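(* Let $s>\frac43$ and $u_0\in H^s(\mathbb T)$. Then there exists $T=T(\|u_0\|_{H^s(\mathbb T)})>0$ such that the Cauchy problem $$\partial_t u+\partial_x^3 u=6|u|^2\partial_x u,\qquad u(0)=u_0,\qquad u(t,x)\in\mathbb C,\ x\in\mathbb T,$$ admits a unique local strong solution $u\in\mathcal C([-T,T],H^s(\mathbb T))$.
   Context: $\mathbb T=\mathbb R/(2\pi\mathbb Z)$; functions are complex valued; $H^s(\mathbb T)$ is the Sobolev space with norm $\|J^su\|_{L^2}$, where $J^s$ is the Fourier multiplier $\widehat{J^sg}(m)=(1+|m|^2)^{s/2}\hat g(m)$. $W(t)$ is the propagator of the linear equation $\partial_tv+\partial_x^3v=0$, i.e. $W(t)u_0(x)=\sum_{k\in\mathbb Z}\widehat{u_0}(k)e^{i(kx+tk^3)}$. For $s>4/3$, a function $u\in\mathcal C([-T,T],H^s(\mathbb T))$ is a strong solution of the Cauchy problem if for each $t\in[-T,T]$ $$u(t)=W(t)u_0+6\int_0^tW(t-t')\big(|u|^2\partial_xu\big)(t')\,dt'$$ in the sense of distributions. Uniqueness is in the whole class of strong solutions in $\mathcal C([-T,T],H^s(\mathbb T))$ (unconditional uniqueness). *)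

theory Defs
  imports "HOL-Analysis.Analysis" "HOL-Library.Periodic_Fun"
begin

text \<open>
  Functions on the torus \<open>\<real>/(2\<pi>\<int>)\<close> are \<open>2\<pi>\<close>-periodic functions on \<open>\<real>\<close>; integrals
  are taken over the fundamental domain \<open>[-\<pi>, \<pi>]\<close>. Elements of \<open>L\<^sup>2\<close> and \<open>H\<^sup>s\<close> are represented
  by functions, and two representatives denote the same element iff they agree a.e.
\<close>

definition torus :: "real measure" where
  "torus = lebesgue_on {-pi..pi}"

abbreviation torus_fun :: "(real \<Rightarrow> complex) \<Rightarrow> bool" where
  "torus_fun f \<equiv> periodic_fun_simple f (2 * pi)"

definition L2_torus :: "(real \<Rightarrow> complex) set" where
  "L2_torus = {f. torus_fun f \<and> f \<in> borel_measurable lebesgue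
                  \<and> integrable torus (\<lambda>x. (cmod (f x))\<^sup>2)}"

definition L2_torus_norm :: "(real \<Rightarrow> complex) \<Rightarrow> real" where
  "L2_torus_norm f = sqrt (\<integral>x. (cmod (f x))\<^sup>2 \<partial>torus)"

definition fourier_coeff :: "(real \<Rightarrow> complex) \<Rightarrow> int \<Rightarrow> complex" where
  "fourier_coeff f m = (\<integral>x. f x * exp (- \<i> * of_int m * of_real x) \<partial>torus) / (2 * pi)"

text \<open>
  \<open>is_J s g h\<close> says that \<open>h\<close> is (a representative of) \<open>J\<^sup>s g\<close>, with \<open>h\<close> in \<open>L\<^sup>2\<close>. It
  determines \<open>h\<close> up to a.e. equality, so the choice made in \<open>J\<close> does not affect norms.
\<close>

definition is_J :: "real \<Rightarrow> (real \<Rightarrow> complex) \<Rightarrow> (real \<Rightarrow> complex) \<Rightarrow> bool" where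
  "is_J s g h \<longleftrightarrow> h \<in> L2_torus \<and>
     (\<forall>m. fourier_coeff h m
            = of_real ((1 + \<bar>real_of_int m\<bar>\<^sup>2) powr (s / 2)) * fourier_coeff g m)"

definition J :: "real \<Rightarrow> (real \<Rightarrow> complex) \<Rightarrow> (real \<Rightarrow> complex)" where
  "J s g = (SOME h. is_J s g h)"

text \<open>For \<open>s < 0\<close> one would have to start from distributions instead of \<open>L\<^sup>2\<close> functions.\<close>

definition Hs_torus :: "real \<Rightarrow> (real \<Rightarrow> complex) set" where
  "Hs_torus s = {g \<in> L2_torus. \<exists>h. is_J s g h}"

definition Hs_norm :: "real \<Rightarrow> (real \<Rightarrow> complex) \<Rightarrow> real" where
  "Hs_norm s g = L2_torus_norm (J s g)"

definition C_Hs :: "real \<Rightarrow> real \<Rightarrow> (real \<Rightarrow> real \<Rightarrow> complex) set" where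
  "C_Hs T s = {u. (\<forall>t\<in>{-T..T}. u t \<in> Hs_torus s) \<and>
     (\<forall>t\<in>{-T..T}. ((\<lambda>t'. Hs_norm s (\<lambda>x. u t' x - u t x)) \<longlongrightarrow> 0) (at t within {-T..T}))}"

definition Dx :: "(real \<Rightarrow> complex) \<Rightarrow> (real \<Rightarrow> complex)" where
  "Dx f = (\<lambda>x. vector_derivative f (at x))"

definition test_fun :: "(real \<Rightarrow> complex) set" where
  "test_fun = {\<phi>. torus_fun \<phi> \<and> (\<forall>n x. (Dx ^^ n) \<phi> differentiable (at x))}"

text \<open>
  The weak derivative \<open>\<partial>\<^sub>x g\<close> (for \<open>s \<ge> 1\<close> it exists in \<open>L\<^sup>2\<close> for all \<open>g\<close> in \<open>H\<^sup>s\<close>); it is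
  determined up to a.e. equality.
\<close>

definition is_weak_deriv :: "(real \<Rightarrow> complex) \<Rightarrow> (real \<Rightarrow> complex) \<Rightarrow> bool" where
  "is_weak_deriv g w \<longleftrightarrow> w \<in> L2_torus \<and>
     (\<forall>\<phi>\<in>test_fun. (\<integral>x. w x * \<phi> x \<partial>torus) = - (\<integral>x. g x * Dx \<phi> x \<partial>torus))"

definition weak_deriv :: "(real \<Rightarrow> complex) \<Rightarrow> (real \<Rightarrow> complex)" where
  "weak_deriv g = (SOME w. is_weak_deriv g w)"

definition nonlin :: "(real \<Rightarrow> complex) \<Rightarrow> (real \<Rightarrow> complex)" where
  "nonlin g = (\<lambda>x. of_real ((cmod (g x))\<^sup>2) * weak_deriv g x)"

text \<open>
  \<open>W t g\<close> is the sum over \<open>k\<close> of \<open>fourier_coeff g k * exp (i (k x + t k^3))\<close> as a distribution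
  in \<open>x\<close>: each term is paired with the test function \<open>\<phi>\<close> before summing.
\<close>

definition W :: "real \<Rightarrow> (real \<Rightarrow> complex) \<Rightarrow> (real \<Rightarrow> complex) \<Rightarrow> complex" where
  "W t g \<phi> = (\<Sum>\<^sub>\<infinity>k::int. \<integral>x. fourier_coeff g k
        * exp (\<i> * (of_int k * of_real x + of_real t * of_int k ^ 3)) * \<phi> x \<partial>torus)"

text \<open>
  The Duhamel formula for
  \<open>\<partial>\<^sub>t u + \<partial>\<^sub>x\<^sup>3 u = 6 |u|\<^sup>2 \<partial>\<^sub>x u\<close>, \<open>u(0) = u\<^sub>0\<close>, as an identity of distributions
  in \<open>x\<close> for each fixed \<open>t\<close>; the distribution-valued time integral is also taken after pairing.
  The interval integral carries the usual sign for \<open>t < 0\<close>.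
\<close>

definition strong_solution ::
    "real \<Rightarrow> real \<Rightarrow> (real \<Rightarrow> complex) \<Rightarrow> (real \<Rightarrow> real \<Rightarrow> complex) \<Rightarrow> bool" where
  "strong_solution s T u0 u \<longleftrightarrow> u \<in> C_Hs T s \<and>
     (\<forall>t\<in>{-T..T}. \<forall>\<phi>\<in>test_fun.
        (\<integral>x. u t x * \<phi> x \<partial>torus)
          = W t u0 \<phi> + 6 * (LBINT t'=ereal 0..ereal t. W (t - t') (nonlin (u t')) \<phi>))"

end

theory Submission
  imports Defs
begin

text \<open>
  In Fourier variables the nonlinearity couples frequencies \<open>x + y + z = k\<close> with the resonance function
  \<open>k\<^sup>3 - x\<^sup>3 - y\<^sup>3 - z\<^sup>3 = 3(x + y)(y + z)(z + x)\<close>. The terms with \<open>x + y = 0\<close> amount to a transport term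
  with speed \<open>6\<parallel>u(t)\<parallel>\<^sup>2\<close> and are removed by a time dependent translation. Among the others, either
  the derivative can be absorbed by the two smaller weights (this is the case when all frequencies
  are comparable, or when \<open>y + z = 0\<close> or \<open>z + x = 0\<close>), or the resonance function is at least a
  multiple of the square of the largest frequency, and integrating by parts in time gains more than
  the derivative that is lost. The gained boundary term is small once it is restricted to large
  frequencies. The resulting normal form is Lipschitz in \<open>H\<^sup>s\<close>, so that two continuous
  solutions with the same data agree by a Gronwall argument. For existence the contraction principle is
  applied to pairs \<open>(a, a')\<close> in \<open>C(H\<^sup>s) \<times> C(H\<^bsup>s-1\<^esup>)\<close>; keeping the derivative as an unknown makes
  each fixed point a solution of the equation itself and not only of its normal form.
\<close>

section \<open>The Hilbert space of square summable sequences\<close>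

text \<open>Estimated directly, the Duhamel term loses a derivative: |u|^2 u_x lies only in H^(s-1),
  and the propagator does not smooth. What the normal form leaves is controlled by a single
  trilinear estimate: two factors go into l1 by Cauchy-Schwarz against the weight \<open>wt\<close>,
  the third stays in l2. Each of the two spares half a power of its bracket, and two halves absorb a
  whole derivative; the remaining power \<open>1/2 - s\<close> must be square summable, which is the
  origin of \<open>s > 1\<close> in the locale. Integration by parts is done coefficient by
  coefficient in the interaction picture: there each coefficient of a solution is differentiable in
  time, while the curve itself is merely continuous in H^s. Had a' been replaced by N(a) inside the
  normal form, its fixed points would be circular: undoing the integration by parts already requires
  a' = N(a). The normal form identity holds, however, for any continuous curve with its derivative,
  so "the second component is the derivative of the first" is a constraint which the iteration
  preserves, and the fixed point then identifies that derivative with N(a).\<close>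

definition l2_bounded :: "('a \<Rightarrow> complex) \<Rightarrow> bool" where
  "l2_bounded f \<longleftrightarrow> (\<exists>C. \<forall>A. finite A \<longrightarrow> L2_set (\<lambda>k. cmod (f k)) A \<le> C)"

typedef 'a ell2 = "{f :: 'a \<Rightarrow> complex. l2_bounded f}"
  morphisms coord Abs_ell2
  by (rule exI[of _ "\<lambda>_. 0"]) (auto simp: l2_bounded_def intro!: exI[of _ 0] simp: L2_set_def)

lemma l2_boundedI: "(\<And>A. finite A \<Longrightarrow> L2_set (\<lambda>k. cmod (f k)) A \<le> C) \<Longrightarrow> l2_bounded f"
  by (auto simp: l2_bounded_def)

lemma l2_bounded_coord [simp]: "l2_bounded (coord f)"
  using coord by auto

lemma coord_Abs_ell2: "l2_bounded f \<Longrightarrow> coord (Abs_ell2 f) = f"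
  by (simp add: Abs_ell2_inverse)

lemma ell2_eqI: "(\<And>k. coord f k = coord g k) \<Longrightarrow> f = g"
  by (metis coord_inject ext)

lemma L2_set_cmod_add:
  "L2_set (\<lambda>k. cmod (f k + g k)) A \<le> L2_set (\<lambda>k. cmod (f k)) A + L2_set (\<lambda>k. cmod (g k)) A"
  by (rule order_trans[OF _ L2_set_triangle_ineq]) (auto intro: L2_set_mono norm_triangle_ineq)

lemma L2_set_cmod_scale:
  "L2_set (\<lambda>k. cmod (c *\<^sub>R f k)) A = \<bar>c\<bar> * L2_set (\<lambda>k. cmod (f k)) A"
  by (simp add: L2_set_right_distrib)

lemma L2_set_sum_le:
  assumes "\<And>i k. i \<in> I \<Longrightarrow> k \<in> A \<Longrightarrow> 0 \<le> f i k"
  shows "L2_set (\<lambda>k. \<Sum>i\<in>I. f i k) A \<le> (\<Sum>i\<in>I. L2_set (f i) A)"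
  using assms
proof (induction I rule: infinite_finite_induct)
  case (insert i I)
  have "L2_set (\<lambda>k. \<Sum>i\<in>insert i I. f i k) A = L2_set (\<lambda>k. f i k + (\<Sum>i\<in>I. f i k)) A"
    using insert by simp
  also have "\<dots> \<le> L2_set (f i) A + L2_set (\<lambda>k. \<Sum>i\<in>I. f i k) A"
    by (rule L2_set_triangle_ineq)
  also have "\<dots> \<le> L2_set (f i) A + (\<Sum>i\<in>I. L2_set (f i) A)"
    using insert by auto
  finally show ?case using insert by simp
qed (auto simp: L2_set_def)

lemma l2_bounded_add: "l2_bounded f \<Longrightarrow> l2_bounded g \<Longrightarrow> l2_bounded (\<lambda>k. f k + g k)"
proof -
  assume "l2_bounded f" "l2_bounded g"
  then obtain C D where
    "\<And>A. finite A \<Longrightarrow> L2_set (\<lambda>k. cmod (f k)) A \<le> C" "\<And>A. finite A \<Longrightarrow> L2_set (\<lambda>k. cmod (g k)) A \<le> D"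
    unfolding l2_bounded_def by blast
  then show ?thesis
    by (intro l2_boundedI[of _ "C + D"] order_trans[OF L2_set_cmod_add add_mono]) auto
qed

lemma l2_bounded_scale: "l2_bounded f \<Longrightarrow> l2_bounded (\<lambda>k. c *\<^sub>R f k)"
  unfolding l2_bounded_def L2_set_cmod_scale by (meson abs_ge_zero mult_left_mono)

lemma l2_bounded_mono:
  assumes "l2_bounded f" "\<And>k. cmod (g k) \<le> cmod (f k)" shows "l2_bounded g"
  using assms unfolding l2_bounded_def by (meson L2_set_mono norm_ge_zero order_trans)

instantiation ell2 :: (type) real_vector
begin

definition zero_ell2 :: "'a ell2" where "0 = Abs_ell2 (\<lambda>_. 0)"
definition plus_ell2 :: "'a ell2 \<Rightarrow> 'a ell2 \<Rightarrow> 'a ell2" where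
  "f + g = Abs_ell2 (\<lambda>k. coord f k + coord g k)"
definition uminus_ell2 :: "'a ell2 \<Rightarrow> 'a ell2" where "- f = Abs_ell2 (\<lambda>k. - coord f k)"
definition minus_ell2 :: "'a ell2 \<Rightarrow> 'a ell2 \<Rightarrow> 'a ell2" where
  "f - g = Abs_ell2 (\<lambda>k. coord f k - coord g k)"
definition scaleR_ell2 :: "real \<Rightarrow> 'a ell2 \<Rightarrow> 'a ell2" where
  "c *\<^sub>R f = Abs_ell2 (\<lambda>k. c *\<^sub>R coord f k)"
lemma coord_zero: "coord 0 k = 0"
  by (simp add: zero_ell2_def coord_Abs_ell2 l2_bounded_def L2_set_def exI[of _ 0])
lemma coord_add: "coord (f + g) k = coord f k + coord g k"
  by (simp add: plus_ell2_def coord_Abs_ell2 l2_bounded_add)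
lemma coord_scaleR: "coord (c *\<^sub>R f) k = c *\<^sub>R coord f k"
  by (simp only: scaleR_ell2_def coord_Abs_ell2 l2_bounded_scale l2_bounded_coord)
lemma coord_uminus: "coord (- f) k = - coord f k"
  using l2_bounded_scale[of "coord f" "-1"] by (simp add: uminus_ell2_def coord_Abs_ell2)
lemma coord_diff: "coord (f - g) k = coord f k - coord g k"
  using l2_bounded_add[of "coord f" "\<lambda>k. (-1) *\<^sub>R coord g k", OF _ l2_bounded_scale]
  by (simp add: minus_ell2_def coord_Abs_ell2)

instance
  by standard (rule ell2_eqI, simp add: coord_zero coord_add coord_scaleR coord_uminus coord_diff algebra_simps)+

end

instantiation ell2 :: (type) real_normed_vector
begin

text \<open>With a supremum over finite sets, every norm bound reduces to a bound for finite sums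
  that is uniform in the set; no summability has to be established beforehand.\<close>

definition norm_ell2 :: "'a ell2 \<Rightarrow> real" where
  "norm f = (SUP A\<in>{A. finite A}. L2_set (\<lambda>k. cmod (coord f k)) A)"
definition dist_ell2 :: "'a ell2 \<Rightarrow> 'a ell2 \<Rightarrow> real" where "dist_ell2 f g = norm (f - g)"
definition sgn_ell2 :: "'a ell2 \<Rightarrow> 'a ell2" where "sgn_ell2 f = inverse (norm f) *\<^sub>R f"
definition uniformity_ell2 :: "('a ell2 \<times> 'a ell2) filter" where
  "uniformity_ell2 = (INF e\<in>{0<..}. principal {(x, y). dist x y < e})"
definition open_ell2 :: "'a ell2 set \<Rightarrow> bool" where
  "open_ell2 U \<longleftrightarrow> (\<forall>x\<in>U. eventually (\<lambda>(x', y). x' = x \<longrightarrow> y \<in> U) uniformity)"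

lemma L2_set_coord_le_norm: "finite A \<Longrightarrow> L2_set (\<lambda>k. cmod (coord f k)) A \<le> norm f"
  unfolding norm_ell2_def
  by (rule cSUP_upper) (use l2_bounded_coord[of f] in \<open>auto simp: l2_bounded_def bdd_above_def\<close>)

lemma norm_ell2_leI: "(\<And>A. finite A \<Longrightarrow> L2_set (\<lambda>k. cmod (coord f k)) A \<le> C) \<Longrightarrow> norm f \<le> C"
  unfolding norm_ell2_def by (rule cSUP_least) auto

lemma cmod_coord_le_norm: "cmod (coord f k) \<le> norm f"
  using L2_set_coord_le_norm[of "{k}" f] by simp

instance
proof
  fix f g :: "'a ell2" and c d :: real
  show "dist f g = norm (f - g)" by (rule dist_ell2_def)
  show "sgn f = f /\<^sub>R norm f" by (rule sgn_ell2_def)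
  show "uniformity = (INF e\<in>{0<..}. principal {(x::'a ell2, y). dist x y < e})"
    by (rule uniformity_ell2_def)
  show "open U = (\<forall>x\<in>U. \<forall>\<^sub>F (x', y) in uniformity. x' = x \<longrightarrow> y \<in> U)" for U :: "'a ell2 set"
    by (rule open_ell2_def)
  \<comment> \<open>Types are inhabited, so \<open>undefined\<close> can serve as an index.\<close>
  have nonneg: "norm f \<ge> 0" for f :: "'a ell2"
    using cmod_coord_le_norm[of f undefined] by (meson norm_ge_zero order_trans)
  show "(norm f = 0) \<longleftrightarrow> f = 0"
  proof
    assume "norm f = 0"
    then show "f = 0" by (intro ell2_eqI) (metis cmod_coord_le_norm coord_zero norm_le_zero_iff)
  next
    assume "f = 0"
    then have "norm f \<le> 0" by (intro norm_ell2_leI) (simp add: coord_zero L2_set_def)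
    with nonneg show "norm f = 0" by (meson antisym)
  qed
  show "norm (f + g) \<le> norm f + norm g"
    by (intro norm_ell2_leI, simp only: coord_add)
      (intro order_trans[OF L2_set_cmod_add add_mono] L2_set_coord_le_norm)
  have scale_le: "norm (c *\<^sub>R f) \<le> \<bar>c\<bar> * norm f" for c and f :: "'a ell2"
    by (intro norm_ell2_leI, simp only: coord_scaleR L2_set_cmod_scale)
      (simp add: L2_set_coord_le_norm mult_left_mono)
  show "norm (c *\<^sub>R f) = \<bar>c\<bar> * norm f"
  proof (rule antisym[OF scale_le])
    show "\<bar>c\<bar> * norm f \<le> norm (c *\<^sub>R f)"
    proof (cases "c = 0")
      case False
      have "inverse c *\<^sub>R (c *\<^sub>R f) = f"
        using False by (intro ell2_eqI) (simp add: coord_scaleR)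
      then show ?thesis
        using scale_le[of "inverse c" "c *\<^sub>R f"] False
        by (simp add: field_simps)
    qed (use nonneg in simp)
  qed
qed

end

lemmas coord_simps [simp] = coord_zero coord_add coord_diff coord_uminus coord_scaleR

lemma L2_set_tendsto:
  assumes "\<And>k. k \<in> A \<Longrightarrow> ((\<lambda>x. f x k) \<longlongrightarrow> g k) F"
  shows "((\<lambda>x. L2_set (f x) A) \<longlongrightarrow> L2_set g A) F"
  unfolding L2_set_def using assms by (intro tendsto_intros)

instance ell2 :: (type) banach
proof
  fix X :: "nat \<Rightarrow> 'a ell2"
  assume X: "Cauchy X"
  have "Cauchy (\<lambda>n. coord (X n) k)" for k
  proof (rule metric_CauchyI)
    fix e :: real assume "e > 0"
    then obtain M where M: "\<And>m n. m \<ge> M \<Longrightarrow> n \<ge> M \<Longrightarrow> dist (X m) (X n) < e"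
      using metric_CauchyD[OF X] by blast
    then show "\<exists>M. \<forall>m\<ge>M. \<forall>n\<ge>M. dist (coord (X m) k) (coord (X n) k) < e"
      by (intro exI[of _ M]) (metis cmod_coord_le_norm coord_diff dist_norm le_less_trans)
  qed
  then have "\<exists>l. (\<lambda>n. coord (X n) k) \<longlonglongrightarrow> l" for k
    by (simp add: Cauchy_convergent_iff convergent_def)
  then obtain g where g: "\<And>k. (\<lambda>n. coord (X n) k) \<longlonglongrightarrow> g k" by metis
  \<comment> \<open>The index \<open>M\<close> depends on \<open>e\<close> alone. For each fixed
    finite \<open>A\<close> the second index is sent to infinity afterwards, which keeps the bound
    uniform in \<open>A\<close>.\<close>
  have tail: "\<exists>M. \<forall>n\<ge>M. \<forall>A. finite A \<longrightarrow> L2_set (\<lambda>k. cmod (coord (X n) k - g k)) A \<le> e"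
    if e: "e > 0" for e :: real
  proof -
    obtain M where M: "\<And>m n. m \<ge> M \<Longrightarrow> n \<ge> M \<Longrightarrow> norm (X m - X n) < e"
      using CauchyD[OF X e] by blast
    have "L2_set (\<lambda>k. cmod (coord (X n) k - g k)) A \<le> e" if "n \<ge> M" "finite A" for n A
    proof (rule tendsto_upperbound)
      show "((\<lambda>m. L2_set (\<lambda>k. cmod (coord (X n) k - coord (X m) k)) A)
              \<longlongrightarrow> L2_set (\<lambda>k. cmod (coord (X n) k - g k)) A) sequentially"
        by (intro L2_set_tendsto tendsto_intros g)
      show "\<forall>\<^sub>F m in sequentially. L2_set (\<lambda>k. cmod (coord (X n) k - coord (X m) k)) A \<le> e"
        using eventually_ge_at_top[of M]
      proof eventually_elim
        case (elim m)
        then show ?case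
          using L2_set_coord_le_norm[OF \<open>finite A\<close>, of "X n - X m"] M[OF \<open>n \<ge> M\<close> elim] by simp
      qed
    qed simp
    then show ?thesis by blast
  qed
  obtain M where M: "\<And>A. finite A \<Longrightarrow> L2_set (\<lambda>k. cmod (coord (X M) k - g k)) A \<le> 1"
    using tail[of 1] by auto
  have "l2_bounded (\<lambda>k. coord (X M) k - g k)"
    by (rule l2_boundedI[of _ 1]) (rule M)
  then have "l2_bounded (\<lambda>k. coord (X M) k + (-1) *\<^sub>R (coord (X M) k - g k))"
    by (intro l2_bounded_add l2_bounded_scale) auto
  then have "l2_bounded g" by simp
  then have cg: "coord (Abs_ell2 g) = g" by (rule coord_Abs_ell2)
  have "X \<longlonglongrightarrow> Abs_ell2 g"
  proof (rule metric_LIMSEQ_I)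
    fix e :: real assume "e > 0"
    then obtain M where M: "\<And>n A. n \<ge> M \<Longrightarrow> finite A \<Longrightarrow> L2_set (\<lambda>k. cmod (coord (X n) k - g k)) A \<le> e / 2"
      using tail[of "e/2"] by auto
    have "norm (X n - Abs_ell2 g) \<le> e / 2" if "n \<ge> M" for n
      by (rule norm_ell2_leI) (use M[OF that] cg in simp)
    then show "\<exists>M. \<forall>n\<ge>M. dist (X n) (Abs_ell2 g) < e"
      using \<open>e > 0\<close> by (intro exI[of _ M]) (fastforce simp: dist_norm)
  qed
  then show "convergent X" by (auto simp: convergent_def)
qed

lemma bounded_linear_coord: "bounded_linear (\<lambda>f. coord f k)"
  by (rule bounded_linear_intro[of _ 1]) (auto simp: cmod_coord_le_norm)

lemmas continuous_on_coord [continuous_intros] =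
  bounded_linear.continuous_on[OF bounded_linear_coord]
lemmas tendsto_coord [tendsto_intros] = bounded_linear.tendsto[OF bounded_linear_coord]

lemma has_sum_coord_power2: "((\<lambda>k. (cmod (coord f k))\<^sup>2) has_sum (norm f)\<^sup>2) UNIV"
proof -
  let ?s = "\<lambda>k. (cmod (coord f k))\<^sup>2"
  have le: "sum ?s A \<le> (norm f)\<^sup>2" if "finite A" for A
    using power_mono[OF L2_set_coord_le_norm[OF that, of f], of 2]
    by (simp add: L2_set_def sum_nonneg)
  have summ: "?s summable_on UNIV"
    by (rule nonneg_bounded_partial_sums_imp_summable_on[where C="(norm f)\<^sup>2"])
      (auto intro!: eventually_finite_subsets_at_top_weakI le)
  have "infsum ?s UNIV \<le> (norm f)\<^sup>2"
    by (rule infsum_le_finite_sums[OF summ]) (use le in auto)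
  moreover have "norm f \<le> sqrt (infsum ?s UNIV)"
  proof (rule norm_ell2_leI)
    fix A :: "'a set" assume "finite A"
    then show "L2_set (\<lambda>k. cmod (coord f k)) A \<le> sqrt (infsum ?s UNIV)"
      unfolding L2_set_def by (intro real_sqrt_le_mono finite_sum_le_infsum summ) auto
  qed
  then have "(norm f)\<^sup>2 \<le> infsum ?s UNIV"
    by (metis infsum_nonneg norm_ge_zero power_mono real_sqrt_pow2 zero_le_power2)
  ultimately show ?thesis using summ by (metis antisym has_sum_infsum)
qed

lemma sum_coord_mult_le:
  assumes "finite A"
  shows "(\<Sum>k\<in>A. cmod (coord f k) * cmod (coord g k)) \<le> norm f * norm g"
proof -
  have "(\<Sum>k\<in>A. \<bar>cmod (coord f k)\<bar> * \<bar>cmod (coord g k)\<bar>)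
      \<le> L2_set (\<lambda>k. cmod (coord f k)) A * L2_set (\<lambda>k. cmod (coord g k)) A"
    by (rule L2_set_mult_ineq)
  also have "\<dots> \<le> norm f * norm g"
    by (intro mult_mono L2_set_coord_le_norm assms) auto
  finally show ?thesis by simp
qed

lemma norm_ell2_mono:
  assumes "\<And>k. cmod (coord f k) \<le> cmod (coord g k)" shows "norm f \<le> norm g"
  by (intro norm_ell2_leI order_trans[OF _ L2_set_coord_le_norm[of _ g]]) (auto intro: L2_set_mono assms)

section \<open>Japanese brackets and summation along symmetric boxes\<close>

definition jap :: "int \<Rightarrow> real" where "jap k = sqrt (1 + (real_of_int k)\<^sup>2)"

lemma jap_ge_1: "1 \<le> jap k" and jap_pos [simp]: "0 < jap k" and jap_nonneg [simp]: "0 \<le> jap k"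
  by (auto simp: jap_def add_pos_nonneg)

lemma jap_ne_0 [simp]: "jap k \<noteq> 0"
  using jap_pos[of k] by linarith

lemma jap_uminus [simp]: "jap (- k) = jap k"
  by (simp add: jap_def)

lemma abs_le_jap: "\<bar>real_of_int k\<bar> \<le> jap k"
  unfolding jap_def by (rule real_le_rsqrt) simp

lemma jap_powr_eq: "(1 + \<bar>real_of_int k\<bar>\<^sup>2) powr (r / 2) = jap k powr r"
  by (simp add: jap_def powr_half_sqrt[symmetric] powr_powr add_nonneg_nonneg)

lemma jap_powr_le_1: "r \<le> 0 \<Longrightarrow> jap k powr r \<le> 1"
  using powr_mono[of r 0 "jap k"] jap_ge_1[of k] by simp

text \<open>Unordered sums converge along the filter of finite sets, whereas dominated convergence
  works with sequences. Finite sets that eventually capture every index mediate between the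
  two.\<close>

lemma has_sum_exhaustion:
  fixes f :: "'a \<Rightarrow> 'b::{comm_monoid_add,topological_space}"
  assumes f: "(f has_sum S) UNIV" and fin: "\<And>n. finite (I n)"
    and ex: "\<And>x. \<forall>\<^sub>F n in sequentially. x \<in> I n"
  shows "(\<lambda>n. sum f (I n)) \<longlonglongrightarrow> S"
proof -
  have "filterlim I (finite_subsets_at_top UNIV) sequentially"
    unfolding filterlim_finite_subsets_at_top
  proof (intro allI impI)
    fix X :: "'a set" assume "finite X \<and> X \<subseteq> UNIV"
    then have "\<forall>\<^sub>F n in sequentially. \<forall>x\<in>X. x \<in> I n"
      by (intro eventually_ball_finite) (auto simp: ex)
    then show "\<forall>\<^sub>F n in sequentially. finite (I n) \<and> X \<subseteq> I n \<and> I n \<subseteq> UNIV"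
      by eventually_elim (auto simp: fin)
  qed
  then show ?thesis using f unfolding has_sum_def by (rule filterlim_compose[rotated])
qed

lemma eventually_mem_symmetric: "\<forall>\<^sub>F n in sequentially. x \<in> {- int n..int n}"
  by (rule eventually_sequentiallyI[of "nat \<bar>x\<bar>"]) auto

lemma has_sum_int_symmetric:
  fixes f :: "int \<Rightarrow> 'b::{comm_monoid_add,topological_space}"
  shows "(f has_sum S) UNIV \<Longrightarrow> (\<lambda>n. \<Sum>k\<in>{- int n..int n}. f k) \<longlonglongrightarrow> S"
  by (erule has_sum_exhaustion) (auto simp only: finite_atLeastAtMost_int eventually_mem_symmetric)

lemma has_sum_int_pair_symmetric:
  fixes f :: "int \<times> int \<Rightarrow> 'b::{comm_monoid_add,topological_space}"
  shows "(f has_sum S) UNIV \<Longrightarrow> (\<lambda>n. \<Sum>p\<in>{- int n..int n}\<times>{- int n..int n}. f p) \<longlonglongrightarrow> S"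
  by (erule has_sum_exhaustion)
    (auto simp only: finite_cartesian_product finite_atLeastAtMost_int mem_Times_iff
      intro!: eventually_conj eventually_mem_symmetric)

section \<open>Diagonal operators\<close>

definition phase :: "('a \<Rightarrow> real) \<Rightarrow> 'a ell2 \<Rightarrow> 'a ell2" where
  "phase \<theta> f = Abs_ell2 (\<lambda>k. cis (\<theta> k) * coord f k)"

lemma coord_phase [simp]: "coord (phase \<theta> f) k = cis (\<theta> k) * coord f k"
proof -
  have "l2_bounded (\<lambda>k. cis (\<theta> k) * coord f k)"
    by (rule l2_bounded_mono[OF l2_bounded_coord[of f]]) (simp add: norm_mult)
  then show ?thesis by (simp add: phase_def coord_Abs_ell2)
qed

lemma norm_phase [simp]: "norm (phase \<theta> f) = norm f"
  by (intro antisym norm_ell2_mono) (auto simp: norm_mult)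

lemma phase_diff: "phase \<theta> (f - g) = phase \<theta> f - phase \<theta> g"
  by (rule ell2_eqI) (simp add: algebra_simps)

lemma phase_phase: "phase \<theta> (phase \<eta> f) = phase (\<lambda>k. \<theta> k + \<eta> k) f"
  by (rule ell2_eqI) (simp add: cis_mult[symmetric])

lemma phase_zero [simp]: "phase (\<lambda>k. 0) f = f"
  by (rule ell2_eqI) simp

definition diag :: "('a \<Rightarrow> real) \<Rightarrow> 'a ell2 \<Rightarrow> 'a ell2" where
  "diag m f = Abs_ell2 (\<lambda>k. of_real (m k) * coord f k)"

lemma
  assumes m: "\<And>k. \<bar>m k\<bar> \<le> 1"
  shows coord_diag: "coord (diag m f) k = of_real (m k) * coord f k"
    and norm_diag_le: "norm (diag m f) \<le> norm f"
    and diag_diff: "diag m (f - g) = diag m f - diag m g"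
proof -
  have le: "cmod (of_real (m k) * coord f k) \<le> cmod (coord f k)" for f k
    using m[of k] by (simp add: norm_mult mult_left_le_one_le)
  have c: "coord (diag m f) k = of_real (m k) * coord f k" for f k
    unfolding diag_def by (subst coord_Abs_ell2) (auto intro: l2_bounded_mono[OF l2_bounded_coord le])
  then show "coord (diag m f) k = of_real (m k) * coord f k" by simp
  show "norm (diag m f) \<le> norm f" by (rule norm_ell2_mono) (simp add: c le)
  show "diag m (f - g) = diag m f - diag m g" by (rule ell2_eqI) (simp add: c right_diff_distrib)
qed

lemma continuous_on_diag:
  assumes m: "\<And>k. \<bar>m k\<bar> \<le> 1" and f: "continuous_on S f"
  shows "continuous_on S (\<lambda>t. diag m (f t))"
proof -
  have "continuous_on UNIV (diag m)"
  proof (rule lipschitz_on_continuous_on)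
    show "1-lipschitz_on UNIV (diag m)"
      by (rule lipschitz_onI) (auto simp: dist_norm diag_diff[OF m, symmetric] norm_diag_le[OF m])
  qed
  then show ?thesis by (rule continuous_on_compose2[OF _ f]) auto
qed

definition proj :: "'a set \<Rightarrow> 'a ell2 \<Rightarrow> 'a ell2" where
  "proj A f = Abs_ell2 (\<lambda>k. if k \<in> A then coord f k else 0)"

lemma coord_proj [simp]: "coord (proj A f) k = (if k \<in> A then coord f k else 0)"
proof -
  have "l2_bounded (\<lambda>k. if k \<in> A then coord f k else 0)"
    by (rule l2_bounded_mono[OF l2_bounded_coord[of f]]) simp
  then show ?thesis by (simp add: proj_def coord_Abs_ell2)
qed

text \<open>Pythagoras. Tails are thereby read off from partial sums, both for the density of finite
  sequences and for Parseval.\<close>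

lemma norm_minus_proj_power2:
  assumes "finite A"
  shows "(norm (f - proj A f))\<^sup>2 = (norm f)\<^sup>2 - (\<Sum>k\<in>A. (cmod (coord f k))\<^sup>2)"
proof -
  have "((\<lambda>k. (if k \<in> A then (cmod (coord f k))\<^sup>2 else 0)) has_sum (\<Sum>k\<in>A. (cmod (coord f k))\<^sup>2)) UNIV"
    using has_sum_finite[OF assms, of "\<lambda>k. (cmod (coord f k))\<^sup>2"]
    by (subst has_sum_cong_neutral[where T=A and g="\<lambda>k. (cmod (coord f k))\<^sup>2"]) auto
  from has_sum_add[OF has_sum_coord_power2 has_sum_uminusI[OF this]]
  have "((\<lambda>k. (cmod (coord f k))\<^sup>2 + - (if k \<in> A then (cmod (coord f k))\<^sup>2 else 0)) has_sum
    ((norm f)\<^sup>2 + - (\<Sum>k\<in>A. (cmod (coord f k))\<^sup>2))) UNIV" .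
  moreover have "(\<lambda>k. (cmod (coord f k))\<^sup>2 + - (if k \<in> A then (cmod (coord f k))\<^sup>2 else 0)) =
      (\<lambda>k. (cmod (coord (f - proj A f) k))\<^sup>2)"
    by (intro ext) simp
  ultimately have "((\<lambda>k. (cmod (coord (f - proj A f) k))\<^sup>2) has_sum
    ((norm f)\<^sup>2 - (\<Sum>k\<in>A. (cmod (coord f k))\<^sup>2))) UNIV"
    by simp
  then show ?thesis using has_sum_coord_power2 by (rule has_sum_unique[symmetric])
qed

lemma ex_proj_close:
  assumes "e > 0" shows "\<exists>A. finite A \<and> norm (f - proj A f) < e"
proof -
  have "\<forall>\<^sub>F A in finite_subsets_at_top UNIV. dist (\<Sum>k\<in>A. (cmod (coord f k))\<^sup>2) ((norm f)\<^sup>2) < e\<^sup>2"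
    using has_sum_coord_power2[of f] assms unfolding has_sum_def by (intro tendstoD) auto
  then obtain A where A: "finite A" "dist (\<Sum>k\<in>A. (cmod (coord f k))\<^sup>2) ((norm f)\<^sup>2) < e\<^sup>2"
    unfolding eventually_finite_subsets_at_top by blast
  then have "(norm (f - proj A f))\<^sup>2 < e\<^sup>2"
    unfolding norm_minus_proj_power2[OF A(1)] dist_real_def by linarith
  then show ?thesis using A(1) assms by (meson less_eq_real_def power_less_imp_less_base)
qed

lemma norm_le_sum_coord:
  assumes "finite A" "\<And>k. k \<notin> A \<Longrightarrow> coord f k = 0"
  shows "norm f \<le> (\<Sum>k\<in>A. cmod (coord f k))"
proof (rule norm_ell2_leI)
  fix B :: "'a set" assume B: "finite B"
  have "L2_set (\<lambda>k. cmod (coord f k)) B \<le> (\<Sum>k\<in>B. cmod (coord f k))"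
    by (rule L2_set_le_sum) simp
  also have "\<dots> = (\<Sum>k\<in>B \<inter> A. cmod (coord f k))"
    using B assms(2) by (intro sum.mono_neutral_right) auto
  also have "\<dots> \<le> (\<Sum>k\<in>A. cmod (coord f k))"
    using assms(1) by (intro sum_mono2) auto
  finally show "L2_set (\<lambda>k. cmod (coord f k)) B \<le> (\<Sum>k\<in>A. cmod (coord f k))" .
qed

lemma norm_triangle4:
  "norm (a + b + c - d) \<le> norm a + norm b + norm c + norm (d :: 'a::real_normed_vector)"
  by (smt (verit) norm_triangle_ineq norm_triangle_ineq4)

text \<open>The phases converge for each \<open>k\<close> but not uniformly (think of
  \<open>t * k^3\<close>). Since phases are isometries, \<open>f0\<close> may be replaced by a
  finite truncation, on which pointwise convergence is enough.\<close>

lemma tendsto_phase: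
  assumes \<theta>: "\<And>k. ((\<lambda>t. \<theta> t k) \<longlongrightarrow> \<theta>0 k) F" and f: "(f \<longlongrightarrow> f0) F"
  shows "((\<lambda>t. phase (\<theta> t) (f t)) \<longlongrightarrow> phase \<theta>0 f0) F"
proof (rule tendstoI)
  fix e :: real assume e: "e > 0"
  obtain A where A: "finite A" "norm (f0 - proj A f0) < e / 4"
    using ex_proj_close[of "e/4" f0] e by auto
  have "((\<lambda>t. \<Sum>k\<in>A. cmod (cis (\<theta> t k) - cis (\<theta>0 k)) * cmod (coord f0 k)) \<longlongrightarrow>
     (\<Sum>k\<in>A. cmod (cis (\<theta>0 k) - cis (\<theta>0 k)) * cmod (coord f0 k))) F"
    unfolding cis_conv_exp by (intro tendsto_intros \<theta>)
  then have "((\<lambda>t. \<Sum>k\<in>A. cmod (cis (\<theta> t k) - cis (\<theta>0 k)) * cmod (coord f0 k)) \<longlongrightarrow> 0) F"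
    by simp
  from order_tendstoD(2)[OF this, of "e/4"] have
    "\<forall>\<^sub>F t in F. (\<Sum>k\<in>A. cmod (cis (\<theta> t k) - cis (\<theta>0 k)) * cmod (coord f0 k)) < e / 4"
    using e by simp
  moreover have "\<forall>\<^sub>F t in F. dist (f t) f0 < e / 4"
    using tendstoD[OF f, of "e/4"] e by simp
  ultimately show "\<forall>\<^sub>F t in F. dist (phase (\<theta> t) (f t)) (phase \<theta>0 f0) < e"
  proof eventually_elim
    case (elim t)
    let ?p = "proj A f0"
    have "norm (phase (\<theta> t) ?p - phase \<theta>0 ?p) \<le>
        (\<Sum>k\<in>A. cmod (coord (phase (\<theta> t) ?p - phase \<theta>0 ?p) k))"
      by (rule norm_le_sum_coord[OF A(1)]) simp
    also have "\<dots> = (\<Sum>k\<in>A. cmod (cis (\<theta> t k) - cis (\<theta>0 k)) * cmod (coord f0 k))"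
      by (intro sum.cong) (auto simp: norm_mult[symmetric] algebra_simps)
    finally have 1: "norm (phase (\<theta> t) ?p - phase \<theta>0 ?p) < e / 4" using elim by linarith
    have "phase (\<theta> t) (f t) - phase \<theta>0 f0 = phase (\<theta> t) (f t - f0)
       + phase (\<theta> t) (f0 - ?p) + (phase (\<theta> t) ?p - phase \<theta>0 ?p) - phase \<theta>0 (f0 - ?p)"
      by (simp add: phase_diff)
    also have "norm \<dots> \<le> norm (f t - f0) + norm (f0 - ?p)
       + norm (phase (\<theta> t) ?p - phase \<theta>0 ?p) + norm (f0 - ?p)"
      by (rule order_trans[OF norm_triangle4]) simp
    also have "\<dots> < e" using 1 A(2) elim by (simp add: dist_norm)
    finally show ?case by (simp add: dist_norm)
  qed
qed

lemma continuous_on_phase: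
  assumes "\<And>k. continuous_on S (\<lambda>t. \<theta> t k)" "continuous_on S f"
  shows "continuous_on S (\<lambda>t. phase (\<theta> t) (f t))"
  using assms unfolding continuous_on_def by (auto intro!: tendsto_phase)

text \<open>The coefficient sequence of the complex conjugate. With it |u|^2 u_x becomes trilinear
  in u, its conjugate and u_x, and all output frequencies are plain sums.\<close>

definition reflect :: "int ell2 \<Rightarrow> int ell2" where
  "reflect f = Abs_ell2 (\<lambda>k. cnj (coord f (- k)))"

lemma coord_reflect [simp]: "coord (reflect f) k = cnj (coord f (- k))"
  and norm_reflect [simp]: "norm (reflect f) = norm f"
proof -
  have L: "L2_set (\<lambda>k. cmod (cnj (coord f (- k)))) A \<le> norm f" if "finite A" for f :: "int ell2" and A
  proof -
    have "L2_set (\<lambda>k. cmod (cnj (coord f (- k)))) A = L2_set (\<lambda>k. cmod (coord f k)) (uminus ` A)"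
      unfolding L2_set_def by (subst sum.reindex) (auto simp: inj_on_def)
    also have "\<dots> \<le> norm f" using that by (intro L2_set_coord_le_norm) auto
    finally show ?thesis .
  qed
  have c: "coord (reflect f) k = cnj (coord f (- k))" for f k
    unfolding reflect_def by (subst coord_Abs_ell2) (auto intro: l2_boundedI L)
  show "coord (reflect f) k = cnj (coord f (- k))" by (rule c)
  have le: "norm (reflect f) \<le> norm f" for f
    by (rule norm_ell2_leI) (use L in \<open>simp add: c\<close>)
  have "reflect (reflect f) = f" by (rule ell2_eqI) (simp add: c)
  then show "norm (reflect f) = norm f" using le[of f] le[of "reflect f"] by simp
qed

lemma reflect_diff: "reflect (f - g) = reflect f - reflect g"
  by (rule ell2_eqI) simp

lemma tendsto_reflect [tendsto_intros]:
  "(f \<longlongrightarrow> f0) F \<Longrightarrow> ((\<lambda>t. reflect (f t)) \<longlongrightarrow> reflect f0) F"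
  by (simp add: tendsto_iff dist_norm reflect_diff[symmetric])

lemma continuous_on_reflect [continuous_intros]:
  "continuous_on S f \<Longrightarrow> continuous_on S (\<lambda>t. reflect (f t))"
  unfolding continuous_on_def by (auto intro!: tendsto_intros)

section \<open>Trilinear Fourier multipliers\<close>

locale regularity =
  fixes s :: real
  assumes s_gt_1: "s > 1"
begin

text \<open>Half a power above \<open>jap k powr (- s)\<close>: a product of two such weights has a
  full derivative to spend. Square summability is the condition
  \<open>2 * s - 1 > 1\<close>.\<close>

definition wt :: "int \<Rightarrow> real" where "wt k = jap k powr (1 / 2 - s)"

lemma wt_nonneg [simp]: "0 \<le> wt k"
  by (simp add: wt_def)

lemma sum_wt_power2_bounded: "\<exists>C. \<forall>A. finite A \<longrightarrow> (\<Sum>k\<in>A. (wt k)\<^sup>2) \<le> C"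
proof -
  \<comment> \<open>The value at 0 is set by hand because \<open>0 powr _\<close> is 0, while
    \<open>wt 0\<close> is 1.\<close>
  define v where "v n = (if n = 0 then 1 else real n powr (1 - 2 * s))" for n :: nat
  have sv: "summable v"
  proof -
    have "summable (\<lambda>n. real n powr (1 - 2 * s))"
      using s_gt_1 by (simp add: summable_real_powr_iff)
    then show ?thesis
      by (rule summable_comparison_test_ev[rotated])
        (auto simp: v_def eventually_sequentially intro!: exI[of _ 1])
  qed
  have v0: "v n \<ge> 0" for n by (simp add: v_def)
  have le: "(wt k)\<^sup>2 \<le> v (nat \<bar>k\<bar>)" for k
  proof -
    have "(wt k)\<^sup>2 = jap k powr (1 - 2 * s)"
      by (simp add: wt_def power2_eq_square flip: powr_add)
    also have "\<dots> \<le> v (nat \<bar>k\<bar>)"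
    proof (cases "k = 0")
      case True
      then show ?thesis by (simp add: v_def jap_def)
    next
      case False
      then have "jap k powr (1 - 2 * s) \<le> \<bar>real_of_int k\<bar> powr (1 - 2 * s)"
        using s_gt_1 abs_le_jap[of k] by (intro powr_mono2') auto
      then show ?thesis using False by (simp add: v_def)
    qed
    finally show ?thesis .
  qed
  have "(\<Sum>k\<in>A. (wt k)\<^sup>2) \<le> suminf v + suminf v" if "finite A" for A :: "int set"
  proof -
    have *: "(\<Sum>k\<in>B. v (nat \<bar>k\<bar>)) \<le> suminf v" if "finite B" "inj_on (\<lambda>k. nat \<bar>k\<bar>) B" for B :: "int set"
    proof -
      have "(\<Sum>k\<in>B. v (nat \<bar>k\<bar>)) = sum v ((\<lambda>k. nat \<bar>k\<bar>) ` B)"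
        using that by (simp add: sum.reindex)
      also have "\<dots> \<le> suminf v" using sv that v0 by (intro sum_le_suminf) auto
      finally show ?thesis .
    qed
    have "(\<Sum>k\<in>A. (wt k)\<^sup>2) \<le> (\<Sum>k\<in>A. v (nat \<bar>k\<bar>))" by (rule sum_mono) (rule le)
    also have "\<dots> = (\<Sum>k\<in>A \<inter> {0..}. v (nat \<bar>k\<bar>)) + (\<Sum>k\<in>A \<inter> {..<0}. v (nat \<bar>k\<bar>))"
      using that by (subst sum.union_disjoint[symmetric]) (auto intro!: sum.cong)
    also have "\<dots> \<le> suminf v + suminf v"
      using that by (intro add_mono *) (auto simp: inj_on_def)
    finally show ?thesis .
  qed
  then show ?thesis by blast
qed

definition wtv :: "int ell2" where "wtv = Abs_ell2 (\<lambda>k. of_real (wt k))"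

lemma coord_wtv [simp]: "coord wtv k = of_real (wt k)"
proof -
  obtain C where "\<And>A. finite A \<Longrightarrow> (\<Sum>k\<in>A. (wt k)\<^sup>2) \<le> C"
    using sum_wt_power2_bounded by blast
  then have "l2_bounded (\<lambda>k. of_real (wt k))"
    by (intro l2_boundedI[of _ "sqrt C"]) (auto simp: L2_set_def)
  then show ?thesis by (simp add: wtv_def coord_Abs_ell2)
qed

definition kap :: real where "kap = (norm wtv)\<^sup>2"

lemma kap_nonneg [simp]: "0 \<le> kap" by (simp add: kap_def)

lemma sum_wt_coord_le:
  assumes "finite A" shows "(\<Sum>k\<in>A. wt k * cmod (coord f k)) \<le> norm wtv * norm f"
  using sum_coord_mult_le[OF assms, of wtv f] by simp

text \<open>Young's inequality l1 * l1 * l2 into l2. For a fixed pair the last factor is a translate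
  of \<open>h\<close>, whose norm does not depend on the shift; the sums over the weighted factors
  are then bounded by Cauchy-Schwarz with \<open>wtv\<close>.\<close>

lemma young_sum:
  assumes A: "finite A" and Q: "finite Q"
  shows "L2_set (\<lambda>k. \<Sum>p\<in>Q\<times>Q. (wt (fst p) * cmod (coord f (fst p))) *
      (wt (snd p) * cmod (coord g (snd p))) * cmod (coord h (k - fst p - snd p))) A
    \<le> kap * norm f * norm g * norm h"
proof -
  let ?c = "\<lambda>p. (wt (fst p) * cmod (coord f (fst p))) * (wt (snd p) * cmod (coord g (snd p)))"
  have "L2_set (\<lambda>k. \<Sum>p\<in>Q\<times>Q. ?c p * cmod (coord h (k - fst p - snd p))) A
    \<le> (\<Sum>p\<in>Q\<times>Q. L2_set (\<lambda>k. ?c p * cmod (coord h (k - fst p - snd p))) A)"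
    by (rule L2_set_sum_le) simp
  also have "\<dots> \<le> (\<Sum>p\<in>Q\<times>Q. ?c p * norm h)"
  proof (rule sum_mono)
    fix p :: "int \<times> int"
    have "L2_set (\<lambda>k. cmod (coord h (k - fst p - snd p))) A =
        L2_set (\<lambda>k. cmod (coord h k)) ((\<lambda>k. k - fst p - snd p) ` A)"
      unfolding L2_set_def by (subst sum.reindex) (auto simp: inj_on_def)
    also have "\<dots> \<le> norm h" using A by (intro L2_set_coord_le_norm) auto
    finally show "L2_set (\<lambda>k. ?c p * cmod (coord h (k - fst p - snd p))) A \<le> ?c p * norm h"
      by (subst L2_set_right_distrib[symmetric]) (auto intro!: mult_left_mono)
  qed
  also have "\<dots> = (\<Sum>k\<in>Q. wt k * cmod (coord f k)) * (\<Sum>k\<in>Q. wt k * cmod (coord g k)) * norm h"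
    by (simp add: sum_product sum.cartesian_product case_prod_beta flip: sum_distrib_right)
  also have "\<dots> \<le> (norm wtv * norm f) * (norm wtv * norm g) * norm h"
    using Q by (intro mult_mono sum_wt_coord_le mult_nonneg_nonneg sum_nonneg) auto
  also have "\<dots> = kap * norm f * norm g * norm h" by (simp add: kap_def power2_eq_square)
  finally show ?thesis .
qed

text \<open>Each of the three products names the two factors that go into l1; the absent one stays
  in l2 and is typically that of highest frequency. Adding all three avoids ordering the
  frequencies.\<close>

definition sym_bound :: "real \<Rightarrow> (int \<Rightarrow> int \<Rightarrow> int \<Rightarrow> complex) \<Rightarrow> bool" where
  "sym_bound C M \<longleftrightarrow> C \<ge> 0 \<and>
     (\<forall>x y z. cmod (M x y z) \<le> C * (wt x * wt y + wt y * wt z + wt x * wt z))"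

definition tri_term :: "(int \<Rightarrow> int \<Rightarrow> int \<Rightarrow> complex) \<Rightarrow> int ell2 \<Rightarrow> int ell2 \<Rightarrow> int ell2 \<Rightarrow>
    int \<Rightarrow> int \<times> int \<Rightarrow> complex" where
  "tri_term M f g h k p = M (fst p) (snd p) (k - fst p - snd p) * coord f (fst p) *
     coord g (snd p) * coord h (k - fst p - snd p)"

lemma tri_term_finite_bound:
  assumes M: "sym_bound C M" and A: "finite A" and P: "finite P"
  shows "L2_set (\<lambda>k. \<Sum>p\<in>P. cmod (tri_term M f g h k p)) A \<le> 3 * C * kap * norm f * norm g * norm h"
proof -
  \<comment> \<open>Large enough to contain all three frequencies of every term, so that each
    regrouped sum is part of a sum over pairs from \<open>Q\<close>.\<close>
  define Q where "Q = fst ` P \<union> snd ` P \<union> (\<lambda>(k, p). k - fst p - snd p) ` (A \<times> P)"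
  have Q: "finite Q" using A P by (auto simp: Q_def)
  let ?S = "\<lambda>f g h k. \<Sum>p\<in>Q\<times>Q. (wt (fst p) * cmod (coord f (fst p))) *
      (wt (snd p) * cmod (coord g (snd p))) * cmod (coord h (k - fst p - snd p))"
  have S0: "0 \<le> ?S f g h k" for f g h k by (intro sum_nonneg mult_nonneg_nonneg) auto
  have C: "C \<ge> 0" using M by (simp add: sym_bound_def)
  have S_le: "(\<Sum>p\<in>P. (wt (fst (r p)) * cmod (coord f (fst (r p)))) *
      (wt (snd (r p)) * cmod (coord g (snd (r p)))) * cmod (coord h (k - fst (r p) - snd (r p))))
      \<le> ?S f g h k" if "inj_on r P" "r ` P \<subseteq> Q \<times> Q" for r f g h k
  proof -
    let ?t = "\<lambda>p. (wt (fst p) * cmod (coord f (fst p))) *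
      (wt (snd p) * cmod (coord g (snd p))) * cmod (coord h (k - fst p - snd p))"
    have "(\<Sum>p\<in>P. ?t (r p)) = sum ?t (r ` P)" using that by (simp add: sum.reindex)
    also have "\<dots> \<le> sum ?t (Q \<times> Q)"
      using that Q by (intro sum_mono2) auto
    finally show ?thesis .
  qed
  have pt: "(\<Sum>p\<in>P. cmod (tri_term M f g h k p)) \<le> C * ?S f g h k + (C * ?S g h f k + C * ?S f h g k)"
    if k: "k \<in> A" for k
  proof -
    have "(\<Sum>p\<in>P. cmod (tri_term M f g h k p)) \<le> (\<Sum>p\<in>P.
       C * (wt (fst p) * cmod (coord f (fst p)) * (wt (snd p) * cmod (coord g (snd p))) * cmod (coord h (k - fst p - snd p)))
     + (C * (wt (snd p) * cmod (coord g (snd p)) * (wt (k - fst p - snd p) * cmod (coord h (k - fst p - snd p))) * cmod (coord f (fst p)))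
     + C * (wt (fst p) * cmod (coord f (fst p)) * (wt (k - fst p - snd p) * cmod (coord h (k - fst p - snd p))) * cmod (coord g (snd p)))))"
    proof (rule sum_mono)
      fix p :: "int \<times> int"
      let ?x = "fst p" and ?y = "snd p" let ?z = "k - ?x - ?y"
      have "cmod (M ?x ?y ?z) \<le> C * (wt ?x * wt ?y + wt ?y * wt ?z + wt ?x * wt ?z)"
        using M by (simp add: sym_bound_def)
      then have "cmod (M ?x ?y ?z) * (cmod (coord f ?x) * cmod (coord g ?y) * cmod (coord h ?z)) \<le>
         C * (wt ?x * wt ?y + wt ?y * wt ?z + wt ?x * wt ?z) * (cmod (coord f ?x) * cmod (coord g ?y) * cmod (coord h ?z))"
        by (rule mult_right_mono) simp
      then show "cmod (tri_term M f g h k p) \<le> C * (wt ?x * cmod (coord f ?x) * (wt ?y * cmod (coord g ?y)) * cmod (coord h ?z))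
     + (C * (wt ?y * cmod (coord g ?y) * (wt ?z * cmod (coord h ?z)) * cmod (coord f ?x))
     + C * (wt ?x * cmod (coord f ?x) * (wt ?z * cmod (coord h ?z)) * cmod (coord g ?y)))"
        unfolding tri_term_def norm_mult by (simp add: algebra_simps)
    qed
    also have "\<dots> \<le> C * ?S f g h k + (C * ?S g h f k + C * ?S f h g k)"
      unfolding sum.distrib sum_distrib_left[symmetric]
    proof (intro add_mono mult_left_mono C)
      show "(\<Sum>p\<in>P. wt (fst p) * cmod (coord f (fst p)) * (wt (snd p) * cmod (coord g (snd p))) *
         cmod (coord h (k - fst p - snd p))) \<le> ?S f g h k"
        using S_le[of "\<lambda>p. p" f g h k] by (force simp: Q_def image_iff)
      \<comment> \<open>For fixed \<open>k\<close> any two of the three frequencies determine the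
        third, so the two weighted slots can be made the summation variables.\<close>
      have "inj_on (\<lambda>p. (snd p, k - fst p - snd p)) P" "(\<lambda>p. (snd p, k - fst p - snd p)) ` P \<subseteq> Q \<times> Q"
        using k by (force simp: inj_on_def prod_eq_iff Q_def)+
      from S_le[OF this, of g h f k]
      show "(\<Sum>p\<in>P. wt (snd p) * cmod (coord g (snd p)) * (wt (k - fst p - snd p) *
         cmod (coord h (k - fst p - snd p))) * cmod (coord f (fst p))) \<le> ?S g h f k"
        by (simp add: algebra_simps)
      have "inj_on (\<lambda>p. (fst p, k - fst p - snd p)) P" "(\<lambda>p. (fst p, k - fst p - snd p)) ` P \<subseteq> Q \<times> Q"
        using k by (force simp: inj_on_def prod_eq_iff Q_def)+
      from S_le[OF this, of f h g k]
      show "(\<Sum>p\<in>P. wt (fst p) * cmod (coord f (fst p)) * (wt (k - fst p - snd p) *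
         cmod (coord h (k - fst p - snd p))) * cmod (coord g (snd p))) \<le> ?S f h g k"
        by (simp add: algebra_simps)
    qed
    finally show ?thesis .
  qed
  have "L2_set (\<lambda>k. \<Sum>p\<in>P. cmod (tri_term M f g h k p)) A \<le>
     L2_set (\<lambda>k. C * ?S f g h k + (C * ?S g h f k + C * ?S f h g k)) A"
    by (intro L2_set_mono pt sum_nonneg) auto
  also have "\<dots> \<le> L2_set (\<lambda>k. C * ?S f g h k) A + (L2_set (\<lambda>k. C * ?S g h f k) A + L2_set (\<lambda>k. C * ?S f h g k) A)"
    by (intro order_trans[OF L2_set_triangle_ineq] add_left_mono L2_set_triangle_ineq)
  also have "\<dots> \<le> C * (kap * norm f * norm g * norm h) + (C * (kap * norm g * norm h * norm f) + C * (kap * norm f * norm h * norm g))"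
    unfolding L2_set_right_distrib[OF C, symmetric]
    by (intro add_mono mult_left_mono C young_sum A Q)
  also have "\<dots> = 3 * C * kap * norm f * norm g * norm h" by simp
  finally show ?thesis .
qed

lemma tri_term_abs_summable:
  assumes M: "sym_bound C M"
  shows "(\<lambda>p. cmod (tri_term M f g h k p)) summable_on UNIV"
    and "(\<Sum>\<^sub>\<infinity>p. cmod (tri_term M f g h k p)) \<le> 3 * C * kap * norm f * norm g * norm h"
proof -
  have b: "(\<Sum>p\<in>P. cmod (tri_term M f g h k p)) \<le> 3 * C * kap * norm f * norm g * norm h" if "finite P" for P
    using tri_term_finite_bound[OF M _ that, of "{k}" f g h] by (simp add: sum_nonneg)
  show 1: "(\<lambda>p. cmod (tri_term M f g h k p)) summable_on UNIV"
    by (rule nonneg_bounded_partial_sums_imp_summable_on)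
      (auto intro!: eventually_finite_subsets_at_top_weakI b)
  show "(\<Sum>\<^sub>\<infinity>p. cmod (tri_term M f g h k p)) \<le> 3 * C * kap * norm f * norm g * norm h"
    by (rule infsum_le_finite_sums[OF 1]) (rule b)
qed

lemma tri_term_summable:
  assumes M: "sym_bound C M"
  shows "tri_term M f g h k summable_on UNIV"
  by (rule abs_summable_summable) (rule tri_term_abs_summable(1)[OF M])

definition tri :: "(int \<Rightarrow> int \<Rightarrow> int \<Rightarrow> complex) \<Rightarrow> int ell2 \<Rightarrow> int ell2 \<Rightarrow> int ell2 \<Rightarrow> int ell2" where
  "tri M f g h = Abs_ell2 (\<lambda>k. infsum (tri_term M f g h k) UNIV)"

lemma
  assumes M: "sym_bound C M"
  shows coord_tri: "coord (tri M f g h) k = infsum (tri_term M f g h k) UNIV"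
    and norm_tri_le: "norm (tri M f g h) \<le> 3 * C * kap * norm f * norm g * norm h"
proof -
  have b: "L2_set (\<lambda>k. cmod (infsum (tri_term M f g h k) UNIV)) A
      \<le> 3 * C * kap * norm f * norm g * norm h" if A: "finite A" for A
  proof (rule tendsto_upperbound)
    show "((\<lambda>P. L2_set (\<lambda>k. cmod (sum (tri_term M f g h k) P)) A) \<longlongrightarrow>
        L2_set (\<lambda>k. cmod (infsum (tri_term M f g h k) UNIV)) A) (finite_subsets_at_top UNIV)"
      by (intro L2_set_tendsto tendsto_norm infsum_tendsto tri_term_summable[OF M])
    show "\<forall>\<^sub>F P in finite_subsets_at_top UNIV. L2_set (\<lambda>k. cmod (sum (tri_term M f g h k) P)) A
       \<le> 3 * C * kap * norm f * norm g * norm h"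
    proof (intro eventually_finite_subsets_at_top_weakI)
      fix P :: "(int \<times> int) set" assume "finite P"
      have "L2_set (\<lambda>k. cmod (sum (tri_term M f g h k) P)) A \<le>
         L2_set (\<lambda>k. \<Sum>p\<in>P. cmod (tri_term M f g h k p)) A"
        by (intro L2_set_mono norm_sum) auto
      also have "\<dots> \<le> 3 * C * kap * norm f * norm g * norm h"
        by (rule tri_term_finite_bound[OF M A \<open>finite P\<close>])
      finally show "L2_set (\<lambda>k. cmod (sum (tri_term M f g h k) P)) A
         \<le> 3 * C * kap * norm f * norm g * norm h" .
    qed
  qed simp
  have c: "coord (tri M f g h) k = infsum (tri_term M f g h k) UNIV" for k
    unfolding tri_def by (subst coord_Abs_ell2) (auto intro: l2_boundedI b)
  then show "coord (tri M f g h) k = infsum (tri_term M f g h k) UNIV" .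
  show "norm (tri M f g h) \<le> 3 * C * kap * norm f * norm g * norm h"
    by (rule norm_ell2_leI) (simp only: c b)
qed

lemma has_sum_tri:
  assumes M: "sym_bound C M"
  shows "(tri_term M f g h k has_sum coord (tri M f g h) k) UNIV"
  unfolding coord_tri[OF M] by (rule has_sum_infsum[OF tri_term_summable[OF M]])

lemma tri_diff:
  assumes M: "sym_bound C M"
  shows "tri M f g h - tri M f' g' h' = tri M (f - f') g h + tri M f' (g - g') h + tri M f' g' (h - h')"
proof (rule ell2_eqI)
  fix k
  have "(tri_term M f g h k has_sum coord (tri M (f - f') g h + tri M f' (g - g') h + tri M f' g' (h - h') + tri M f' g' h') k) UNIV"
    unfolding coord_add
    by (rule has_sum_cong[THEN iffD1, OF _ has_sum_add[OF has_sum_add[OF has_sum_add]]])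
      (rule_tac [2-5] has_sum_tri[OF M], simp add: tri_term_def algebra_simps)
  then have "coord (tri M f g h) k = coord (tri M (f - f') g h + tri M f' (g - g') h + tri M f' g' (h - h') + tri M f' g' h') k"
    using has_sum_tri[OF M] by (rule has_sum_unique[symmetric])
  then show "coord (tri M f g h - tri M f' g' h') k = coord (tri M (f - f') g h + tri M f' (g - g') h + tri M f' g' (h - h')) k"
    by simp
qed

lemma norm_tri_diff_le:
  assumes M: "sym_bound C M" and b: "norm f' \<le> a1" "norm g \<le> a2" "norm g' \<le> a2" "norm h \<le> a3"
  shows "norm (tri M f g h - tri M f' g' h') \<le>
    3 * C * kap * (norm (f - f') * a2 * a3 + a1 * norm (g - g') * a3 + a1 * a2 * norm (h - h'))"
proof -
  have C: "C \<ge> 0" using M by (simp add: sym_bound_def)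
  have a: "0 \<le> a1" "0 \<le> a2" "0 \<le> a3" using b norm_ge_zero by (meson order_trans)+
  have "norm (tri M f g h - tri M f' g' h') \<le>
     norm (tri M (f - f') g h) + norm (tri M f' (g - g') h) + norm (tri M f' g' (h - h'))"
    unfolding tri_diff[OF M] by (meson add_mono norm_triangle_ineq order_refl order_trans)
  also have "\<dots> \<le> 3 * C * kap * norm (f - f') * norm g * norm h +
     3 * C * kap * norm f' * norm (g - g') * norm h + 3 * C * kap * norm f' * norm g' * norm (h - h')"
    by (intro add_mono norm_tri_le M)
  also have "\<dots> \<le> 3 * C * kap * norm (f - f') * a2 * a3 +
     3 * C * kap * a1 * norm (g - g') * a3 + 3 * C * kap * a1 * a2 * norm (h - h')"
    using C a b by (intro add_mono mult_mono mult_nonneg_nonneg) auto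
  finally show ?thesis by (simp add: algebra_simps)
qed

lemma tendsto_tri:
  assumes M: "sym_bound C M" and f: "(f \<longlongrightarrow> f0) F" and g: "(g \<longlongrightarrow> g0) F" and h: "(h \<longlongrightarrow> h0) F"
  shows "((\<lambda>t. tri M (f t) (g t) (h t)) \<longlongrightarrow> tri M f0 g0 h0) F"
proof (rule LIM_zero_cancel, rule Lim_null_comparison)
  show "\<forall>\<^sub>F t in F. norm (tri M (f t) (g t) (h t) - tri M f0 g0 h0) \<le>
     3 * C * kap * (norm (f t - f0) * (norm (g t) + norm g0) * norm (h t)
      + norm f0 * norm (g t - g0) * norm (h t) + norm f0 * (norm (g t) + norm g0) * norm (h t - h0))"
    by (intro always_eventually allI norm_tri_diff_le[OF M]) auto
  have "((\<lambda>t. 3 * C * kap * (norm (f t - f0) * (norm (g t) + norm g0) * norm (h t)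
      + norm f0 * norm (g t - g0) * norm (h t) + norm f0 * (norm (g t) + norm g0) * norm (h t - h0))) \<longlongrightarrow>
      3 * C * kap * (norm (f0 - f0) * (norm g0 + norm g0) * norm h0
      + norm f0 * norm (g0 - g0) * norm h0 + norm f0 * (norm g0 + norm g0) * norm (h0 - h0))) F"
    by (intro tendsto_intros f g h)
  then show "((\<lambda>t. 3 * C * kap * (norm (f t - f0) * (norm (g t) + norm g0) * norm (h t)
      + norm f0 * norm (g t - g0) * norm (h t) + norm f0 * (norm (g t) + norm g0) * norm (h t - h0))) \<longlongrightarrow> 0) F"
    by simp
qed

end

section \<open>The resonance function\<close>

lemma jap_power2: "(jap k)\<^sup>2 = 1 + (real_of_int k)\<^sup>2"
  by (simp add: jap_def)

lemma jap_add_le: "jap (x + y) \<le> jap x + jap y"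
proof (rule power2_le_imp_le)
  have "real_of_int x * real_of_int y \<le> \<bar>real_of_int x\<bar> * \<bar>real_of_int y\<bar>"
    by (metis abs_ge_self abs_mult)
  also have "\<dots> \<le> jap x * jap y"
    by (intro mult_mono abs_le_jap) auto
  finally show "(jap (x + y))\<^sup>2 \<le> (jap x + jap y)\<^sup>2"
    unfolding power2_sum jap_power2 by (simp add: power2_sum)
qed simp

definition Om :: "int \<Rightarrow> int \<Rightarrow> int \<Rightarrow> int" where "Om x y z = (x + y) * (y + z) * (z + x)"

lemma Om_eq: "(x + y + z) ^ 3 = x ^ 3 + y ^ 3 + z ^ 3 + 3 * Om x y z"
  by (simp add: Om_def power3_eq_cube algebra_simps)

definition mu :: "int \<Rightarrow> int \<Rightarrow> int \<Rightarrow> real" where "mu x y z = max (jap x) (max (jap y) (jap z))"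

lemma mu_ge: "jap x \<le> mu x y z" "jap y \<le> mu x y z" "jap z \<le> mu x y z"
  by (auto simp: mu_def)

lemma mu_cases: "mu x y z = jap x \<or> mu x y z = jap y \<or> mu x y z = jap z"
  by (auto simp: mu_def max_def)

lemma mu_pos: "0 < mu x y z"
  using mu_ge(1)[of x y z] jap_pos[of x] by linarith

lemma jap_sum_le_mu: "jap (x + y + z) \<le> 3 * mu x y z"
  using jap_add_le[of "x + y" z] jap_add_le[of x y] mu_ge(1)[of x y z] mu_ge(2)[of y x z]
    mu_ge(3)[of z x y] by linarith

text \<open>If \<open>c\<close> is small against \<open>a\<close>, then \<open>c + a\<close> is of
  size \<open>|a|\<close>. Either \<open>b\<close> is not small, and then neither is
  \<open>b + c\<close>; or \<open>b\<close> is small, and \<open>a + b\<close> is of size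
  \<open>|a|\<close>. The third factor is a nonzero integer, hence at least 1. The two cases give
  the constants 64/7 and 32/21, both below 10.\<close>

lemma Om_lower_bound_int:
  assumes "8 * \<bar>c\<bar> \<le> \<bar>a\<bar>" "Om a b c \<noteq> 0"
  shows "a\<^sup>2 \<le> 10 * \<bar>Om a b c\<bar>"
proof -
  have nz: "\<bar>a + b\<bar> \<ge> 1" "\<bar>b + c\<bar> \<ge> 1" using assms(2) by (auto simp: Om_def)
  have "\<bar>a\<bar> \<le> \<bar>c + a\<bar> + \<bar>c\<bar>" "\<bar>b\<bar> \<le> \<bar>b + c\<bar> + \<bar>c\<bar>" "\<bar>a\<bar> \<le> \<bar>a + b\<bar> + \<bar>b\<bar>" by arith+
  note tri = this
  have 1: "8 * \<bar>c + a\<bar> \<ge> 7 * \<bar>a\<bar>" using assms(1) tri by linarith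
  have Om: "\<bar>Om a b c\<bar> = \<bar>a + b\<bar> * \<bar>b + c\<bar> * \<bar>c + a\<bar>" by (simp add: Om_def abs_mult)
  show ?thesis
  proof (cases "4 * \<bar>b\<bar> \<ge> \<bar>a\<bar>")
    case True
    then have 2: "8 * \<bar>b + c\<bar> \<ge> \<bar>a\<bar>" using assms(1) tri by linarith
    have "1 * \<bar>a\<bar> * (7 * \<bar>a\<bar>) \<le> \<bar>a + b\<bar> * (8 * \<bar>b + c\<bar>) * (8 * \<bar>c + a\<bar>)"
      by (rule mult_mono[OF mult_mono[OF nz(1) 2] 1]) auto
    then have "7 * (\<bar>a\<bar> * \<bar>a\<bar>) \<le> 64 * \<bar>Om a b c\<bar>" unfolding Om by (simp add: algebra_simps)
    then show ?thesis by (simp add: power2_eq_square)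
  next
    case False
    then have 2: "4 * \<bar>a + b\<bar> \<ge> 3 * \<bar>a\<bar>" using tri by linarith
    have "(3 * \<bar>a\<bar>) * 1 * (7 * \<bar>a\<bar>) \<le> (4 * \<bar>a + b\<bar>) * \<bar>b + c\<bar> * (8 * \<bar>c + a\<bar>)"
      by (rule mult_mono[OF mult_mono[OF 2 nz(2)] 1]) auto
    then have "21 * (\<bar>a\<bar> * \<bar>a\<bar>) \<le> 32 * \<bar>Om a b c\<bar>" unfolding Om by (simp add: algebra_simps)
    then show ?thesis by (simp add: power2_eq_square)
  qed
qed

text \<open>Passing from \<open>a^2\<close> to the bracket \<open>1 + a^2\<close> costs the factor
  2: the strict hypothesis forces \<open>1 <= a^2\<close>.\<close>

lemma Om_lower_bound:
  assumes "8 * jap c < jap a" "Om a b c \<noteq> 0"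
  shows "(jap a)\<^sup>2 \<le> 20 * \<bar>real_of_int (Om a b c)\<bar>"
proof -
  have "(8 * jap c)\<^sup>2 < (jap a)\<^sup>2" using assms(1) by (intro power_strict_mono) auto
  then have lt: "64 * (real_of_int c)\<^sup>2 + 63 < (real_of_int a)\<^sup>2"
    by (simp add: power_mult_distrib jap_power2)
  then have "(8 * real_of_int c)\<^sup>2 \<le> (real_of_int a)\<^sup>2" by (simp add: power_mult_distrib)
  then have "\<bar>8 * real_of_int c\<bar> \<le> \<bar>real_of_int a\<bar>" by (simp only: abs_le_square_iff)
  then have "8 * \<bar>c\<bar> \<le> \<bar>a\<bar>" by linarith
  from Om_lower_bound_int[OF this assms(2)]
  have "real_of_int (a\<^sup>2) \<le> real_of_int (10 * \<bar>Om a b c\<bar>)" by (rule of_int_le_iff[THEN iffD2])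
  then have "(real_of_int a)\<^sup>2 \<le> 10 * \<bar>real_of_int (Om a b c)\<bar>" by simp
  moreover have "1 \<le> (real_of_int a)\<^sup>2" using lt zero_le_power2[of "real_of_int c"] by linarith
  ultimately show ?thesis unfolding jap_power2 by linarith
qed

text \<open>The contrapositive of \<open>Om_lower_bound\<close>. As \<open>Om\<close> is symmetric,
  the largest frequency can be moved to the first slot and either of the others to the
  third.\<close>

lemma comparable_frequencies:
  assumes "Om x y z \<noteq> 0" "20 * \<bar>real_of_int (Om x y z)\<bar> < (mu x y z)\<^sup>2"
  shows "mu x y z \<le> 8 * jap x" "mu x y z \<le> 8 * jap y" "mu x y z \<le> 8 * jap z"
proof -
  have sym: "Om x z y = Om x y z" "Om y x z = Om x y z" "Om y z x = Om x y z" "Om z x y = Om x y z" "Om z y x = Om x y z"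
    by (simp_all add: Om_def mult_ac add_ac)
  have lb: "jap a \<le> 8 * jap c" if "mu x y z = jap a" "Om a b c = Om x y z" for a b c
    using Om_lower_bound[of c a b] assms that by force
  have lt: "jap k \<le> 8 * jap k" for k using jap_pos[of k] by linarith
  consider "mu x y z = jap x" | "mu x y z = jap y" | "mu x y z = jap z" using mu_cases by blast
  then have "mu x y z \<le> 8 * jap x \<and> mu x y z \<le> 8 * jap y \<and> mu x y z \<le> 8 * jap z"
  proof cases
    case 1
    then show ?thesis using lb[of x z y] lb[of x y z] lt[of x] sym by simp
  next
    case 2
    then show ?thesis using lb[of y z x] lb[of y x z] lt[of y] sym by simp
  next
    case 3
    then show ?thesis using lb[of z y x] lb[of z x y] lt[of z] sym by simp
  qed
  then show "mu x y z \<le> 8 * jap x" "mu x y z \<le> 8 * jap y" "mu x y z \<le> 8 * jap z" by auto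
qed

text \<open>The region in which the time oscillation is exploited. The 20 is that of
  \<open>Om_lower_bound\<close>, so that a triple with \<open>Om\<close> nonzero and
  \<open>K <= mu\<close> outside this region has comparable frequencies. The threshold
  \<open>K\<close> serves to make the boundary term small.\<close>

definition osc :: "real \<Rightarrow> int \<Rightarrow> int \<Rightarrow> int \<Rightarrow> bool" where
  "osc K x y z \<longleftrightarrow> Om x y z \<noteq> 0 \<and> (mu x y z)\<^sup>2 \<le> 20 * \<bar>real_of_int (Om x y z)\<bar> \<and> K \<le> mu x y z"

section \<open>Pointwise bounds for the symbols of the normal form\<close>

context regularity
begin

definition pw :: "int \<Rightarrow> int \<Rightarrow> int \<Rightarrow> real" where
  "pw x y z = jap x powr s * jap y powr s * jap z powr s"

lemma pw_pos: "0 < pw x y z" by (simp add: pw_def)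

abbreviation Wsum :: "int \<Rightarrow> int \<Rightarrow> int \<Rightarrow> real" where
  "Wsum x y z \<equiv> wt x * wt y + wt y * wt z + wt x * wt z"

lemma Wsum_nonneg: "0 \<le> Wsum x y z" by simp

lemma Wsum_ge: "wt x * wt y \<le> Wsum x y z" "wt y * wt z \<le> Wsum x y z" "wt x * wt z \<le> Wsum x y z"
  by simp_all

lemma inverse_jap_powr_le_wt: "1 / jap k powr s \<le> wt k"
proof -
  have "jap k powr (- s) \<le> jap k powr (1 / 2 - s)"
    by (rule powr_mono) (use jap_ge_1 in auto)
  then show ?thesis by (simp add: wt_def powr_minus_divide)
qed

lemma mu_powr_div_pw: "mu x y z powr s / pw x y z \<le> Wsum x y z"
proof -
  have *: "1 / (jap a powr s * jap b powr s) \<le> wt a * wt b" for a b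
    using mult_mono[OF inverse_jap_powr_le_wt inverse_jap_powr_le_wt, of a b] by simp
  consider "mu x y z = jap x" | "mu x y z = jap y" | "mu x y z = jap z" using mu_cases by blast
  then show ?thesis
  proof cases
    case 1
    then have "mu x y z powr s / pw x y z = 1 / (jap y powr s * jap z powr s)" by (simp add: pw_def)
    then show ?thesis using *[of y z] Wsum_ge(2)[of y z x] by linarith
  next
    case 2
    then have "mu x y z powr s / pw x y z = 1 / (jap x powr s * jap z powr s)" by (simp add: pw_def)
    then show ?thesis using *[of x z] Wsum_ge(3)[of x z y] by linarith
  next
    case 3
    then have "mu x y z powr s / pw x y z = 1 / (jap x powr s * jap y powr s)" by (simp add: pw_def)
    then show ?thesis using *[of x y] Wsum_ge(1)[of x y z] by linarith
  qed
qed

lemma jap_powr_sum_le: "0 \<le> r \<Longrightarrow> jap (x + y + z) powr r \<le> 3 powr r * mu x y z powr r"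
  using powr_mono2[OF _ _ jap_sum_le_mu[of x y z], of r] mu_pos[of x y z]
  by (simp add: powr_mult)

lemma jap_powr_eq_wt: "jap k powr (1 / 2) / jap k powr s = wt k"
  by (simp add: wt_def powr_diff)

lemma mu_powr_comparable:
  assumes "mu x y z \<le> 8 * jap x" "mu x y z \<le> 8 * jap y" "mu x y z \<le> 8 * jap z"
  shows "mu x y z * mu x y z powr s / pw x y z \<le> 8 * Wsum x y z"
proof -
  have *: "mu x y z / (jap a powr s * jap b powr s) \<le> 8 * (wt a * wt b)"
    if "mu x y z \<le> 8 * jap a" "mu x y z \<le> 8 * jap b" for a b
  proof -
    have "mu x y z = mu x y z powr (1 / 2) * mu x y z powr (1 / 2)"
      using mu_pos[of x y z] by (simp flip: powr_add)
    also have "\<dots> \<le> (8 * jap a) powr (1 / 2) * (8 * jap b) powr (1 / 2)"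
      using that mu_pos[of x y z] by (intro mult_mono powr_mono2) auto
    also have "\<dots> = (8 powr (1/2) * 8 powr (1/2)) * (jap a powr (1 / 2) * jap b powr (1 / 2))"
      by (simp add: powr_mult)
    also have "8 powr (1/2) * 8 powr (1/2) = (8::real)"
      by (simp flip: powr_add)
    finally have "mu x y z / (jap a powr s * jap b powr s) \<le>
        8 * (jap a powr (1 / 2) * jap b powr (1 / 2)) / (jap a powr s * jap b powr s)"
      by (intro divide_right_mono) auto
    also have "\<dots> = 8 * (wt a * wt b)" by (simp flip: jap_powr_eq_wt)
    finally show ?thesis .
  qed
  consider "mu x y z = jap x" | "mu x y z = jap y" | "mu x y z = jap z" using mu_cases by blast
  then show ?thesis
  proof cases
    case 1
    then have eq: "mu x y z * mu x y z powr s / pw x y z = mu x y z / (jap y powr s * jap z powr s)"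
      by (simp add: pw_def)
    show ?thesis unfolding eq by (rule order_trans[OF *[OF assms(2,3)] mult_left_mono[OF Wsum_ge(2)]]) simp
  next
    case 2
    then have eq: "mu x y z * mu x y z powr s / pw x y z = mu x y z / (jap x powr s * jap z powr s)"
      by (simp add: pw_def)
    show ?thesis unfolding eq by (rule order_trans[OF *[OF assms(1,3)] mult_left_mono[OF Wsum_ge(3)]]) simp
  next
    case 3
    then have eq: "mu x y z * mu x y z powr s / pw x y z = mu x y z / (jap x powr s * jap y powr s)"
      by (simp add: pw_def)
    show ?thesis unfolding eq by (rule order_trans[OF *[OF assms(1,2)] mult_left_mono[OF Wsum_ge(1)]]) simp
  qed
qed

text \<open>
  All symbols act on normalised coefficients: a solution is represented by
  \<open>\<langle>k\<rangle>\<^sup>s\<close> times its Fourier coefficients, its time derivative by \<open>\<langle>k\<rangle>\<^bsup>s-1\<^esup>\<close> times them, so that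
  \<open>H\<^sup>s\<close> and \<open>H\<^bsup>s-1\<^esup>\<close> both become \<open>\<ell>\<^sup>2\<close>. The slots \<open>x, y, z\<close> are the frequencies of \<open>u\<close>, of the
  conjugate of \<open>u\<close>, and of \<open>\<partial>\<^sub>x u\<close>. \<open>symNf\<close> is the full nonlinearity \<open>6|u|\<^sup>2\<partial>\<^sub>x u\<close> (with values in \<open>H\<^bsup>s-1\<^esup>\<close>),
  \<open>symN\<close> drops the transport terms removed by the gauge, \<open>symG\<close> keeps the terms that need no
  integration by parts in time, and \<open>symB\<close> is the rest divided by \<open>-3i\<Omega>\<close>.
\<close>

definition symNf :: "int \<Rightarrow> int \<Rightarrow> int \<Rightarrow> complex" where
  "symNf x y z = 6 * \<i> * of_int z * of_real (jap (x + y + z) powr (s - 1) / pw x y z)"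

definition symN :: "int \<Rightarrow> int \<Rightarrow> int \<Rightarrow> complex" where
  "symN x y z = (if x + y = 0 then 0 else symNf x y z)"

definition symG :: "real \<Rightarrow> int \<Rightarrow> int \<Rightarrow> int \<Rightarrow> complex" where
  "symG K x y z = (if x + y = 0 \<or> osc K x y z then 0
     else 6 * \<i> * of_int z * of_real (jap (x + y + z) powr s / pw x y z))"

definition symB :: "real \<Rightarrow> int \<Rightarrow> int \<Rightarrow> int \<Rightarrow> complex" where
  "symB K x y z = (if osc K x y z
     then of_real (- 2 * real_of_int z / real_of_int (Om x y z) * (jap (x + y + z) powr s / pw x y z)) else 0)"

text \<open>The derivative on the third slot is paid for by measuring the output one power lower, in
  H^(s-1).\<close>

lemma sym_bound_Nf: "sym_bound (6 * 3 powr s) symNf"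
  unfolding sym_bound_def
proof (intro conjI allI)
  fix x y z
  let ?m = "mu x y z"
  have "cmod (symNf x y z) = 6 * (\<bar>real_of_int z\<bar> * jap (x + y + z) powr (s - 1)) / pw x y z"
    using pw_pos[of x y z] by (simp add: symNf_def norm_mult norm_divide abs_mult)
  also have "\<dots> \<le> 6 * (?m * (3 powr s * ?m powr (s - 1))) / pw x y z"
  proof (intro divide_right_mono mult_left_mono mult_mono)
    show "\<bar>real_of_int z\<bar> \<le> ?m" using abs_le_jap[of z] mu_ge(3)[of z x y] by linarith
    have "jap (x + y + z) powr (s - 1) \<le> 3 powr (s - 1) * ?m powr (s - 1)"
      using s_gt_1 by (intro jap_powr_sum_le) auto
    also have "\<dots> \<le> 3 powr s * ?m powr (s - 1)"
      by (intro mult_right_mono powr_mono) auto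
    finally show "jap (x + y + z) powr (s - 1) \<le> 3 powr s * ?m powr (s - 1)" .
  qed (use mu_pos[of x y z] pw_pos[of x y z] in auto)
  also have "\<dots> = 6 * 3 powr s * (?m powr s / pw x y z)"
    using mu_pos[of x y z] by (simp add: powr_diff)
  also have "\<dots> \<le> 6 * 3 powr s * Wsum x y z"
    by (intro mult_left_mono mu_powr_div_pw) auto
  finally show "cmod (symNf x y z) \<le> 6 * 3 powr s * Wsum x y z" .
qed simp

lemma sym_bound_N: "sym_bound (6 * 3 powr s) symN"
  using sym_bound_Nf by (simp add: sym_bound_def symN_def)

text \<open>Division by \<open>Om\<close>, at least \<open>mu^2 / 20\<close>, beats the derivative
  \<open>z\<close> by a further power of \<open>mu\<close>. This surplus is used in two ways: for
  smallness in \<open>sym_bound_B\<close>, and for a factor of lower regularity in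
  \<open>sym_bound_D\<close>.\<close>

lemma cmod_symB_le: "cmod (symB K x y z) * mu x y z \<le> 40 * 3 powr s * Wsum x y z"
proof (cases "osc K x y z")
  case True
  let ?m = "mu x y z"
  have m: "?m > 0" by (rule mu_pos)
  have O: "\<bar>real_of_int (Om x y z)\<bar> > 0" "?m\<^sup>2 \<le> 20 * \<bar>real_of_int (Om x y z)\<bar>"
    using True by (auto simp: osc_def)
  have z: "\<bar>real_of_int z\<bar> \<le> ?m" using abs_le_jap[of z] mu_ge(3)[of z x y] by linarith
  have "\<bar>real_of_int z\<bar> * ?m \<le> 20 * \<bar>real_of_int (Om x y z)\<bar>"
    using mult_right_mono[OF z, of ?m] m O(2) unfolding power2_eq_square by linarith
  then have "\<bar>real_of_int z\<bar> * ?m / \<bar>real_of_int (Om x y z)\<bar> \<le> 20"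
    using O(1) by (simp add: pos_divide_le_eq)
  then have 1: "2 * (\<bar>real_of_int z\<bar> * ?m / \<bar>real_of_int (Om x y z)\<bar>) \<le> 40" by simp
  have "cmod (symB K x y z) * ?m =
     2 * (\<bar>real_of_int z\<bar> * ?m / \<bar>real_of_int (Om x y z)\<bar>) * (jap (x + y + z) powr s / pw x y z)"
    using True pw_pos[of x y z] by (simp add: symB_def norm_mult norm_divide abs_mult)
  also have "\<dots> \<le> 40 * (3 powr s * ?m powr s / pw x y z)"
    using 1 s_gt_1 m pw_pos[of x y z]
    by (intro mult_mono divide_right_mono jap_powr_sum_le) auto
  also have "\<dots> = 40 * 3 powr s * (?m powr s / pw x y z)" by simp
  also have "\<dots> \<le> 40 * 3 powr s * Wsum x y z"
    by (intro mult_left_mono mu_powr_div_pw) auto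
  finally show ?thesis .
qed (simp add: symB_def)

text \<open>On the support \<open>K <= mu\<close>, so the surplus power of \<open>mu\<close> becomes
  the factor \<open>1 / K\<close>.\<close>

lemma sym_bound_B: 
  assumes "K \<ge> 1" shows "sym_bound (40 * 3 powr s / K) (symB K)"
  unfolding sym_bound_def
proof (intro conjI allI)
  fix x y z
  have "cmod (symB K x y z) * K \<le> cmod (symB K x y z) * mu x y z"
    by (cases "osc K x y z") (auto simp: osc_def symB_def intro!: mult_left_mono)
  also note cmod_symB_le
  finally show "cmod (symB K x y z) \<le> 40 * 3 powr s / K * Wsum x y z"
    using assms by (simp add: field_simps)
qed (use assms in simp)

text \<open>When the time derivative hits a factor, that factor is only in H^(s-1); \<open>j\<close>
  is the bracket it lacks, and the surplus power of \<open>mu\<close> covers it.\<close>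

lemma sym_bound_D:
  assumes "\<And>x y z. 0 \<le> j x y z" "\<And>x y z. j x y z \<le> mu x y z"
  shows "sym_bound (40 * 3 powr s) (\<lambda>x y z. symB K x y z * of_real (j x y z))"
  unfolding sym_bound_def
proof (intro conjI allI)
  fix x y z
  have "cmod (symB K x y z * of_real (j x y z)) \<le> cmod (symB K x y z) * mu x y z"
    using assms by (simp add: norm_mult mult_left_mono)
  also note cmod_symB_le
  finally show "cmod (symB K x y z * of_real (j x y z)) \<le> 40 * 3 powr s * Wsum x y z" .
qed simp

text \<open>The symbol carries a full derivative and the full output weight, and each way of failing
  \<open>osc\<close> compensates it: bounded frequencies cost a factor \<open>K\<close>, comparable
  ones use \<open>mu_powr_comparable\<close>, and if a pair sums to zero then the output frequency
  equals the remaining input frequency and the two weights cancel.\<close>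

lemma sym_bound_G:
  assumes K: "K \<ge> 1" shows "sym_bound (48 * 3 powr s * K) (symG K)"
  unfolding sym_bound_def
proof (intro conjI allI)
  fix x y z
  let ?m = "mu x y z" and ?k = "x + y + z"
  let ?C = "48 * 3 powr s * K"
  have c1: "1 \<le> 3 powr s" using s_gt_1 by (simp add: ge_one_powr_ge_zero)
  have C6: "6 * 3 powr s * K \<le> ?C" "48 * 3 powr s \<le> ?C" "6 \<le> ?C"
  proof -
    have "1 \<le> 3 powr s * K" using K c1 mult_mono[of 1 "3 powr s" 1 K] by simp
    then show "6 \<le> ?C" by linarith
    have "3 powr s * 1 \<le> 3 powr s * K" using K by (intro mult_left_mono) auto
    then show "48 * 3 powr s \<le> ?C" by linarith
  qed (use K in simp)
  have m: "?m > 0" by (rule mu_pos)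
  have z: "\<bar>real_of_int z\<bar> \<le> ?m" using abs_le_jap[of z] mu_ge(3)[of z x y] by linarith
  have k: "jap ?k powr s \<le> 3 powr s * ?m powr s" using s_gt_1 by (intro jap_powr_sum_le) auto
  show "cmod (symG K x y z) \<le> ?C * Wsum x y z"
  proof (cases "x + y = 0 \<or> osc K x y z")
    case True
    then show ?thesis using K by (auto simp: symG_def)
  next
    case False
    then have eq: "cmod (symG K x y z) = 6 * (\<bar>real_of_int z\<bar> * jap ?k powr s) / pw x y z"
      using pw_pos[of x y z] by (simp add: symG_def norm_mult norm_divide abs_mult)
    also have "\<dots> \<le> 6 * (?m * (3 powr s * ?m powr s)) / pw x y z"
      using z k m pw_pos[of x y z] by (intro divide_right_mono mult_left_mono mult_mono) auto
    finally have g1: "cmod (symG K x y z) \<le> 6 * 3 powr s * (?m * ?m powr s / pw x y z)"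
      by (simp add: mult_ac)
    \<comment> \<open>For a pair of opposite frequencies the two brackets coincide, so the
      derivative is shared equally between them.\<close>
    have res: "\<bar>real_of_int z\<bar> / (jap a powr s * jap z powr s) \<le> wt a * wt z" if "jap a = jap z" for a
    proof -
      have "\<bar>real_of_int z\<bar> \<le> jap a powr (1/2) * jap z powr (1/2)"
        using abs_le_jap[of z] that by (simp flip: powr_add)
      then have "\<bar>real_of_int z\<bar> / (jap a powr s * jap z powr s) \<le>
          (jap a powr (1/2) * jap z powr (1/2)) / (jap a powr s * jap z powr s)"
        by (intro divide_right_mono) auto
      then show ?thesis by (simp flip: jap_powr_eq_wt)
    qed
    \<comment> \<open>The factor \<open>x + y\<close> of \<open>Om\<close> is excluded at this
      point, so that \<open>Om = 0\<close> leaves only the last two cases.\<close>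
    consider "?m < K" | "Om x y z \<noteq> 0" "20 * \<bar>real_of_int (Om x y z)\<bar> < ?m\<^sup>2" | "y + z = 0" | "z + x = 0"
      using False by (auto simp: osc_def Om_def not_le)
    then show ?thesis
    proof cases
      case 1
      have "?m * ?m powr s / pw x y z = ?m * (?m powr s / pw x y z)" by simp
      also have "\<dots> \<le> K * Wsum x y z"
        using 1 m pw_pos[of x y z] K by (intro mult_mono mu_powr_div_pw) auto
      finally have "cmod (symG K x y z) \<le> 6 * 3 powr s * (K * Wsum x y z)"
        using g1 by (meson mult_left_mono order_trans powr_ge_zero zero_le_mult_iff zero_le_numeral)
      also have "\<dots> = (6 * 3 powr s * K) * Wsum x y z" by (simp only: mult.assoc)
      also have "\<dots> \<le> ?C * Wsum x y z" by (rule mult_right_mono[OF C6(1) Wsum_nonneg])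
      finally show ?thesis .
    next
      case 2
      have "?m * ?m powr s / pw x y z \<le> 8 * Wsum x y z"
        by (rule mu_powr_comparable) (use comparable_frequencies[OF 2] in auto)
      then have "cmod (symG K x y z) \<le> 6 * 3 powr s * (8 * Wsum x y z)"
        using g1 by (meson mult_left_mono order_trans powr_ge_zero zero_le_mult_iff zero_le_numeral)
      also have "\<dots> = (48 * 3 powr s) * Wsum x y z" by simp
      also have "\<dots> \<le> ?C * Wsum x y z" by (rule mult_right_mono[OF C6(2) Wsum_nonneg])
      finally show ?thesis .
    next
      case 3
      then have kx: "?k = x" by simp
      have "y = - z" using 3 by simp
      then have "jap y = jap z" by simp
      have "cmod (symG K x y z) = 6 * (\<bar>real_of_int z\<bar> / (jap y powr s * jap z powr s))"
        unfolding eq kx by (simp add: pw_def)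
      also have "\<dots> \<le> 6 * Wsum x y z" by (rule mult_left_mono[OF order_trans[OF res[OF \<open>jap y = jap z\<close>] Wsum_ge(2)]]) simp
      also have "\<dots> \<le> ?C * Wsum x y z" by (rule mult_right_mono[OF C6(3) Wsum_nonneg])
      finally show ?thesis .
    next
      case 4
      then have ky: "?k = y" by simp
      have "x = - z" using 4 by simp
      then have "jap x = jap z" by simp
      have "cmod (symG K x y z) = 6 * (\<bar>real_of_int z\<bar> / (jap x powr s * jap z powr s))"
        unfolding eq ky by (simp add: pw_def)
      also have "\<dots> \<le> 6 * Wsum x y z" by (rule mult_left_mono[OF order_trans[OF res[OF \<open>jap x = jap z\<close>] Wsum_ge(3)]]) simp
      also have "\<dots> \<le> ?C * Wsum x y z" by (rule mult_right_mono[OF C6(3) Wsum_nonneg])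
      finally show ?thesis .
    qed
  qed
qed (use K in simp)

end

section \<open>Differentiation by parts\<close>

definition cub :: "real \<Rightarrow> int \<Rightarrow> real" where "cub t k = t * real_of_int k ^ 3"

context regularity
begin

text \<open>The trilinear operator conjugated by the linear flow, that is, seen in the interaction
  picture. By \<open>osc_factor_eq\<close> and \<open>has_sum_triT\<close> this merely multiplies
  each term by an oscillating phase.\<close>

definition triT :: "(int \<Rightarrow> int \<Rightarrow> int \<Rightarrow> complex) \<Rightarrow> real \<Rightarrow> int ell2 \<Rightarrow> int ell2 \<Rightarrow> int ell2 \<Rightarrow> int ell2" where
  "triT M t f g h = phase (\<lambda>k. - cub t k) (tri M (phase (cub t) f) (phase (cub t) g) (phase (cub t) h))"

definition osc_factor :: "real \<Rightarrow> int \<Rightarrow> int \<times> int \<Rightarrow> complex" where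
  "osc_factor t k p = cis (- 3 * real_of_int (Om (fst p) (snd p) (k - fst p - snd p)) * t)"

lemma osc_factor_eq:
  "osc_factor t k p = cis (- cub t k) * cis (cub t (fst p)) * cis (cub t (snd p)) * cis (cub t (k - fst p - snd p))"
proof -
  let ?x = "fst p" and ?y = "snd p" and ?z = "k - fst p - snd p"
  have "(real_of_int (?x + ?y + ?z)) ^ 3 = real_of_int ((?x + ?y + ?z) ^ 3)" by simp
  also have "\<dots> = real_of_int ?x ^ 3 + real_of_int ?y ^ 3 + real_of_int ?z ^ 3 + 3 * real_of_int (Om ?x ?y ?z)"
    unfolding Om_eq by simp
  finally have "real_of_int k ^ 3 = real_of_int ?x ^ 3 + real_of_int ?y ^ 3 + real_of_int ?z ^ 3 + 3 * real_of_int (Om ?x ?y ?z)"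
    by simp
  then have "- cub t k + cub t ?x + cub t ?y + cub t ?z = - 3 * real_of_int (Om ?x ?y ?z) * t"
    unfolding cub_def by (simp add: algebra_simps)
  then show ?thesis unfolding osc_factor_def cis_mult by simp
qed

lemma has_sum_triT:
  assumes M: "sym_bound C M"
  shows "((\<lambda>p. osc_factor t k p * tri_term M f g h k p) has_sum coord (triT M t f g h) k) UNIV"
proof -
  have "((\<lambda>p. cis (- cub t k) * tri_term M (phase (cub t) f) (phase (cub t) g) (phase (cub t) h) k p) has_sum
     cis (- cub t k) * coord (tri M (phase (cub t) f) (phase (cub t) g) (phase (cub t) h)) k) UNIV"
    by (intro has_sum_cmult_right has_sum_tri[OF M])
  moreover have "(\<lambda>p. cis (- cub t k) * tri_term M (phase (cub t) f) (phase (cub t) g) (phase (cub t) h) k p)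
     = (\<lambda>p. osc_factor t k p * tri_term M f g h k p)"
    by (rule ext) (simp add: osc_factor_eq tri_term_def mult_ac)
  ultimately show ?thesis by (simp add: triT_def)
qed

lemma norm_triT_le: "sym_bound C M \<Longrightarrow> norm (triT M t f g h) \<le> 3 * C * kap * norm f * norm g * norm h"
  unfolding triT_def norm_phase by (rule order_trans[OF norm_tri_le]) auto

lemma norm_triT_diff_le:
  assumes "sym_bound C M" "norm f' \<le> a1" "norm g \<le> a2" "norm g' \<le> a2" "norm h \<le> a3"
  shows "norm (triT M t f g h - triT M t f' g' h') \<le>
    3 * C * kap * (norm (f - f') * a2 * a3 + a1 * norm (g - g') * a3 + a1 * a2 * norm (h - h'))"
  unfolding triT_def phase_diff[symmetric] norm_phase
  by (rule order_trans[OF norm_tri_diff_le[OF assms(1), of _ a1 _ a2 _ _ a3]])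
    (use assms in \<open>auto simp: phase_diff[symmetric]\<close>)

lemma continuous_on_triT:
  assumes M: "sym_bound C M" and c: "continuous_on S f" "continuous_on S g" "continuous_on S h"
  shows "continuous_on S (\<lambda>t. triT M t (f t) (g t) (h t))"
proof -
  have cub: "continuous_on S (\<lambda>t. cub t k)" for k
    unfolding cub_def by (intro continuous_intros)
  have "continuous_on S (\<lambda>t. tri M (phase (cub t) (f t)) (phase (cub t) (g t)) (phase (cub t) (h t)))"
    using continuous_on_phase[of S cub, OF cub c(1)] continuous_on_phase[of S cub, OF cub c(2)]
      continuous_on_phase[of S cub, OF cub c(3)]
    unfolding continuous_on_def by (auto intro!: tendsto_tri[OF M])
  then show ?thesis unfolding triT_def
    by (intro continuous_on_phase continuous_on_minus cub)
qed

definition opN :: "real \<Rightarrow> int ell2 \<Rightarrow> int ell2" where "opN t a = triT symN t a (reflect a) a"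
definition opG :: "real \<Rightarrow> real \<Rightarrow> int ell2 \<Rightarrow> int ell2" where "opG K t a = triT (symG K) t a (reflect a) a"
definition opB :: "real \<Rightarrow> real \<Rightarrow> int ell2 \<Rightarrow> int ell2" where "opB K t a = triT (symB K) t a (reflect a) a"

text \<open>In the normalisation used, a curve whose derivative is represented by \<open>y\<close>
  satisfies d/dt \<open>coord a k\<close> = \<open>jap k * coord y k\<close>. The bracket in each of
  the three symbols is the one produced by the differentiated slot.\<close>

definition symD1 :: "real \<Rightarrow> int \<Rightarrow> int \<Rightarrow> int \<Rightarrow> complex" where
  "symD1 K x y z = symB K x y z * of_real (jap x)"
definition symD2 :: "real \<Rightarrow> int \<Rightarrow> int \<Rightarrow> int \<Rightarrow> complex" where
  "symD2 K x y z = symB K x y z * of_real (jap y)"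
definition symD3 :: "real \<Rightarrow> int \<Rightarrow> int \<Rightarrow> int \<Rightarrow> complex" where
  "symD3 K x y z = symB K x y z * of_real (jap z)"

lemma sym_bound_D123:
  "sym_bound (40 * 3 powr s) (symD1 K)" "sym_bound (40 * 3 powr s) (symD2 K)" "sym_bound (40 * 3 powr s) (symD3 K)"
  unfolding symD1_def[abs_def] symD2_def[abs_def] symD3_def[abs_def]
  by (rule sym_bound_D; use mu_ge in simp)+

definition opD :: "real \<Rightarrow> real \<Rightarrow> int ell2 \<Rightarrow> int ell2 \<Rightarrow> int ell2" where
  "opD K t a y = triT (symD1 K) t y (reflect a) a + triT (symD2 K) t a (reflect y) a + triT (symD3 K) t a (reflect a) y"

lemma continuous_on_ops:
  assumes "continuous_on S a" "continuous_on S y" "K \<ge> 1"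
  shows "continuous_on S (\<lambda>t. opN t (a t))" "continuous_on S (\<lambda>t. opG K t (a t))"
    "continuous_on S (\<lambda>t. opB K t (a t))" "continuous_on S (\<lambda>t. opD K t (a t) (y t))"
  unfolding opN_def opG_def opB_def opD_def
  by (intro continuous_intros assms continuous_on_triT[OF sym_bound_N] continuous_on_triT[OF sym_bound_G]
     continuous_on_triT[OF sym_bound_B] continuous_on_triT[OF sym_bound_D123(1)]
     continuous_on_triT[OF sym_bound_D123(2)] continuous_on_triT[OF sym_bound_D123(3)])+

text \<open>The coefficient \<open>-2 z / Om\<close> in \<open>symB\<close> is \<open>6 i z\<close>
  divided by \<open>-3 i Om\<close>. On \<open>osc\<close> the factor \<open>Om\<close> is nonzero,
  hence so is \<open>x + y\<close>, and \<open>symG\<close> vanishes; off \<open>osc\<close> the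
  left side vanishes and \<open>symG\<close> is everything.\<close>

lemma symB_times_phase_derivative:
  "symB K x y z * (- 3 * \<i> * of_int (Om x y z)) = of_real (jap (x + y + z)) * symN x y z - symG K x y z"
proof -
  have p: "jap k powr s = jap k * jap k powr (s - 1)" for k
    by (simp add: powr_diff)
  show ?thesis
  proof (cases "osc K x y z")
    case True
    then have "Om x y z \<noteq> 0" "x + y \<noteq> 0" by (auto simp: osc_def Om_def)
    then show ?thesis using True pw_pos[of x y z]
      by (simp add: symB_def symN_def symNf_def symG_def p field_simps)
  next
    case False
    then show ?thesis using pw_pos[of x y z]
      by (simp add: symB_def symN_def symNf_def symG_def p field_simps)
  qed
qed

text \<open>\<open>d/dt\<close> of \<open>e^(-3i\<Omega>t) symB a b a\<close>: on the support of \<open>symB\<close> the phase produces the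
  oscillating part of \<open>opN\<close>, the other three terms make up \<open>opD\<close>.\<close>

definition int_parts_term ::
    "real \<Rightarrow> real \<Rightarrow> int ell2 \<Rightarrow> int ell2 \<Rightarrow> int \<Rightarrow> int \<times> int \<Rightarrow> complex" where
  "int_parts_term K t a y k p = of_real (jap k) * (osc_factor t k p * tri_term symN a (reflect a) a k p)
     - osc_factor t k p * tri_term (symG K) a (reflect a) a k p
     + (osc_factor t k p * tri_term (symD1 K) y (reflect a) a k p
      + osc_factor t k p * tri_term (symD2 K) a (reflect y) a k p
      + osc_factor t k p * tri_term (symD3 K) a (reflect a) y k p)"

lemma has_vector_derivative_opB_term:
  assumes a: "\<And>k. ((\<lambda>t. coord (a t) k) has_vector_derivative of_real (jap k) * coord (y t) k) (at t within S)"
  shows "((\<lambda>t. osc_factor t k p * tri_term (symB K) (a t) (reflect (a t)) (a t) k p)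
    has_vector_derivative int_parts_term K t (a t) (y t) k p) (at t within S)"
proof -
  let ?x = "fst p" and ?y = "snd p" let ?z = "k - ?x - ?y"
  have E: "((\<lambda>t. osc_factor t k p) has_vector_derivative
      (- 3 * \<i> * of_int (Om ?x ?y ?z)) * osc_factor t k p) (at t within S)"
  proof -
    let ?c = "- 3 * \<i> * of_int (Om ?x ?y ?z) :: complex"
    have "osc_factor t k p = exp (t *\<^sub>R ?c)" for t
      by (simp add: osc_factor_def cis_conv_exp scaleR_conv_of_real mult_ac)
    then show ?thesis
      using has_vector_derivative_eq_rhs[OF exp_scaleR_has_vector_derivative_right mult.commute, of ?c t S]
      by simp
  qed
  \<comment> \<open>The bracket is even, so the conjugate slot, which is read at
    \<open>- ?y\<close>, still produces \<open>jap ?y\<close>.\<close>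
  have c: "((\<lambda>t. cnj (coord (a t) (- ?y))) has_vector_derivative cnj (of_real (jap ?y) * coord (y t) (- ?y))) (at t within S)"
    using has_vector_derivative_cnj[OF a[of "- ?y"]] by simp
  have "((\<lambda>t. osc_factor t k p * tri_term (symB K) (a t) (reflect (a t)) (a t) k p)
    has_vector_derivative
     (osc_factor t k p * (symB K ?x ?y ?z *
       (coord (a t) ?x * cnj (coord (a t) (- ?y)) * (of_real (jap ?z) * coord (y t) ?z)
       + (coord (a t) ?x * cnj (of_real (jap ?y) * coord (y t) (- ?y)) + of_real (jap ?x) * coord (y t) ?x * cnj (coord (a t) (- ?y)))
         * coord (a t) ?z))
     + (- 3 * \<i> * of_int (Om ?x ?y ?z)) * osc_factor t k p * (symB K ?x ?y ?z * (coord (a t) ?x * cnj (coord (a t) (- ?y)) * coord (a t) ?z)))) (at t within S)"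
    unfolding tri_term_def coord_reflect mult.assoc[of "symB K ?x ?y ?z"]
    by (intro has_vector_derivative_mult has_vector_derivative_mult_right E c a)
  moreover have "(osc_factor t k p * (symB K ?x ?y ?z *
       (coord (a t) ?x * cnj (coord (a t) (- ?y)) * (of_real (jap ?z) * coord (y t) ?z)
       + (coord (a t) ?x * cnj (of_real (jap ?y) * coord (y t) (- ?y)) + of_real (jap ?x) * coord (y t) ?x * cnj (coord (a t) (- ?y)))
         * coord (a t) ?z))
     + (- 3 * \<i> * of_int (Om ?x ?y ?z)) * osc_factor t k p * (symB K ?x ?y ?z * (coord (a t) ?x * cnj (coord (a t) (- ?y)) * coord (a t) ?z)))
    = int_parts_term K t (a t) (y t) k p" (is "?L = ?R")
  proof -
    have "?L = osc_factor t k p * (symB K ?x ?y ?z * (- 3 * \<i> * of_int (Om ?x ?y ?z)) * (coord (a t) ?x * cnj (coord (a t) (- ?y)) * coord (a t) ?z))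
      + osc_factor t k p * (symB K ?x ?y ?z *
       (coord (a t) ?x * cnj (coord (a t) (- ?y)) * (of_real (jap ?z) * coord (y t) ?z)
       + (coord (a t) ?x * (of_real (jap ?y) * cnj (coord (y t) (- ?y))) + of_real (jap ?x) * coord (y t) ?x * cnj (coord (a t) (- ?y)))
         * coord (a t) ?z))"
      by (simp add: algebra_simps)
    also have "\<dots> = ?R"
      unfolding symB_times_phase_derivative int_parts_term_def tri_term_def coord_reflect symD1_def symD2_def symD3_def
      by (simp add: algebra_simps)
    finally show ?thesis .
  qed
  ultimately show ?thesis by simp
qed

lemma has_sum_int_parts:
  assumes K: "K \<ge> 1"
  shows "(int_parts_term K t a y k has_sum
    (of_real (jap k) * coord (opN t a) k - coord (opG K t a) k + coord (opD K t a y) k)) UNIV"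
  unfolding int_parts_term_def opN_def opG_def opD_def coord_add diff_conv_add_uminus
  by (intro has_sum_add has_sum_uminusI has_sum_cmult_right has_sum_triT[OF sym_bound_N]
      has_sum_triT[OF sym_bound_G[OF K]] has_sum_triT[OF sym_bound_D123(1)]
      has_sum_triT[OF sym_bound_D123(2)] has_sum_triT[OF sym_bound_D123(3)])

lemma sum_cmod_term_le:
  assumes M: "sym_bound C M" and P: "finite P"
  shows "cmod (\<Sum>p\<in>P. osc_factor t k p * tri_term M f g h k p) \<le> 3 * C * kap * norm f * norm g * norm h"
proof -
  have "cmod (\<Sum>p\<in>P. osc_factor t k p * tri_term M f g h k p) \<le> (\<Sum>p\<in>P. cmod (tri_term M f g h k p))"
    by (rule order_trans[OF norm_sum]) (auto simp: norm_mult osc_factor_def intro!: sum_mono)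
  also have "\<dots> \<le> (\<Sum>\<^sub>\<infinity>p. cmod (tri_term M f g h k p))"
    by (rule finite_sum_le_infsum) (use P tri_term_abs_summable(1)[OF M] in auto)
  also have "\<dots> \<le> 3 * C * kap * norm f * norm g * norm h"
    by (rule tri_term_abs_summable(2)[OF M])
  finally show ?thesis .
qed

text \<open>The dominating constant for \<open>integration_by_parts\<close>. It may depend on
  \<open>k\<close>, as one coefficient is treated at a time, but not on \<open>P\<close> or
  \<open>t\<close>.\<close>

lemma int_parts_bound:
  assumes K: "K \<ge> 1" and P: "finite P" and R: "norm a \<le> R" "norm y \<le> R"
  shows "cmod (\<Sum>p\<in>P. int_parts_term K t a y k p) \<le>
    jap k * (3 * (6 * 3 powr s) * kap * R * R * R) + 3 * (48 * 3 powr s * K) * kap * R * R * R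
    + 3 * (3 * (40 * 3 powr s) * kap * R * R * R)"
proof -
  have R0: "0 \<le> R" using R norm_ge_zero order_trans by blast
  have b: "cmod (\<Sum>p\<in>P. osc_factor t k p * tri_term M f g h k p) \<le> 3 * C * kap * R * R * R"
    if M: "sym_bound C M" and "norm f \<le> R" "norm g \<le> R" "norm h \<le> R" for M C f g h
  proof (rule order_trans[OF sum_cmod_term_le[OF M P]])
    have "C \<ge> 0" using M by (simp add: sym_bound_def)
    then show "3 * C * kap * norm f * norm g * norm h \<le> 3 * C * kap * R * R * R"
      using that R0 by (intro mult_mono mult_nonneg_nonneg) auto
  qed
  have n3: "X + X + X = 3 * X" for X :: real by simp
  have n5: "cmod (A - B + (D + E + F)) \<le> cmod A + cmod B + (cmod D + cmod E + cmod F)" for A B D E F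
    by (smt (verit) norm_triangle_ineq norm_triangle_ineq4)
  have "cmod (\<Sum>p\<in>P. int_parts_term K t a y k p) \<le>
      cmod (of_real (jap k) * (\<Sum>p\<in>P. osc_factor t k p * tri_term symN a (reflect a) a k p))
      + cmod (\<Sum>p\<in>P. osc_factor t k p * tri_term (symG K) a (reflect a) a k p)
      + (cmod (\<Sum>p\<in>P. osc_factor t k p * tri_term (symD1 K) y (reflect a) a k p)
       + cmod (\<Sum>p\<in>P. osc_factor t k p * tri_term (symD2 K) a (reflect y) a k p)
       + cmod (\<Sum>p\<in>P. osc_factor t k p * tri_term (symD3 K) a (reflect a) y k p))"
    unfolding int_parts_term_def sum.distrib sum_subtractf sum_distrib_left[symmetric] by (rule n5)
  also have "\<dots> \<le> jap k * (3 * (6 * 3 powr s) * kap * R * R * R) + 3 * (48 * 3 powr s * K) * kap * R * R * R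
    + (3 * (40 * 3 powr s) * kap * R * R * R + 3 * (40 * 3 powr s) * kap * R * R * R + 3 * (40 * 3 powr s) * kap * R * R * R)"
    unfolding norm_mult norm_of_real abs_of_nonneg[OF jap_nonneg]
    by (intro add_mono mult_left_mono b sym_bound_N sym_bound_G[OF K] sym_bound_D123) (use R in auto)
  also have "\<dots> = jap k * (3 * (6 * 3 powr s) * kap * R * R * R) + 3 * (48 * 3 powr s * K) * kap * R * R * R
    + 3 * (3 * (40 * 3 powr s) * kap * R * R * R)"
    by (simp only: n3)
  finally show ?thesis .
qed

text \<open>The fundamental theorem is applied to the finitely many terms of a box, each of which is
  differentiable; the boxes then grow under the integral by dominated convergence. The curve
  \<open>y\<close> is tied to \<open>a\<close> only through the derivative and need not be
  \<open>opN\<close> of it.\<close>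

lemma integration_by_parts:
  assumes K: "K \<ge> 1" and cd: "c \<le> d"
    and ca: "continuous_on {c..d} a" and cy: "continuous_on {c..d} y"
    and a: "\<And>t k. t \<in> {c..d} \<Longrightarrow>
      ((\<lambda>t. coord (a t) k) has_vector_derivative of_real (jap k) * coord (y t) k) (at t within {c..d})"
  shows "((\<lambda>t. of_real (jap k) * coord (opN t (a t)) k - coord (opG K t (a t)) k + coord (opD K t (a t) (y t)) k)
     has_integral (coord (opB K d (a d)) k - coord (opB K c (a c)) k)) {c..d}" (is "(?g has_integral _) _")
proof -
  let ?I = "\<lambda>n. {- int n..int n} \<times> {- int n..int n}"
  let ?b = "\<lambda>t p. osc_factor t k p * tri_term (symB K) (a t) (reflect (a t)) (a t) k p"
  let ?f = "\<lambda>n t. \<Sum>p\<in>?I n. int_parts_term K t (a t) (y t) k p"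
  have int: "(?f n has_integral (\<Sum>p\<in>?I n. ?b d p - ?b c p)) {c..d}" for n
    by (intro has_integral_sum fundamental_theorem_of_calculus cd has_vector_derivative_opB_term a) auto
  obtain R1 where R1: "\<And>t. t \<in> {c..d} \<Longrightarrow> norm (a t) \<le> R1"
    using compact_imp_bounded[OF compact_continuous_image[OF ca compact_Icc]] unfolding bounded_iff by (metis imageI)
  obtain R2 where R2: "\<And>t. t \<in> {c..d} \<Longrightarrow> norm (y t) \<le> R2"
    using compact_imp_bounded[OF compact_continuous_image[OF cy compact_Icc]] unfolding bounded_iff by (metis imageI)
  define R where "R = max R1 R2"
  have R: "norm (a t) \<le> R" "norm (y t) \<le> R" if "t \<in> {c..d}" for t
    using R1[OF that] R2[OF that] by (auto simp: R_def)
  let ?h = "\<lambda>t::real. jap k * (3 * (6 * 3 powr s) * kap * R * R * R) + 3 * (48 * 3 powr s * K) * kap * R * R * R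
    + 3 * (3 * (40 * 3 powr s) * kap * R * R * R)"
  have "?g integrable_on {c..d}" and lim: "(\<lambda>n. integral {c..d} (?f n)) \<longlonglongrightarrow> integral {c..d} ?g"
    using dominated_convergence[of ?f "{c..d}" ?h ?g]
      has_integral_integrable[OF int] int_parts_bound[OF K _ R] has_sum_int_pair_symmetric[OF has_sum_int_parts[OF K]]
    by auto
  have "(\<lambda>n. \<Sum>p\<in>?I n. ?b d p - ?b c p) \<longlonglongrightarrow> coord (opB K d (a d)) k - coord (opB K c (a c)) k"
    unfolding sum_subtractf opB_def
    by (intro tendsto_diff has_sum_int_pair_symmetric has_sum_triT[OF sym_bound_B[OF K]])
  then have "integral {c..d} ?g = coord (opB K d (a d)) k - coord (opB K c (a c)) k"
    by (intro LIMSEQ_unique[OF lim[unfolded integral_unique[OF int]]])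
  then show ?thesis using integrable_integral[OF \<open>?g integrable_on {c..d}\<close>] by simp
qed

end

section \<open>The gauged equation: contraction and uniqueness\<close>

text \<open>The integral from 0 to \<open>t\<close> with its sign. Both pieces start at
  \<open>- T\<close>, so differentiability holds on the whole interval, without a case split at
  0.\<close>

definition sint :: "real \<Rightarrow> (real \<Rightarrow> 'a::banach) \<Rightarrow> real \<Rightarrow> 'a" where
  "sint T f t = integral {- T..t} f - integral {- T..0} f"

lemma sint_zero [simp]: "sint T f 0 = 0"
  by (simp add: sint_def)

lemma has_vector_derivative_sint:
  assumes "continuous_on {- T..T} f" "t \<in> {- T..T}"
  shows "(sint T f has_vector_derivative f t) (at t within {- T..T})"
  unfolding sint_def[abs_def]
  using has_vector_derivative_diff[OF integral_has_vector_derivative[OF assms] has_vector_derivative_const]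
  by simp

lemma continuous_on_sint:
  "continuous_on {- T..T} f \<Longrightarrow> continuous_on {- T..T} (sint T f)"
  by (rule continuous_on_vector_derivative) (rule has_vector_derivative_sint)

lemma sint_nonneg:
  assumes "continuous_on {- T..T} f" "0 \<le> t" "t \<le> T"
  shows "sint T f t = integral {0..t} f"
proof -
  have "f integrable_on {- T..t}"
    by (rule integrable_continuous_real, rule continuous_on_subset[OF assms(1)]) (use assms in auto)
  then show ?thesis
    unfolding sint_def using Henstock_Kurzweil_Integration.integral_combine[of "- T" 0 t f] assms
    by (simp add: algebra_simps)
qed

lemma sint_nonpos:
  assumes "continuous_on {- T..T} f" "t \<le> 0" "- T \<le> t"
  shows "sint T f t = - integral {t..0} f"
proof -
  have "f integrable_on {- T..0}"
    by (rule integrable_continuous_real, rule continuous_on_subset[OF assms(1)]) (use assms in auto)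
  then show ?thesis
    unfolding sint_def using Henstock_Kurzweil_Integration.integral_combine[of "- T" t 0 f] assms
    by (simp add: algebra_simps)
qed

lemma eq_sint:
  assumes f: "\<And>t. t \<in> {- T..T} \<Longrightarrow> (f has_vector_derivative g t) (at t within {- T..T})"
    and t: "t \<in> {- T..T}"
  shows "f t = f 0 + sint T g t"
proof -
  have T: "- T \<le> 0" "0 \<le> T" using t by auto
  have *: "(g has_integral (f u - f (- T))) {- T..u}" if "u \<in> {- T..T}" for u
    using that by (intro fundamental_theorem_of_calculus)
      (auto intro: has_vector_derivative_within_subset[OF f])
  show ?thesis
    unfolding sint_def using integral_unique[OF *[OF t]] integral_unique[OF *[of 0]] T by simp
qed

text \<open>In the sup norm weighted by \<open>exp (lam * |t|)\<close> integration gains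
  \<open>1 / lam\<close>. It is thus small on an interval of any given length, which uniqueness on
  all of \<open>{- T..T}\<close> requires.\<close>

lemma norm_sint_le_exp:
  fixes f :: "real \<Rightarrow> 'a::banach"
  assumes f: "continuous_on {- T..T} f" and lam: "lam > 0" and t: "t \<in> {- T..T}"
    and b: "\<And>t. t \<in> {- T..T} \<Longrightarrow> norm (f t) \<le> A * exp (lam * \<bar>t\<bar>)"
  shows "norm (sint T f t) \<le> A / lam * exp (lam * \<bar>t\<bar>)"
proof -
  have T: "- T \<le> 0" "0 \<le> T" using t by auto
  have "0 \<le> A" using order_trans[OF norm_ge_zero b[of 0]] T by simp
  show ?thesis
  proof (cases "0 \<le> t")
    case True
    have i: "((\<lambda>u. A * exp (lam * u)) has_integral (A / lam * exp (lam * t) - A / lam * exp (lam * 0))) {0..t}"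
      by (rule fundamental_theorem_of_calculus)
        (use True lam in \<open>auto intro!: derivative_eq_intros simp flip: has_real_derivative_iff_has_vector_derivative\<close>)
    have fi: "f integrable_on {0..t}"
      by (rule integrable_continuous_real, rule continuous_on_subset[OF f]) (use t T in auto)
    have b': "norm (f u) \<le> A * exp (lam * u)" if "u \<in> {0..t}" for u
      using b[of u] that t T by auto
    have "norm (integral {0..t} f) \<le> integral {0..t} (\<lambda>u. A * exp (lam * u))"
      by (rule integral_norm_bound_integral[OF fi has_integral_integrable[OF i] b'])
    also have "\<dots> = A / lam * exp (lam * t) - A / lam" unfolding integral_unique[OF i] by simp
    also have "\<dots> \<le> A / lam * exp (lam * \<bar>t\<bar>)" using True \<open>0 \<le> A\<close> lam by simp
    finally show ?thesis using sint_nonneg[OF f True] t by simp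
  next
    case False
    have i: "((\<lambda>u. A * exp (- lam * u)) has_integral (- A / lam * exp (- lam * 0) - (- A / lam * exp (- lam * t)))) {t..0}"
      by (rule fundamental_theorem_of_calculus)
        (use False lam in \<open>auto intro!: derivative_eq_intros simp flip: has_real_derivative_iff_has_vector_derivative\<close>)
    have b': "norm (f u) \<le> A * exp (- lam * u)" if "u \<in> {t..0}" for u
      using b[of u] that t T by auto
    have fi: "f integrable_on {t..0}"
      by (rule integrable_continuous_real, rule continuous_on_subset[OF f]) (use t T in auto)
    have "norm (integral {t..0} f) \<le> integral {t..0} (\<lambda>u. A * exp (- lam * u))"
      by (rule integral_norm_bound_integral[OF fi has_integral_integrable[OF i] b'])
    also have "\<dots> = A / lam * exp (- lam * t) - A / lam" unfolding integral_unique[OF i] by simp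
    also have "\<dots> \<le> A / lam * exp (lam * \<bar>t\<bar>)" using False \<open>0 \<le> A\<close> lam by simp
    finally show ?thesis using sint_nonpos[OF f] False t by simp
  qed
qed

text \<open>The weighted bound with \<open>lam = 1 / T\<close>; the 3 majorises
  \<open>exp 1\<close>.\<close>

lemma norm_sint_le:
  fixes f :: "real \<Rightarrow> 'a::banach"
  assumes f: "continuous_on {- T..T} f" and t: "t \<in> {- T..T}" and T: "T > 0"
    and b: "\<And>t. t \<in> {- T..T} \<Longrightarrow> norm (f t) \<le> A"
  shows "norm (sint T f t) \<le> 3 * T * A"
proof -
  have A: "0 \<le> A" using order_trans[OF norm_ge_zero b[of 0]] T by simp
  have "norm (sint T f t) \<le> A / (1 / T) * exp (1 / T * \<bar>t\<bar>)"
  proof (rule norm_sint_le_exp[OF f _ t])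
    fix u assume u: "u \<in> {- T..T}"
    have "1 \<le> exp (1 / T * \<bar>u\<bar>)" using T by simp
    then show "norm (f u) \<le> A * exp (1 / T * \<bar>u\<bar>)"
      using b[OF u] A mult_left_mono[of 1 "exp (1 / T * \<bar>u\<bar>)" A] by linarith
  qed (use T in simp)
  also have "\<dots> \<le> A / (1 / T) * 3"
  proof (intro mult_left_mono)
    have "exp (1 / T * \<bar>t\<bar>) \<le> exp 1" using t T by (auto simp: field_simps)
    then show "exp (1 / T * \<bar>t\<bar>) \<le> 3" using exp_le by linarith
  qed (use A T in simp)
  finally show ?thesis by (simp add: mult_ac)
qed

lemma sint_diff:
  fixes f g :: "real \<Rightarrow> 'a::banach"
  assumes "continuous_on {- T..T} f" "continuous_on {- T..T} g" "t \<in> {- T..T}"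
  shows "sint T f t - sint T g t = sint T (\<lambda>t. f t - g t) t"
proof -
  have "h integrable_on {- T..u}" if "continuous_on {- T..T} h" "u \<in> {- T..T}" for h :: "real \<Rightarrow> 'a" and u
    by (rule integrable_continuous_real, rule continuous_on_subset[OF that(1)]) (use that in auto)
  then show ?thesis using assms
    by (auto simp: sint_def Henstock_Kurzweil_Integration.integral_diff)
qed

section \<open>The normal form equation and its fixed point\<close>

context regularity
begin

text \<open>The rate of change of \<open>a - opB a\<close> along a solution. No derivative is lost
  here: \<open>opG\<close> is bounded on l2, and in \<open>opD\<close> the lower regularity of
  \<open>y\<close> has been compensated.\<close>

definition opF :: "real \<Rightarrow> real \<Rightarrow> int ell2 \<Rightarrow> int ell2 \<Rightarrow> int ell2" where
  "opF K t a y = opG K t a - opD K t a y"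

text \<open>The gauged equation in the interaction picture, coefficient by coefficient.\<close>

definition gsol :: "real \<Rightarrow> int ell2 \<Rightarrow> (real \<Rightarrow> int ell2) \<Rightarrow> bool" where
  "gsol T a0 a \<longleftrightarrow> continuous_on {- T..T} a \<and> a 0 = a0 \<and> (\<forall>t\<in>{- T..T}. \<forall>k.
     ((\<lambda>t. coord (a t) k) has_vector_derivative of_real (jap k) * coord (opN t (a t)) k) (at t within {- T..T}))"

text \<open>The pivot of both halves of the argument. With \<open>y = opN a\<close> it turns a
  solution into the normal form. With \<open>y\<close> unrelated to \<open>opN a\<close> it shows
  that the output of the normal form map has derivative \<open>opN a\<close>, so that the constraint
  of the iteration survives.\<close>

lemma normal_form_derivative:
  assumes K: "K \<ge> 1" and ca: "continuous_on {- T..T} a" and cy: "continuous_on {- T..T} y"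
    and a: "\<And>t k. t \<in> {- T..T} \<Longrightarrow>
      ((\<lambda>t. coord (a t) k) has_vector_derivative of_real (jap k) * coord (y t) k) (at t within {- T..T})"
    and t: "t \<in> {- T..T}"
  shows "((\<lambda>t. coord (opB K t (a t) + sint T (\<lambda>t. opF K t (a t) (y t)) t) k) has_vector_derivative
    of_real (jap k) * coord (opN t (a t)) k) (at t within {- T..T})"
proof -
  let ?g = "\<lambda>t. of_real (jap k) * coord (opN t (a t)) k - coord (opG K t (a t)) k + coord (opD K t (a t) (y t)) k"
  let ?F = "\<lambda>t. opF K t (a t) (y t)"
  have cF: "continuous_on {- T..T} ?F"
    unfolding opF_def by (intro continuous_intros continuous_on_ops[OF ca cy K])
  have cg: "continuous_on {- T..T} ?g"
    by (intro continuous_intros continuous_on_ops[OF ca cy K])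
  have i: "(?g has_integral (coord (opB K u (a u)) k - coord (opB K (- T) (a (- T))) k)) {- T..u}"
    if "u \<in> {- T..T}" for u
    using that by (intro integration_by_parts K continuous_on_subset[OF ca] continuous_on_subset[OF cy])
      (auto intro: has_vector_derivative_within_subset[OF a])
  have "((\<lambda>u. coord (opB K (- T) (a (- T))) k + integral {- T..u} ?g) has_vector_derivative ?g t) (at t within {- T..T})"
    using has_vector_derivative_add[OF has_vector_derivative_const integral_has_vector_derivative[OF cg t]] by simp
  then have "((\<lambda>u. coord (opB K u (a u)) k) has_vector_derivative ?g t) (at t within {- T..T})"
    by (rule has_vector_derivative_transform[OF t, rotated]) (simp add: integral_unique[OF i])
  moreover have "((\<lambda>u. coord (sint T ?F u) k) has_vector_derivative coord (?F t) k) (at t within {- T..T})"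
    by (rule bounded_linear.has_vector_derivative[OF bounded_linear_coord has_vector_derivative_sint[OF cF t]])
  ultimately have "((\<lambda>u. coord (opB K u (a u)) k + coord (sint T ?F u) k) has_vector_derivative ?g t + coord (?F t) k) (at t within {- T..T})"
    by (rule has_vector_derivative_add)
  then show ?thesis by (simp add: opF_def)
qed

lemma opN_lipschitz:
  assumes R: "R \<ge> 0"
  shows "\<exists>L\<ge>0. \<forall>t a b. norm a \<le> R \<longrightarrow> norm b \<le> R \<longrightarrow> norm (opN t a - opN t b) \<le> L * norm (a - b)"
proof (intro exI conjI allI impI)
  fix t and a b :: "int ell2" assume *: "norm a \<le> R" "norm b \<le> R"
  show "norm (opN t a - opN t b) \<le> (3 * (6 * 3 powr s) * kap * (3 * R * R)) * norm (a - b)"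
    unfolding opN_def
    by (rule order_trans[OF norm_triT_diff_le[OF sym_bound_N, of _ R _ R _ _ R]])
      (use * in \<open>auto simp: reflect_diff[symmetric] algebra_simps\<close>)
qed (use R in simp)

lemma opB_lipschitz:
  assumes R: "R \<ge> 0" and e: "e > 0"
  shows "\<exists>K\<ge>1. \<forall>t a b. norm a \<le> R \<longrightarrow> norm b \<le> R \<longrightarrow> norm (opB K t a - opB K t b) \<le> e * norm (a - b)"
proof -
  define Q where "Q = 3 * (40 * 3 powr s) * kap * (3 * R * R)"
  \<comment> \<open>\<open>Q / K\<close> is the Lipschitz constant on the ball for the threshold
    \<open>K\<close>; this choice gives both \<open>K >= 1\<close> and
    \<open>Q / K <= e\<close>.\<close>
  define K where "K = 1 + Q / e"
  have Q0: "Q \<ge> 0" using R by (simp add: Q_def)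
  have K: "K \<ge> 1" using Q0 e by (simp add: K_def)
  have QK: "Q / K \<le> e" using e Q0 K by (simp add: K_def field_simps)
  show ?thesis
  proof (intro exI conjI allI impI)
    fix t and a b :: "int ell2" assume *: "norm a \<le> R" "norm b \<le> R"
    have "norm (opB K t a - opB K t b) \<le> 
      3 * (40 * 3 powr s / K) * kap * (norm (a - b) * R * R + R * norm (reflect a - reflect b) * R + R * R * norm (a - b))"
      unfolding opB_def by (rule norm_triT_diff_le[OF sym_bound_B[OF K]]) (use * in auto)
    also have "\<dots> = (Q / K) * norm (a - b)"
      unfolding reflect_diff[symmetric] norm_reflect by (simp add: Q_def algebra_simps add_divide_distrib)
    also have "\<dots> \<le> e * norm (a - b)" by (intro mult_right_mono QK) simp
    finally show "norm (opB K t a - opB K t b) \<le> e * norm (a - b)" .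
  qed (rule K)
qed

lemma opF_lipschitz:
  assumes K: "K \<ge> 1" and R: "R \<ge> 0"
  shows "\<exists>L\<ge>0. \<forall>t a b y z. norm a \<le> R \<longrightarrow> norm b \<le> R \<longrightarrow> norm y \<le> R \<longrightarrow> norm z \<le> R \<longrightarrow>
     norm (opF K t a y - opF K t b z) \<le> L * (norm (a - b) + norm (y - z))"
proof (intro exI conjI allI impI)
  fix t and a b y z :: "int ell2" assume *: "norm a \<le> R" "norm b \<le> R" "norm y \<le> R" "norm z \<le> R"
  let ?C = "48 * 3 powr s * K" and ?D = "40 * 3 powr s"
  let ?m = "norm (a - b) + norm (y - z)"
  have tri_le: "norm (triT M t f g h - triT M t f' g' h') \<le> (3 * C * kap * (3 * R * R)) * ?m"
    if M: "sym_bound C M" and n: "norm f' \<le> R" "norm g \<le> R" "norm g' \<le> R" "norm h \<le> R"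
      and d: "norm (f - f') \<le> ?m" "norm (g - g') \<le> ?m" "norm (h - h') \<le> ?m" for C M f g h f' g' h'
  proof -
    have C: "C \<ge> 0" using M by (simp add: sym_bound_def)
    have "norm (triT M t f g h - triT M t f' g' h') \<le>
       3 * C * kap * (norm (f - f') * R * R + R * norm (g - g') * R + R * R * norm (h - h'))"
      by (rule norm_triT_diff_le[OF M n])
    also have "\<dots> \<le> 3 * C * kap * (?m * R * R + R * ?m * R + R * R * ?m)"
      using C R d by (intro mult_left_mono add_mono mult_right_mono mult_nonneg_nonneg) auto
    finally show ?thesis by (simp add: algebra_simps)
  qed
  \<comment> \<open>Arranged in the shape of \<open>norm_triangle4\<close>; two of the differences
    appear reversed, which \<open>norm_minus_commute\<close> undoes.\<close>
  have eq: "(g - (d1 + d2 + d3)) - (g' - (d1' + d2' + d3')) = (g - g') + (d1' - d1) + (d2' - d2) - (d3 - d3')"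
    for g g' d1 d2 d3 d1' d2' d3' :: "int ell2" by simp
  have "norm (opF K t a y - opF K t b z) \<le> (3 * ?C * kap * (3 * R * R)) * ?m + (3 * ?D * kap * (3 * R * R)) * ?m
     + (3 * ?D * kap * (3 * R * R)) * ?m + (3 * ?D * kap * (3 * R * R)) * ?m"
    unfolding opF_def opG_def opD_def eq
    apply (rule order_trans[OF norm_triangle4])
    apply (subst norm_minus_commute[of "triT (symD1 K) t z _ _"], subst norm_minus_commute[of "triT (symD2 K) t b _ _"])
    apply (intro add_mono tri_le sym_bound_G[OF K] sym_bound_D123)
    using * by (auto simp: reflect_diff[symmetric])
  then show "norm (opF K t a y - opF K t b z) \<le>
      (3 * ?C * kap * (3 * R * R) + 3 * (3 * ?D * kap * (3 * R * R))) * ?m"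
    by (simp add: algebra_simps)
qed (use K R in simp)

lemma triT_zero: assumes "sym_bound C M" shows "triT M t 0 g h = 0" "triT M t f g 0 = 0"
  using norm_triT_le[OF assms, of t 0 g h] norm_triT_le[OF assms, of t f g 0] by auto

lemma ops_zero: "opN t 0 = 0" "K \<ge> 1 \<Longrightarrow> opB K t 0 = 0" "K \<ge> 1 \<Longrightarrow> opF K t 0 0 = 0"
  by (simp_all add: opN_def opB_def opF_def opG_def opD_def triT_zero[OF sym_bound_N] triT_zero[OF sym_bound_B]
    triT_zero[OF sym_bound_G] triT_zero[OF sym_bound_D123(1)] triT_zero[OF sym_bound_D123(2)] triT_zero[OF sym_bound_D123(3)])

text \<open>Both curves satisfy the same normal form, and the threshold \<open>K\<close> may depend
  on their common bound. The difference is measured in an exponentially weighted sup norm at a time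
  where the maximum is attained.\<close>

lemma gsol_unique:
  assumes a: "gsol T a0 a" and b: "gsol T a0 b" and t: "t \<in> {- T..T}"
  shows "a t = b t"
proof -
  have T: "0 \<in> {- T..T}" using t by auto
  have ca: "continuous_on {- T..T} a" and cb: "continuous_on {- T..T} b"
    using a b by (auto simp: gsol_def)
  obtain R1 where R1: "\<And>t. t \<in> {- T..T} \<Longrightarrow> norm (a t) \<le> R1"
    using compact_imp_bounded[OF compact_continuous_image[OF ca compact_Icc]] unfolding bounded_iff by (metis imageI)
  obtain R2 where R2: "\<And>t. t \<in> {- T..T} \<Longrightarrow> norm (b t) \<le> R2"
    using compact_imp_bounded[OF compact_continuous_image[OF cb compact_Icc]] unfolding bounded_iff by (metis imageI)
  define R where "R = max R1 R2"
  have R: "norm (a t) \<le> R" "norm (b t) \<le> R" if "t \<in> {- T..T}" for t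
    using R1[OF that] R2[OF that] by (auto simp: R_def)
  have R0: "R \<ge> 0" using R[OF T] norm_ge_zero order_trans by blast
  obtain LN where LN: "LN \<ge> 0" "\<And>t a b. norm a \<le> R \<Longrightarrow> norm b \<le> R \<Longrightarrow> norm (opN t a - opN t b) \<le> LN * norm (a - b)"
    using opN_lipschitz[OF R0] by blast
  obtain K where K: "K \<ge> 1" "\<And>t a b. norm a \<le> R \<Longrightarrow> norm b \<le> R \<Longrightarrow> norm (opB K t a - opB K t b) \<le> 1/4 * norm (a - b)"
    using opB_lipschitz[OF R0, of "1/4"] by auto
  define Q where "Q = max R (LN * R)"
  have Q: "Q \<ge> 0" "R \<le> Q" "LN * R \<le> Q" using R0 by (auto simp: Q_def)
  obtain LF where LF: "LF \<ge> 0" "\<And>t a b y z. norm a \<le> Q \<Longrightarrow> norm b \<le> Q \<Longrightarrow> norm y \<le> Q \<Longrightarrow> norm z \<le> Q \<Longrightarrow>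
     norm (opF K t a y - opF K t b z) \<le> LF * (norm (a - b) + norm (y - z))"
    using opF_lipschitz[OF K(1) Q(1)] by blast
  have Nb: "norm (opN t x) \<le> Q" if "norm x \<le> R" for t x
    using LN(2)[OF that, of 0 t] R0 that Q(3) mult_left_mono[OF that LN(1)] by (simp add: ops_zero)
  let ?Fa = "\<lambda>t. opF K t (a t) (opN t (a t))" and ?Fb = "\<lambda>t. opF K t (b t) (opN t (b t))"
  have cF: "continuous_on {- T..T} ?Fa" "continuous_on {- T..T} ?Fb"
    unfolding opF_def
    by (intro continuous_intros continuous_on_ops(2,4)[OF ca continuous_on_ops(1)[OF ca ca K(1)] K(1)]
      continuous_on_ops(2,4)[OF cb continuous_on_ops(1)[OF cb cb K(1)] K(1)])+
  \<comment> \<open>For a solution the curve and \<open>normal_form_derivative\<close> with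
    \<open>y = opN\<close> have the same coefficient derivatives, hence differ by a
    constant.\<close>
  have duh: "c t - opB K t (c t) - sint T (\<lambda>t. opF K t (c t) (opN t (c t))) t = a0 - opB K 0 a0"
    if c: "gsol T a0 c" and t: "t \<in> {- T..T}" for c t
  proof (rule ell2_eqI)
    fix k
    have cc: "continuous_on {- T..T} c" using c by (simp add: gsol_def)
    have dc: "((\<lambda>t. coord (c t) k) has_vector_derivative of_real (jap k) * coord (opN t (c t)) k) (at t within {- T..T})"
      if "t \<in> {- T..T}" for t k using c that by (simp add: gsol_def)
    let ?h = "\<lambda>t. coord (c t) k - coord (opB K t (c t) + sint T (\<lambda>t. opF K t (c t) (opN t (c t))) t) k"
    have "(?h has_vector_derivative 0) (at t within {- T..T})" if "t \<in> {- T..T}" for t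
      using has_vector_derivative_diff[OF dc[OF that, of k]
          normal_form_derivative[OF K(1) cc continuous_on_ops(1)[OF cc cc K(1)] dc that, where k=k]]
      by simp
    from eq_sint[OF this t] have "?h t = ?h 0" by (simp add: sint_def)
    then show "coord (c t - opB K t (c t) - sint T (\<lambda>t. opF K t (c t) (opN t (c t))) t) k = coord (a0 - opB K 0 a0) k"
      using c by (simp add: gsol_def algebra_simps)
  qed
  have sub_aux: "x - x' = (p - p') + (q - q')" if "x - p - q = c" "x' - p' - q' = c"
    for x x' p p' q q' c :: "int ell2"
  proof -
    have "x = c + q + p" "x' = c + q' + p'" using that by (metis diff_add_cancel)+
    then show ?thesis by simp
  qed
  define CL where "CL = LF * (1 + LN)"
  \<comment> \<open>Makes \<open>CL / lam\<close> at most 1/4 and keeps \<open>lam\<close> positive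
    even if \<open>CL\<close> is 0.\<close>
  define lam where "lam = 4 * CL + 1"
  have "CL \<ge> 0" using LF(1) LN(1) by (simp add: CL_def)
  then have CL: "CL \<ge> 0" "lam > 0" by (auto simp: lam_def)
  have Fdiff: "norm (?Fa t - ?Fb t) \<le> CL * norm (a t - b t)" if "t \<in> {- T..T}" for t
  proof -
    have "norm (?Fa t - ?Fb t) \<le> LF * (norm (a t - b t) + norm (opN t (a t) - opN t (b t)))"
      using R[OF that] Q Nb by (intro LF(2)) (auto intro: order_trans)
    also have "\<dots> \<le> LF * (norm (a t - b t) + LN * norm (a t - b t))"
      using R[OF that] by (intro mult_left_mono add_left_mono LN) (use LF in auto)
    finally show ?thesis by (simp add: CL_def algebra_simps)
  qed
  have "continuous_on {- T..T} (\<lambda>t. exp (- lam * \<bar>t\<bar>) * norm (a t - b t))"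
    by (intro continuous_intros ca cb)
  then obtain tm where tm: "tm \<in> {- T..T}"
    "\<And>t. t \<in> {- T..T} \<Longrightarrow> exp (- lam * \<bar>t\<bar>) * norm (a t - b t) \<le> exp (- lam * \<bar>tm\<bar>) * norm (a tm - b tm)"
    using continuous_attains_sup[OF compact_Icc, of "- T" T] T by blast
  define M where "M = exp (- lam * \<bar>tm\<bar>) * norm (a tm - b tm)"
  have wM: "norm (a t - b t) \<le> M * exp (lam * \<bar>t\<bar>)" if "t \<in> {- T..T}" for t
  proof -
    have "exp (lam * \<bar>t\<bar>) * (exp (- lam * \<bar>t\<bar>) * norm (a t - b t)) \<le> exp (lam * \<bar>t\<bar>) * M"
      unfolding M_def by (intro mult_left_mono tm(2)[OF that]) simp
    then show ?thesis by (simp add: mult.assoc[symmetric] mult_exp_exp mult.commute)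
  qed
  have M0: "M \<ge> 0" by (simp add: M_def)
  have "norm (sint T ?Fa tm - sint T ?Fb tm) \<le> (CL * M) / lam * exp (lam * \<bar>tm\<bar>)"
    unfolding sint_diff[OF cF tm(1)]
  proof (rule norm_sint_le_exp[OF _ CL(2) tm(1)])
    show "continuous_on {- T..T} (\<lambda>t. ?Fa t - ?Fb t)" by (intro continuous_intros cF)
    fix t assume t: "t \<in> {- T..T}"
    show "norm (?Fa t - ?Fb t) \<le> CL * M * exp (lam * \<bar>t\<bar>)"
      using order_trans[OF Fdiff[OF t] mult_left_mono[OF wM[OF t] CL(1)]] by (simp add: mult.assoc)
  qed
  also have "\<dots> \<le> 1/4 * M * exp (lam * \<bar>tm\<bar>)"
    using M0 CL by (intro mult_right_mono) (auto simp: lam_def field_simps)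
  finally have P: "norm (sint T ?Fa tm - sint T ?Fb tm) \<le> 1/4 * M * exp (lam * \<bar>tm\<bar>)" .
  have "a tm - b tm = (opB K tm (a tm) - opB K tm (b tm)) + (sint T ?Fa tm - sint T ?Fb tm)"
    by (rule sub_aux[OF duh[OF a tm(1)] duh[OF b tm(1)]])
  \<comment> \<open>A quarter comes from the boundary term and a quarter from the integral. At the
    maximising time the second is also a quarter of the left side, which must therefore
    vanish.\<close>
  then have "norm (a tm - b tm) \<le> 1/4 * norm (a tm - b tm) + 1/4 * M * exp (lam * \<bar>tm\<bar>)"
    using norm_triangle_le[OF add_mono[OF K(2)[OF R[OF tm(1)]] P]] by simp
  also have "M * exp (lam * \<bar>tm\<bar>) = norm (a tm - b tm)"
    by (simp add: M_def exp_minus)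
  then have "1/4 * M * exp (lam * \<bar>tm\<bar>) = 1/4 * norm (a tm - b tm)" by simp
  finally have "norm (a tm - b tm) = 0" using norm_ge_zero[of "a tm - b tm"] by linarith
  then have "M = 0" by (simp add: M_def)
  then show "a t = b t" using wM[OF t] by simp
qed

lemma continuous_on_fst_snd_bcontfun:
  "continuous_on S (\<lambda>t. fst (apply_bcontfun F t))" "continuous_on S (\<lambda>t. snd (apply_bcontfun F t))"
  by (intro continuous_on_fst continuous_on_snd continuous_on_apply_bcontfun)+

text \<open>All parameters are chosen from \<open>r\<close> before \<open>a0\<close> is fixed, so
  one \<open>T\<close> serves the whole ball of data.\<close>

theorem gsol_exists:
  assumes r: "r \<ge> 0"
  shows "\<exists>T>0. \<forall>a0. norm a0 \<le> r \<longrightarrow> (\<exists>a. gsol T a0 a)"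
proof -
  define R where "R = r + 1"
  have R: "R \<ge> 1" using r by (simp add: R_def)
  then have R0: "R \<ge> 0" by simp
  \<comment> \<open>Serves twice: \<open>e <= 1/4\<close> is the contraction constant of
    \<open>opB\<close>, and \<open>e * R = 1/4\<close> bounds \<open>opB\<close> on the ball of
    radius \<open>R\<close>.\<close>
  define e where "e = 1 / (4 * R)"
  have e: "e > 0" "e \<le> 1/4" "e * R = 1/4" using R by (auto simp: e_def field_simps)
  obtain K where K: "K \<ge> 1" "\<And>t a b. norm a \<le> R \<Longrightarrow> norm b \<le> R \<Longrightarrow> norm (opB K t a - opB K t b) \<le> e * norm (a - b)"
    using opB_lipschitz[OF R0 e(1)] by blast
  obtain LN where LN: "LN \<ge> 0" "\<And>t a b. norm a \<le> R \<Longrightarrow> norm b \<le> R \<Longrightarrow> norm (opN t a - opN t b) \<le> LN * norm (a - b)"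
    using opN_lipschitz[OF R0] by blast
  \<comment> \<open>The second component of the map is \<open>opN\<close>, which is Lipschitz but
    neither small nor integrated in time. Storing the derivative divided by \<open>L\<close> turns
    its constant into \<open>LN / L <= 1/4\<close>.\<close>
  define L where "L = 4 * LN + 1"
  have L: "L > 0" "L \<ge> 1" "LN / L \<le> 1/4" using LN(1) by (auto simp: L_def field_simps)
  define Q where "Q = max R (LN * R)"
  have Q: "Q \<ge> 0" "R \<le> Q" "LN * R \<le> Q" using R0 by (auto simp: Q_def)
  obtain LF where LF: "LF \<ge> 0" "\<And>t a b y z. norm a \<le> Q \<Longrightarrow> norm b \<le> Q \<Longrightarrow> norm y \<le> Q \<Longrightarrow> norm z \<le> Q \<Longrightarrow>
     norm (opF K t a y - opF K t b z) \<le> LF * (norm (a - b) + norm (y - z))"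
    using opF_lipschitz[OF K(1) Q(1)] by blast
  have Nb: "norm (opN t x) \<le> Q" if "norm x \<le> R" for t x
    using LN(2)[OF that, of 0 t] R0 that Q(3) mult_left_mono[OF that LN(1)] by (simp add: ops_zero)
  have Bb: "norm (opB K t x) \<le> 1/4" if "norm x \<le> R" for t x
    using K(2)[OF that, of 0 t] R0 mult_left_mono[OF that, of e] e by (simp add: ops_zero[OF] ops_zero(2)[OF K(1)])
  have Fb: "norm (opF K t x z) \<le> LF * (2 * Q)" if "norm x \<le> Q" "norm z \<le> Q" for t x z
    using LF(2)[of x 0 z 0 t] Q(1) that mult_left_mono[of "norm x + norm z" "2 * Q" LF] LF(1)
    by (simp add: ops_zero(3)[OF K(1)])
  \<comment> \<open>Dominates both the size of \<open>opF\<close> and its Lipschitz constant in the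
    rescaled pair; with the 3 of \<open>norm_sint_le\<close>, \<open>T\<close> below makes the
    integral term cost a quarter. The summand 1 keeps \<open>D\<close> positive.\<close>
  define D where "D = LF * (2 * Q) + LF * (1 + L) + 1"
  have D: "D > 0" "LF * (2 * Q) \<le> D" "LF * (1 + L) \<le> D"
    using LF(1) Q(1) L(1) by (auto simp: D_def intro!: add_nonneg_pos)
  define T where "T = 1 / (12 * D)"
  have T: "T > 0" using D by (simp add: T_def)
  have TD: "3 * T * D = 1/4" using D by (simp add: T_def)
  have "\<exists>a. gsol T a0 a" if a0: "norm a0 \<le> r" for a0
  proof -
    \<comment> \<open>Clamping the time makes the curves bounded continuous functions on the whole
      line, a ready-made complete space.\<close>
    define cl where "cl t = max (- T) (min T t)" for t
    have cl: "cl t \<in> {- T..T}" "t \<in> {- T..T} \<Longrightarrow> cl t = t" for t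
      using T by (auto simp: cl_def)
    have ccl: "continuous_on UNIV cl" unfolding cl_def by (intro continuous_intros)
    txt \<open>The unknown is the pair of a curve and its (rescaled) time derivative; the constraint that
      ties them together is part of the complete metric space \<open>S\<close> and makes the normal form
      identity available for every iterate.\<close>
    define A :: "(real \<Rightarrow>\<^sub>C (int ell2 \<times> int ell2)) \<Rightarrow> real \<Rightarrow> int ell2" where "A F t = fst (F t)" for F t
    define Y :: "(real \<Rightarrow>\<^sub>C (int ell2 \<times> int ell2)) \<Rightarrow> real \<Rightarrow> int ell2" where "Y F t = L *\<^sub>R snd (F t)" for F t
    have cA: "continuous_on S (A F)" and cY: "continuous_on S (Y F)" for F S
      unfolding A_def Y_def by (intro continuous_intros continuous_on_fst_snd_bcontfun)+
    define P where "P F = sint T (\<lambda>t. opF K t (A F t) (Y F t))" for F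
    have cF: "continuous_on {- T..T} (\<lambda>t. opF K t (A F t) (Y F t))" for F
      unfolding opF_def by (intro continuous_intros continuous_on_ops[OF cA cY K(1)])
    \<comment> \<open>The constant is adjusted so that \<open>G1 F 0 = a0\<close> as soon as
      \<open>A F 0 = a0\<close>.\<close>
    define G1 where "G1 F t = a0 - opB K 0 a0 + (opB K t (A F t) + P F t)" for F t
    have cG1: "continuous_on {- T..T} (G1 F)" for F
      unfolding G1_def P_def by (intro continuous_intros continuous_on_sint cF continuous_on_ops[OF cA cY K(1)])
    have cN: "continuous_on {- T..T} (\<lambda>t. opN t (A F t))" for F
      by (rule continuous_on_ops(1)[OF cA cY K(1)])
    define Gf where "Gf F t = (G1 F (cl t), (1 / L) *\<^sub>R opN (cl t) (A F (cl t)))" for F t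
    have Gf_b: "Gf F \<in> bcontfun" for F
    proof -
      let ?g = "\<lambda>t. (G1 F t, (1 / L) *\<^sub>R opN t (A F t))"
      have c: "continuous_on {- T..T} ?g" by (intro continuous_intros cG1 cN)
      have "bounded (?g ` {- T..T})"
        by (rule compact_imp_bounded[OF compact_continuous_image[OF c compact_Icc]])
      then have "bounded (range (\<lambda>t. ?g (cl t)))"
        by (rule bounded_subset) (use cl(1) in auto)
      moreover have "continuous_on UNIV (\<lambda>t. ?g (cl t))"
        by (rule continuous_on_compose2[OF c ccl]) (use cl(1) in auto)
      ultimately show ?thesis by (simp add: bcontfun_def Gf_def[abs_def])
    qed
    define G where "G F = Bcontfun (Gf F)" for F
    have G: "apply_bcontfun (G F) t = Gf F t" for F t
      unfolding G_def by (simp add: Bcontfun_inverse[OF Gf_b])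
    define Phi where "Phi F t k = sint T (\<lambda>t. of_real (jap k) * coord (Y F t) k) t" for F t k
    have cYk: "continuous_on {- T..T} (\<lambda>t. of_real (jap k) * coord (Y F t) k)" for F k
      by (intro continuous_intros cY)
    define S where "S = {F. (\<forall>t. norm (A F t) \<le> R \<and> norm (Y F t) \<le> Q) \<and>
       (\<forall>t\<in>{- T..T}. \<forall>k. coord (A F t) k = coord a0 k + Phi F t k)}"
    have dA: "norm (A F t - A H t) \<le> dist F H" for F H t
    proof -
      have "norm (A F t - A H t) = dist (fst (F t)) (fst (H t))" by (simp add: A_def dist_norm)
      also have "\<dots> \<le> dist (F t) (H t)" by (rule dist_fst_le)
      also have "\<dots> \<le> dist F H" by (rule dist_bounded)
      finally show ?thesis .
    qed
    have dY: "norm (Y F t - Y H t) \<le> L * dist F H" for F H t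
    proof -
      have "norm (Y F t - Y H t) = L * dist (snd (F t)) (snd (H t))"
        using L by (simp add: Y_def dist_norm flip: scaleR_diff_right)
      also have "dist (snd (F t)) (snd (H t)) \<le> dist (F t) (H t)" by (rule dist_snd_le)
      also have "\<dots> \<le> dist F H" by (rule dist_bounded)
      finally show ?thesis using L by simp
    qed
    have contA: "continuous_on UNIV (\<lambda>F. A F t)" for t
    proof (rule lipschitz_on_continuous_on)
      show "1-lipschitz_on UNIV (\<lambda>F. A F t)"
        by (rule lipschitz_onI) (use dA in \<open>auto simp: dist_norm\<close>)
    qed
    have contY: "continuous_on UNIV (\<lambda>F. Y F t)" for t
    proof (rule lipschitz_on_continuous_on)
      show "L-lipschitz_on UNIV (\<lambda>F. Y F t)"
        by (rule lipschitz_onI) (use dY L in \<open>auto simp: dist_norm\<close>)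
    qed
    \<comment> \<open>The bracket \<open>jap k\<close> is unbounded in \<open>k\<close> but a
      constant for each \<open>k\<close>. Imposing the derivative constraint coefficientwise
      therefore yields a closed condition.\<close>
    have contPhi: "continuous_on UNIV (\<lambda>F. Phi F t k)" if t: "t \<in> {- T..T}" for t k
    proof (rule lipschitz_on_continuous_on)
      show "(3 * T * (jap k * L))-lipschitz_on UNIV (\<lambda>F. Phi F t k)"
      proof (rule lipschitz_onI)
        fix F H
        have "norm (Phi F t k - Phi H t k) \<le> 3 * T * (jap k * (L * dist F H))"
          unfolding Phi_def sint_diff[OF cYk cYk t]
        proof (rule norm_sint_le[OF _ t T])
          fix u
          show "cmod (of_real (jap k) * coord (Y F u) k - of_real (jap k) * coord (Y H u) k) \<le> jap k * (L * dist F H)"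
            using cmod_coord_le_norm[of "Y F u - Y H u" k] dY[of F u H]
            by (simp add: norm_mult flip: right_diff_distrib)
        qed (intro continuous_intros cY)
        then show "dist (Phi F t k) (Phi H t k) \<le> 3 * T * (jap k * L) * dist F H"
          by (simp add: dist_norm mult_ac)
      qed (use T L in simp)
    qed
    have "closed S"
    proof -
      have "S = (\<Inter>t. {F. norm (A F t) \<le> R} \<inter> {F. norm (Y F t) \<le> Q}) \<inter>
         (\<Inter>t\<in>{- T..T}. \<Inter>k. {F. coord (A F t) k = coord a0 k + Phi F t k})"
        unfolding S_def by blast
      moreover have "closed \<dots>"
        by (intro closed_Int closed_INT ballI closed_Collect_le closed_Collect_eq continuous_intros
           contA contY contPhi)
      ultimately show ?thesis by simp
    qed
    then have compl: "complete S" by (simp add: complete_eq_closed)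
    have ne: "S \<noteq> {}"
    proof -
      \<comment> \<open>The constant curve \<open>a0\<close> with zero derivative satisfies the
        constraint.\<close>
      have "const_bcontfun (a0, 0) \<in> S"
        using a0 R Q by (auto simp: S_def A_def Y_def Phi_def sint_def R_def)
      then show ?thesis by blast
    qed
    have GS: "G F \<in> S" if F: "F \<in> S" for F
    proof -
      have FA: "norm (A F t) \<le> R" and FY: "norm (Y F t) \<le> Q" for t using F by (auto simp: S_def)
      have FQ: "norm (A F t) \<le> Q" for t using FA Q(2) order_trans by blast
      have GA: "A (G F) t = G1 F (cl t)" and GY: "Y (G F) t = opN (cl t) (A F (cl t))" for t
        using L by (auto simp: A_def[of "G F"] Y_def[of "G F"] G Gf_def)
      have Pb: "norm (P F t) \<le> 1/4" if "t \<in> {- T..T}" for t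
      proof -
        have "norm (P F t) \<le> 3 * T * D" unfolding P_def
          by (rule norm_sint_le[OF cF that T]) (use Fb[OF FQ FY] D(2) order_trans in blast)
        then show ?thesis using TD by simp
      qed
      have "norm (G1 F t) \<le> R" if "t \<in> {- T..T}" for t
      proof -
        have "norm (G1 F t) \<le> norm a0 + norm (opB K 0 a0) + (norm (opB K t (A F t)) + norm (P F t))"
          unfolding G1_def by (intro norm_triangle_le norm_triangle_le_diff add_mono order_refl)
        also have "\<dots> \<le> r + 1/4 + (1/4 + 1/4)"
          using a0 by (intro add_mono Bb FA Pb that) (auto simp: R_def)
        finally show ?thesis by (simp add: R_def)
      qed
      \<comment> \<open>The constraint is inherited: since \<open>Y F\<close> represents the
        derivative of \<open>A F\<close>, the normal form identity gives \<open>G1 F\<close> the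
        derivative \<open>opN\<close> of \<open>A F\<close>, which is what the second component of
        \<open>G F\<close> records.\<close>
      moreover have "coord (G1 F t) k = coord a0 k + sint T (\<lambda>t. of_real (jap k) * coord (opN t (A F t)) k) t"
        if t: "t \<in> {- T..T}" for t k
      proof -
        have rel: "coord (A F t) k = coord a0 k + Phi F t k" if "t \<in> {- T..T}" for t k
          using F that by (simp add: S_def)
        have dA: "((\<lambda>t. coord (A F t) k) has_vector_derivative of_real (jap k) * coord (Y F t) k) (at t within {- T..T})"
          if t: "t \<in> {- T..T}" for t k
        proof -
          have "((\<lambda>t. coord a0 k + Phi F t k) has_vector_derivative of_real (jap k) * coord (Y F t) k) (at t within {- T..T})"
            unfolding Phi_def
            using has_vector_derivative_add[OF has_vector_derivative_const has_vector_derivative_sint[OF cYk t]] by simp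
          then show ?thesis by (rule has_vector_derivative_transform[OF t, rotated]) (simp add: rel)
        qed
        have A0: "A F 0 = a0"
          using rel[of 0] T by (intro ell2_eqI) (simp add: Phi_def)
        have "((\<lambda>t. coord (G1 F t) k) has_vector_derivative of_real (jap k) * coord (opN t (A F t)) k) (at t within {- T..T})"
          if t: "t \<in> {- T..T}" for t
          using has_vector_derivative_add[OF has_vector_derivative_const[of "coord (a0 - opB K 0 a0) k"]
              normal_form_derivative[OF K(1) cA cY dA t, where k=k]]
          by (simp add: G1_def P_def)
        from eq_sint[OF this t] have "coord (G1 F t) k = coord (G1 F 0) k + sint T (\<lambda>t. of_real (jap k) * coord (opN t (A F t)) k) t" .
        moreover have "G1 F 0 = a0" by (simp add: G1_def P_def A0)
        ultimately show ?thesis by simp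
      qed
      moreover have "sint T (\<lambda>t. of_real (jap k) * coord (opN t (A F t)) k) t = Phi (G F) t k" if t: "t \<in> {- T..T}" for t k
        unfolding Phi_def GY sint_def
        using t T cl(2) by (auto intro!: arg_cong2[where f="(-)"] Henstock_Kurzweil_Integration.integral_cong)
      ultimately show ?thesis
        unfolding S_def using Nb[OF FA] cl by (simp add: GA GY)
    qed
    have contr: "dist (G F) (G H) \<le> 3/4 * dist F H" if F: "F \<in> S" and H: "H \<in> S" for F H
    proof (rule dist_bound)
      fix t
      let ?t = "cl t"
      let ?d = "dist F H"
      have FA: "norm (A F t) \<le> R" and FY: "norm (Y F t) \<le> Q" for t using F by (auto simp: S_def)
      have FQ: "norm (A F t) \<le> Q" for t using FA Q(2) order_trans by blast
      have HA: "norm (A H t) \<le> R" and HY: "norm (Y H t) \<le> Q" for t using H by (auto simp: S_def)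
      have HQ: "norm (A H t) \<le> Q" for t using HA Q(2) order_trans by blast
      have "norm (P F ?t - P H ?t) \<le> 3 * T * (D * ?d)"
        unfolding P_def sint_diff[OF cF cF cl(1)]
      proof (rule norm_sint_le[OF _ cl(1) T])
        fix u
        have "norm (opF K u (A F u) (Y F u) - opF K u (A H u) (Y H u)) \<le> LF * (norm (A F u - A H u) + norm (Y F u - Y H u))"
          by (intro LF FQ FY HQ HY)
        also have "\<dots> \<le> LF * (?d + L * ?d)"
          by (intro mult_left_mono add_mono dA dY LF)
        also have "\<dots> = (LF * (1 + L)) * ?d" by (simp add: algebra_simps)
        also have "\<dots> \<le> D * ?d" by (intro mult_right_mono D) simp
        finally show "norm (opF K u (A F u) (Y F u) - opF K u (A H u) (Y H u)) \<le> D * ?d" .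
      qed (intro continuous_intros cF)
      also have "\<dots> = 1/4 * ?d" using TD by (simp add: mult.assoc[symmetric])
      finally have P: "norm (P F ?t - P H ?t) \<le> 1/4 * ?d" .
      have "norm (opB K ?t (A F ?t) - opB K ?t (A H ?t)) \<le> e * norm (A F ?t - A H ?t)"
        by (intro K FA HA)
      also have "\<dots> \<le> 1/4 * ?d" using e by (intro mult_mono dA) auto
      finally have B: "norm (opB K ?t (A F ?t) - opB K ?t (A H ?t)) \<le> 1/4 * ?d" .
      have eq: "G1 F ?t - G1 H ?t = (opB K ?t (A F ?t) - opB K ?t (A H ?t)) + (P F ?t - P H ?t)"
        by (simp add: G1_def)
      have X: "norm (G1 F ?t - G1 H ?t) \<le> 1/4 * ?d + 1/4 * ?d"
        unfolding eq by (rule norm_triangle_le[OF add_mono[OF B P]])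
      have "norm ((1 / L) *\<^sub>R opN ?t (A F ?t) - (1 / L) *\<^sub>R opN ?t (A H ?t)) = 1 / L * norm (opN ?t (A F ?t) - opN ?t (A H ?t))"
        using L by (simp flip: scaleR_diff_right)
      also have "\<dots> \<le> 1 / L * (LN * ?d)"
        using L LN(1) by (intro mult_left_mono order_trans[OF LN(2)[OF FA HA]] dA) auto
      also have "\<dots> = LN / L * ?d" by simp
      also have "\<dots> \<le> 1/4 * ?d" by (intro mult_right_mono L) simp
      finally have N: "norm ((1 / L) *\<^sub>R opN ?t (A F ?t) - (1 / L) *\<^sub>R opN ?t (A H ?t)) \<le> 1/4 * ?d" .
      have "dist (G F t) (G H t) \<le> norm (G1 F ?t - G1 H ?t) + norm ((1 / L) *\<^sub>R opN ?t (A F ?t) - (1 / L) *\<^sub>R opN ?t (A H ?t))"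
        unfolding G Gf_def dist_norm diff_Pair by (rule norm_Pair_le)
      also have "\<dots> \<le> 3/4 * ?d" using X N by simp
      finally show "dist (G F t) (G H t) \<le> 3/4 * ?d" .
    qed
    have "\<exists>!F\<in>S. G F = F"
      by (rule Banach_fix[OF compl ne, of "3/4"]) (use GS contr in auto)
    then obtain F where F: "F \<in> S" "G F = F" by blast
    \<comment> \<open>This relation is special to the fixed point; for other members of
      \<open>S\<close> the stored derivative and \<open>opN\<close> may differ.\<close>
    have fixA: "Y F t = opN t (A F t)" if "t \<in> {- T..T}" for t
    proof -
      have "Y (G F) t = opN (cl t) (A F (cl t))"
        using L by (auto simp: Y_def[of "G F"] G Gf_def)
      then show ?thesis using F cl(2)[OF that] by simp
    qed
    have rel: "coord (A F t) k = coord a0 k + Phi F t k" if "t \<in> {- T..T}" for t k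
      using F that by (simp add: S_def)
    have "gsol T a0 (A F)"
      unfolding gsol_def
    proof (intro conjI ballI allI cA)
      show "A F 0 = a0" using rel[of 0] T by (intro ell2_eqI) (simp add: Phi_def)
      fix t k assume t: "t \<in> {- T..T}"
      have "((\<lambda>t. coord a0 k + Phi F t k) has_vector_derivative of_real (jap k) * coord (Y F t) k) (at t within {- T..T})"
        unfolding Phi_def
        using has_vector_derivative_add[OF has_vector_derivative_const has_vector_derivative_sint[OF cYk t]] by simp
      then have "((\<lambda>t. coord (A F t) k) has_vector_derivative of_real (jap k) * coord (Y F t) k) (at t within {- T..T})"
        by (rule has_vector_derivative_transform[OF t, rotated]) (simp add: rel)
      then show "((\<lambda>t. coord (A F t) k) has_vector_derivative of_real (jap k) * coord (opN t (A F t)) k) (at t within {- T..T})"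
        by (simp add: fixA[OF t])
    qed
    then show ?thesis by blast
  qed
  then show ?thesis using T by blast
qed

end

section \<open>The gauge transformation\<close>

context regularity
begin

lemma abs_jap_powr_minus_s_le_1: "\<bar>jap k powr (- s)\<bar> \<le> 1"
  using s_gt_1 jap_powr_le_1[of "- s" k] by simp

definition damp :: "int ell2 \<Rightarrow> int ell2" where "damp = diag (\<lambda>k. jap k powr (- s))"

lemma coord_damp [simp]: "coord (damp f) k = of_real (jap k powr (- s)) * coord f k"
  unfolding damp_def by (rule coord_diag[OF abs_jap_powr_minus_s_le_1])

lemma continuous_on_damp: "continuous_on S f \<Longrightarrow> continuous_on S (\<lambda>t. damp (f t))"
  unfolding damp_def by (rule continuous_on_diag[OF abs_jap_powr_minus_s_le_1])

text \<open>For the normalised coefficients of u this is the squared L2 norm of u divided by 2 pi: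
  \<open>damp\<close> removes the normalisation.\<close>

definition mass :: "int ell2 \<Rightarrow> real" where "mass f = (norm (damp f))\<^sup>2"

lemma continuous_on_mass: "continuous_on S f \<Longrightarrow> continuous_on S (\<lambda>t. mass (f t))"
  unfolding mass_def by (intro continuous_intros continuous_on_damp)

lemma mass_phase [simp]: "mass (phase \<theta> f) = mass f"
proof -
  have "damp (phase \<theta> f) = phase \<theta> (damp f)" by (rule ell2_eqI) (simp add: mult_ac)
  then show ?thesis by (simp add: mass_def)
qed

text \<open>The terms with \<open>x + y = 0\<close> are a pure transport term with speed proportional to the mass.\<close>

lemma nonlinearity_split:
  "of_real (jap k) * coord (tri symNf f (reflect f) f) k =
   of_real (jap k) * coord (tri symN f (reflect f) f) k + 6 * \<i> * of_int k * of_real (mass f) * coord f k"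
proof -
  let ?t = "tri_term symNf f (reflect f) f k"
  let ?c = "6 * \<i> * of_int k * of_real (1 / jap k) * coord f k"
  have "b = - a" if "a + b = 0" for a b :: int using that by simp
  then have antidiag: "range (\<lambda>x::int. (x, - x)) = {p. fst p + snd p = 0}"
    by (auto simp: image_iff)
  have "((\<lambda>x. (cmod (coord (damp f) x))\<^sup>2) has_sum mass f) UNIV"
    unfolding mass_def by (rule has_sum_coord_power2)
  then have "((\<lambda>x. complex_of_real ((cmod (coord (damp f) x))\<^sup>2)) has_sum of_real (mass f)) UNIV"
    by (rule has_sum_of_real)
  from has_sum_cmult_right[OF this, of ?c]
  have "((\<lambda>x. ?c * of_real ((cmod (coord (damp f) x))\<^sup>2)) has_sum (?c * of_real (mass f))) UNIV" .
  note h1 = this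
  \<comment> \<open>On the antidiagonal the third frequency is \<open>k\<close> itself and the slots
    \<open>x\<close>, \<open>- x\<close> multiply to a squared modulus; of the output weight of
    order \<open>s - 1\<close> only \<open>1 / jap k\<close> remains.\<close>
  have h2: "?c * of_real ((cmod (coord (damp f) x))\<^sup>2) = (?t \<circ> (\<lambda>x. (x, - x))) x" for x
  proof -
    have 1: "complex_of_real ((cmod (coord (damp f) x))\<^sup>2) = of_real (jap x powr (- s) * jap x powr (- s)) * (coord f x * cnj (coord f x))"
      by (simp only: complex_norm_square) (simp add: mult_ac)
    have 2: "jap k powr (s - 1) / (jap x powr s * jap x powr s * jap k powr s) = 1 / jap k * (jap x powr (- s) * jap x powr (- s))"
      by (simp add: powr_diff powr_minus divide_simps)
    have 3: "(?t \<circ> (\<lambda>x. (x, - x))) x = 6 * \<i> * of_int k *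
        of_real (jap k powr (s - 1) / (jap x powr s * jap x powr s * jap k powr s)) * coord f x * cnj (coord f x) * coord f k"
      by (simp add: tri_term_def symNf_def pw_def)
    show ?thesis unfolding 1 3 2 by (simp add: mult_ac)
  qed
  have "((\<lambda>x. (?t \<circ> (\<lambda>x. (x, - x))) x) has_sum (?c * of_real (mass f))) UNIV"
    using h1 unfolding h2 .
  then have "(?t has_sum (?c * of_real (mass f))) (range (\<lambda>x. (x, - x)))"
    by (subst has_sum_reindex) (auto simp: inj_on_def o_def)
  then have "((\<lambda>p. if fst p + snd p = 0 then ?t p else 0) has_sum (?c * of_real (mass f))) UNIV"
    by (rule has_sum_cong_neutral[THEN iffD1, rotated -1]) (auto simp: antidiag)
  from has_sum_add[OF has_sum_tri[OF sym_bound_N, of f "reflect f" f k] this]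
  have "(?t has_sum (coord (tri symN f (reflect f) f) k + ?c * of_real (mass f))) UNIV"
    by (rule has_sum_cong[THEN iffD1, rotated]) (simp add: tri_term_def symN_def)
  from has_sum_unique[OF has_sum_tri[OF sym_bound_Nf] this] show ?thesis
    by (simp add: distrib_left)
qed

text \<open>A phase linear in \<open>k\<close> is a translation in space, and translations commute
  with Fourier multipliers because the input frequencies add up to the output frequency.\<close>

lemma tri_phase_linear:
  assumes M: "sym_bound C M"
  shows "tri M (phase (\<lambda>k. real_of_int k * \<tau>) f) (phase (\<lambda>k. real_of_int k * \<tau>) g) (phase (\<lambda>k. real_of_int k * \<tau>) h)
    = phase (\<lambda>k. real_of_int k * \<tau>) (tri M f g h)"
proof (rule ell2_eqI)
  fix k
  have c: "cis (real_of_int (fst p) * \<tau>) * cis (real_of_int (snd p) * \<tau>) * cis (real_of_int (k - fst p - snd p) * \<tau>) = cis (real_of_int k * \<tau>)"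
    for p :: "int \<times> int"
  proof -
    have "real_of_int (fst p) * \<tau> + real_of_int (snd p) * \<tau> + real_of_int (k - fst p - snd p) * \<tau> = real_of_int k * \<tau>"
      by (simp add: algebra_simps)
    then show ?thesis unfolding cis_mult by simp
  qed
  have "tri_term M (phase (\<lambda>k. real_of_int k * \<tau>) f) (phase (\<lambda>k. real_of_int k * \<tau>) g) (phase (\<lambda>k. real_of_int k * \<tau>) h) k
     = (\<lambda>p. cis (real_of_int k * \<tau>) * tri_term M f g h k p)"
  proof
    fix p :: "int \<times> int"
    show "tri_term M (phase (\<lambda>k. real_of_int k * \<tau>) f) (phase (\<lambda>k. real_of_int k * \<tau>) g) (phase (\<lambda>k. real_of_int k * \<tau>) h) k p
       = cis (real_of_int k * \<tau>) * tri_term M f g h k p"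
      unfolding c[of p, symmetric] by (simp only: tri_term_def coord_phase mult_ac)
  qed
  then have "(tri_term M (phase (\<lambda>k. real_of_int k * \<tau>) f) (phase (\<lambda>k. real_of_int k * \<tau>) g) (phase (\<lambda>k. real_of_int k * \<tau>) h) k
     has_sum (cis (real_of_int k * \<tau>) * coord (tri M f g h) k)) UNIV"
    using has_sum_cmult_right[OF has_sum_tri[OF M]] by simp
  then show "coord (tri M (phase (\<lambda>k. real_of_int k * \<tau>) f) (phase (\<lambda>k. real_of_int k * \<tau>) g) (phase (\<lambda>k. real_of_int k * \<tau>) h)) k
    = coord (phase (\<lambda>k. real_of_int k * \<tau>) (tri M f g h)) k"
    using has_sum_unique[OF has_sum_tri[OF M]] by simp
qed

text \<open>The passage to the interaction picture composed with the translation by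
  \<open>6 * \<tau>\<close>, where \<open>\<tau>\<close> will be the time integral of the
  mass.\<close>

definition gauge :: "real \<Rightarrow> real \<Rightarrow> int \<Rightarrow> real" where
  "gauge \<tau> t k = - cub t k - real_of_int k * (6 * \<tau>)"

lemma coord_opN_gauge:
  "coord (opN t (phase (gauge \<tau> t) c)) k = cis (gauge \<tau> t k) * coord (tri symN c (reflect c) c) k"
proof -
  have 1: "phase (cub t) (phase (gauge \<tau> t) c) = phase (\<lambda>k. real_of_int k * (- 6 * \<tau>)) c"
    unfolding phase_phase gauge_def by (simp add: mult_ac)
  have 2: "phase (cub t) (reflect (phase (gauge \<tau> t) c)) = phase (\<lambda>k. real_of_int k * (- 6 * \<tau>)) (reflect c)"
    by (rule ell2_eqI) (simp add: gauge_def cub_def cis_cnj cis_mult mult.assoc[symmetric])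
  show ?thesis
    unfolding opN_def triT_def 1 2 tri_phase_linear[OF sym_bound_N]
    by (simp add: gauge_def cis_mult mult.assoc[symmetric])
qed

text \<open>The original equation for the normalised Fourier coefficients.\<close>

definition usol :: "real \<Rightarrow> int ell2 \<Rightarrow> (real \<Rightarrow> int ell2) \<Rightarrow> bool" where
  "usol T c0 c \<longleftrightarrow> continuous_on {- T..T} c \<and> c 0 = c0 \<and> (\<forall>t\<in>{- T..T}. \<forall>k.
     ((\<lambda>t. cis (- cub t k) * coord (c t) k) has_vector_derivative
       cis (- cub t k) * (of_real (jap k) * coord (tri symNf (c t) (reflect (c t)) (c t)) k)) (at t within {- T..T}))"

lemma has_vector_derivative_cis_linear:
  assumes "(\<tau> has_vector_derivative m) (at t within S)"
  shows "((\<lambda>t. cis (r * \<tau> t)) has_vector_derivative \<i> * of_real (r * m) * cis (r * \<tau> t)) (at t within S)"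
proof -
  have "((\<lambda>t. \<i> * of_real (r * \<tau> t)) has_vector_derivative \<i> * of_real (r * m)) (at t within S)"
    by (intro has_vector_derivative_mult_right has_vector_derivative_of_real)
      (use assms in \<open>auto intro!: derivative_eq_intros simp: has_real_derivative_iff_has_vector_derivative[symmetric]\<close>)
  from field_vector_diff_chain_within[OF this has_field_derivative_at_within[OF DERIV_exp]]
  show ?thesis by (simp add: cis_conv_exp o_def)
qed

lemma continuous_on_gauge: "continuous_on S \<tau> \<Longrightarrow> continuous_on S (\<lambda>t. gauge (\<tau> t) t k)"
  unfolding gauge_def cub_def by (intro continuous_intros)

text \<open>Differentiating the translation phase produces \<open>-6 i k\<close> times the mass,
  which cancels the transport term of \<open>nonlinearity_split\<close>.\<close>

lemma usol_imp_gsol: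
  assumes c: "usol T c0 c" and T: "T \<ge> 0"
  defines "\<tau> \<equiv> sint T (\<lambda>t. mass (c t))"
  shows "gsol T c0 (\<lambda>t. phase (gauge (\<tau> t) t) (c t))"
  unfolding gsol_def
proof (intro conjI ballI allI)
  have cc: "continuous_on {- T..T} c" using c by (simp add: usol_def)
  have cm: "continuous_on {- T..T} (\<lambda>t. mass (c t))" by (rule continuous_on_mass[OF cc])
  have c\<tau>: "continuous_on {- T..T} \<tau>" unfolding \<tau>_def by (rule continuous_on_sint[OF cm])
  show "continuous_on {- T..T} (\<lambda>t. phase (gauge (\<tau> t) t) (c t))"
    by (intro continuous_on_phase continuous_on_gauge cc c\<tau>)
  have "gauge (\<tau> 0) 0 = (\<lambda>k. 0)" by (rule ext) (simp add: gauge_def cub_def \<tau>_def)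
  then show "phase (gauge (\<tau> 0) 0) (c 0) = c0" using c by (simp add: usol_def)
  fix t k assume t: "t \<in> {- T..T}"
  have d\<tau>: "(\<tau> has_vector_derivative mass (c t)) (at t within {- T..T})"
    unfolding \<tau>_def by (rule has_vector_derivative_sint[OF cm t])
  have g: "cis (gauge \<tau> t k) = cis (- 6 * real_of_int k * \<tau>) * cis (- cub t k)" for \<tau> t
    unfolding gauge_def cis_mult by (simp add: algebra_simps)
  have "((\<lambda>t. cis (- 6 * real_of_int k * \<tau> t) * (cis (- cub t k) * coord (c t) k)) has_vector_derivative
     cis (- 6 * real_of_int k * \<tau> t) * (cis (- cub t k) * (of_real (jap k) * coord (tri symNf (c t) (reflect (c t)) (c t)) k))
     + \<i> * of_real (- 6 * real_of_int k * mass (c t)) * cis (- 6 * real_of_int k * \<tau> t) * (cis (- cub t k) * coord (c t) k)) (at t within {- T..T})"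
    by (intro has_vector_derivative_mult has_vector_derivative_cis_linear d\<tau>)
      (use c t in \<open>simp add: usol_def\<close>)
  moreover have "cis (- 6 * real_of_int k * \<tau> t) * (cis (- cub t k) * (of_real (jap k) * coord (tri symNf (c t) (reflect (c t)) (c t)) k))
     + \<i> * of_real (- 6 * real_of_int k * mass (c t)) * cis (- 6 * real_of_int k * \<tau> t) * (cis (- cub t k) * coord (c t) k)
     = of_real (jap k) * coord (opN t (phase (gauge (\<tau> t) t) (c t))) k"
    unfolding coord_opN_gauge nonlinearity_split g by (simp add: algebra_simps)
  ultimately show "((\<lambda>t. coord (phase (gauge (\<tau> t) t) (c t)) k) has_vector_derivative
     of_real (jap k) * coord (opN t (phase (gauge (\<tau> t) t) (c t))) k) (at t within {- T..T})"
    by (simp add: g mult.assoc)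
qed

text \<open>The mass ignores phases, so the shift can be computed from the gauged curve before the
  original one is known.\<close>

lemma gsol_imp_usol:
  assumes a: "gsol T a0 a" and T: "T \<ge> 0"
  shows "\<exists>c. usol T a0 c"
proof -
  have ca: "continuous_on {- T..T} a" using a by (simp add: gsol_def)
  have cm: "continuous_on {- T..T} (\<lambda>t. mass (a t))" by (rule continuous_on_mass[OF ca])
  define \<tau> where "\<tau> = sint T (\<lambda>t. mass (a t))"
  have c\<tau>: "continuous_on {- T..T} \<tau>" unfolding \<tau>_def by (rule continuous_on_sint[OF cm])
  define c where "c t = phase (\<lambda>k. - gauge (\<tau> t) t k) (a t)" for t
  have ac: "a t = phase (gauge (\<tau> t) t) (c t)" and mc: "mass (a t) = mass (c t)" for t
    unfolding c_def by (simp_all add: phase_phase)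
  have "usol T a0 c" unfolding usol_def
  proof (intro conjI ballI allI)
    show "continuous_on {- T..T} c" unfolding c_def
      by (intro continuous_on_phase continuous_on_minus continuous_on_gauge ca c\<tau>)
    have "gauge (\<tau> 0) 0 = (\<lambda>k. 0)" by (rule ext) (simp add: gauge_def cub_def \<tau>_def)
    then show "c 0 = a0" using a by (simp add: c_def gsol_def)
    fix t k assume t: "t \<in> {- T..T}"
    have d\<tau>: "(\<tau> has_vector_derivative mass (c t)) (at t within {- T..T})"
      unfolding \<tau>_def mc[symmetric] by (rule has_vector_derivative_sint[OF cm t])
    have g: "cis (6 * real_of_int k * \<tau>) * cis (gauge \<tau> t k) = cis (- cub t k)" for \<tau> t
      unfolding gauge_def cis_mult by (simp add: algebra_simps)
    have g': "cis (6 * real_of_int k * \<tau> t) * coord (a t) k = cis (- cub t k) * coord (c t) k" for t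
      unfolding ac by (simp add: g flip: mult.assoc)
    have "((\<lambda>t. cis (6 * real_of_int k * \<tau> t) * coord (a t) k) has_vector_derivative
       cis (6 * real_of_int k * \<tau> t) * (of_real (jap k) * coord (opN t (a t)) k)
       + \<i> * of_real (6 * real_of_int k * mass (c t)) * cis (6 * real_of_int k * \<tau> t) * coord (a t) k) (at t within {- T..T})"
      by (intro has_vector_derivative_mult has_vector_derivative_cis_linear d\<tau>)
        (use a t in \<open>simp add: gsol_def\<close>)
    moreover have "cis (6 * real_of_int k * \<tau> t) * (of_real (jap k) * coord (opN t (a t)) k)
       + \<i> * of_real (6 * real_of_int k * mass (c t)) * cis (6 * real_of_int k * \<tau> t) * coord (a t) k
       = cis (- cub t k) * (of_real (jap k) * coord (tri symNf (c t) (reflect (c t)) (c t)) k)"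
    proof -
      have "cis (6 * real_of_int k * \<tau> t) * (of_real (jap k) * coord (opN t (a t)) k)
       + \<i> * of_real (6 * real_of_int k * mass (c t)) * cis (6 * real_of_int k * \<tau> t) * coord (a t) k
       = (cis (6 * real_of_int k * \<tau> t) * cis (gauge (\<tau> t) t k)) * (of_real (jap k) * coord (tri symN (c t) (reflect (c t)) (c t)) k)
        + \<i> * of_real (6 * real_of_int k * mass (c t)) * (cis (6 * real_of_int k * \<tau> t) * coord (a t) k)"
        unfolding ac[of t] coord_opN_gauge by (simp add: mult_ac)
      also have "\<dots> = cis (- cub t k) * (of_real (jap k) * coord (tri symNf (c t) (reflect (c t)) (c t)) k)"
        unfolding g g' nonlinearity_split by (simp add: algebra_simps)
      finally show ?thesis .
    qed
    ultimately show "((\<lambda>t. cis (- cub t k) * coord (c t) k) has_vector_derivative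
       cis (- cub t k) * (of_real (jap k) * coord (tri symNf (c t) (reflect (c t)) (c t)) k)) (at t within {- T..T})"
      by (simp only: g')
  qed
  then show ?thesis by blast
qed

text \<open>Each solution brings its own gauge. Equality of the gauged curves forces equal masses at
  all times, hence equal shifts, and then the common phase can be removed.\<close>

theorem usol_unique:
  assumes c: "usol T c0 c" and d: "usol T c0 d" and t: "t \<in> {- T..T}"
  shows "c t = d t"
proof -
  have T: "T \<ge> 0" using t by auto
  define \<tau> where "\<tau> c = sint T (\<lambda>t. mass (c t))" for c
  have eq: "phase (gauge (\<tau> c t) t) (c t) = phase (gauge (\<tau> d t) t) (d t)" if "t \<in> {- T..T}" for t
    unfolding \<tau>_def by (rule gsol_unique[OF usol_imp_gsol[OF c T] usol_imp_gsol[OF d T] that])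
  have m: "mass (c t) = mass (d t)" if "t \<in> {- T..T}" for t
    using arg_cong[OF eq[OF that], of mass] by simp
  have "\<tau> c t = \<tau> d t"
    unfolding \<tau>_def sint_def
    using t m by (intro arg_cong2[where f="(-)"] Henstock_Kurzweil_Integration.integral_cong) auto
  then have "phase (\<lambda>k. - gauge (\<tau> c t) t k) (phase (gauge (\<tau> c t) t) (c t)) = phase (\<lambda>k. - gauge (\<tau> c t) t k) (phase (gauge (\<tau> c t) t) (d t))"
    using eq[OF t] by simp
  then show ?thesis by (simp add: phase_phase)
qed

theorem usol_exists:
  assumes "r \<ge> 0" shows "\<exists>T>0. \<forall>c0. norm c0 \<le> r \<longrightarrow> (\<exists>c. usol T c0 c)"
  using gsol_exists[OF assms] gsol_imp_usol by (meson less_imp_le)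

end

section \<open>Fourier series in \<open>L\<^sup>2\<close> of the torus\<close>

definition cexp :: "int \<Rightarrow> real \<Rightarrow> complex" where "cexp k x = exp (\<i> * of_int k * of_real x)"

lemma cexp_eq_cis: "cexp k x = cis (real_of_int k * x)"
  by (simp add: cexp_def cis_conv_exp mult_ac)

lemma norm_cexp [simp]: "cmod (cexp k x) = 1"
  by (simp add: cexp_eq_cis)

lemma cnj_cexp: "cnj (cexp k x) = cexp (- k) x"
  by (simp add: cexp_eq_cis cis_cnj)

lemma cexp_mult: "cexp k x * cexp l x = cexp (k + l) x"
  by (simp add: cexp_eq_cis cis_mult distrib_right)

lemma cexp_0 [simp]: "cexp 0 x = 1"
  by (simp add: cexp_def)

lemma cexp_add_2pi [simp]: "cexp k (x + 2 * pi) = cexp k x"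
proof -
  have "cexp k (x + 2 * pi) = cis (real_of_int k * x) * cis (real_of_int k * (2 * pi))"
    by (simp add: cexp_eq_cis cis_mult distrib_left)
  also have "cis (real_of_int k * (2 * pi)) = 1"
    using cis_multiple_2pi[of "real_of_int k"] by (simp add: mult_ac)
  finally show ?thesis by (simp add: cexp_eq_cis)
qed

lemma continuous_on_cexp [continuous_intros]: "continuous_on S (cexp k)"
  unfolding cexp_def by (intro continuous_intros)

lemma torus_fun_cexp: "torus_fun (cexp k)"
  by standard simp

lemma space_torus [simp]: "space torus = {- pi..pi}"
  by (simp add: torus_def)

lemma integrable_torus_continuous:
  fixes f :: "real \<Rightarrow> 'b::euclidean_space"
  shows "continuous_on {- pi..pi} f \<Longrightarrow> integrable torus f"
  unfolding torus_def by (rule continuous_imp_integrable_real)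

lemma integrable_torus_const [simp]: "integrable torus (\<lambda>x. c :: 'b::euclidean_space)"
  by (rule integrable_torus_continuous) simp

lemma measurable_torus_lebesgue: "f \<in> borel_measurable lebesgue \<Longrightarrow> f \<in> borel_measurable torus"
  unfolding torus_def by (rule measurable_restrict_space1)

lemma measurable_torus_continuous:
  fixes f :: "real \<Rightarrow> 'b::euclidean_space"
  shows "continuous_on UNIV f \<Longrightarrow> f \<in> borel_measurable torus"
  by (meson borel_measurable_integrable continuous_on_subset integrable_torus_continuous subset_UNIV)

lemma measurable_cexp [measurable]: "cexp k \<in> borel_measurable torus"
  by (intro measurable_torus_continuous continuous_intros)

lemma torus_integral_eq:
  fixes f :: "real \<Rightarrow> 'b::euclidean_space"
  assumes "(f has_integral I) {- pi..pi}" "continuous_on {- pi..pi} f"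
  shows "integral\<^sup>L torus f = I"
proof -
  have "(f has_integral (integral\<^sup>L torus f)) {- pi..pi}"
    unfolding torus_def
    by (rule has_integral_integral_lebesgue_on) (use integrable_torus_continuous[OF assms(2)] in \<open>auto simp: torus_def\<close>)
  then show ?thesis using assms(1) by (rule has_integral_unique)
qed

lemma torus_integral_const: "integral\<^sup>L torus (\<lambda>x. c :: 'b::euclidean_space) = (2 * pi) *\<^sub>R c"
  by (rule torus_integral_eq) (use has_integral_const_real[of c "- pi" pi] in auto)

lemma measure_torus [simp]: "measure torus {- pi..pi} = 2 * pi"
  using torus_integral_const[of "1::real"] by simp

lemma cexp_has_vector_derivative: "(cexp k has_vector_derivative (\<i> * of_int k * cexp k x)) (at x within S)"
proof -
  have "((\<lambda>t. exp (t *\<^sub>R (\<i> * of_int k))) has_vector_derivative (exp (x *\<^sub>R (\<i> * of_int k)) * (\<i> * of_int k))) (at x within S)"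
    by (rule exp_scaleR_has_vector_derivative_right)
  moreover have "(\<lambda>t. exp (t *\<^sub>R (\<i> * of_int k))) = cexp k"
    by (rule ext) (simp add: cexp_def scaleR_conv_of_real mult_ac)
  ultimately show ?thesis by (metis mult.commute)
qed

lemma torus_integral_deriv:
  assumes f: "\<And>x. (f has_vector_derivative f' x) (at x)" and c: "continuous_on UNIV f'" and p: "torus_fun f"
  shows "integral\<^sup>L torus f' = 0"
proof (rule torus_integral_eq)
  have "(f' has_integral (f pi - f (- pi))) {- pi..pi}"
    by (rule fundamental_theorem_of_calculus) (auto intro: has_vector_derivative_at_within f)
  moreover have "f pi = f (- pi)"
    using periodic_fun_simple.plus_period[OF p, of "- pi"] by simp
  ultimately show "(f' has_integral 0) {- pi..pi}" by simp
qed (use c continuous_on_subset in blast)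

lemma torus_integral_cexp: "integral\<^sup>L torus (cexp k) = (if k = 0 then 2 * pi else 0)"
proof (cases "k = 0")
  case True
  then have "cexp k = (\<lambda>x. 1)" by (intro ext) simp
  then show ?thesis using True by (simp add: scaleR_conv_of_real)
next
  case False
  have "integral\<^sup>L torus (\<lambda>x. \<i> * of_int k * cexp k x) = 0"
    by (rule torus_integral_deriv[OF cexp_has_vector_derivative _ torus_fun_cexp]) (intro continuous_intros)
  then show ?thesis using False by simp
qed

lemma fourier_coeff_eq: "fourier_coeff f m = integral\<^sup>L torus (\<lambda>x. f x * cexp (- m) x) / (2 * pi)"
  by (simp add: fourier_coeff_def cexp_def)

lemma integrable_mult_bounded:
  fixes f g :: "real \<Rightarrow> complex"
  assumes f: "integrable torus f" and g: "g \<in> borel_measurable torus" and b: "\<And>x. cmod (g x) \<le> B"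
  shows "integrable torus (\<lambda>x. f x * g x)"
proof (rule Bochner_Integration.integrable_bound)
  show "integrable torus (\<lambda>x. B * cmod (f x))" using f by simp
  show "(\<lambda>x. f x * g x) \<in> borel_measurable torus"
    using f g by (intro borel_measurable_times) auto
  have "cmod (f x * g x) \<le> norm (B * cmod (f x))" for x
  proof -
    have "cmod (f x * g x) \<le> B * cmod (f x)"
      using mult_right_mono[OF b[of x], of "cmod (f x)"] by (simp add: norm_mult mult.commute)
    also have "\<dots> \<le> norm (B * cmod (f x))" by simp
    finally show ?thesis .
  qed
  then show "AE x in torus. cmod (f x * g x) \<le> norm (B * cmod (f x))" by simp
qed

lemma integrable_mult_cexp: "integrable torus f \<Longrightarrow> integrable torus (\<lambda>x. f x * cexp k x)"
  by (rule integrable_mult_bounded[where B=1]) auto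

subsection \<open>Completeness of the exponentials\<close>

text \<open>Completeness is needed for integrable functions. The class of functions to which
  \<open>h\<close> is orthogonal is enlarged step by step: exponentials, polynomials in
  \<open>cis x\<close>, continuous functions, indicators of closed sets.\<close>

definition annihilates_exps :: "(real \<Rightarrow> complex) \<Rightarrow> bool" where
  "annihilates_exps h \<longleftrightarrow> integrable torus h \<and> (\<forall>m. integral\<^sup>L torus (\<lambda>x. h x * cexp m x) = 0)"

lemma annihilates_exps_mult_cexp: "annihilates_exps h \<Longrightarrow> annihilates_exps (\<lambda>x. h x * cexp k x)"
  unfolding annihilates_exps_def by (simp add: integrable_mult_cexp mult.assoc cexp_mult)

lemma annihilates_exps_lincomb:
  assumes "annihilates_exps f" "annihilates_exps g"
  shows "annihilates_exps (\<lambda>x. a * f x + b * g x)"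
proof -
  have i: "integrable torus (\<lambda>x. f x * cexp m x)" "integrable torus (\<lambda>x. g x * cexp m x)" for m
    using assms by (auto simp: annihilates_exps_def intro: integrable_mult_cexp)
  have "integral\<^sup>L torus (\<lambda>x. (a * f x + b * g x) * cexp m x) = 0" for m
  proof -
    have "integral\<^sup>L torus (\<lambda>x. (a * f x + b * g x) * cexp m x)
       = integral\<^sup>L torus (\<lambda>x. a * (f x * cexp m x) + b * (g x * cexp m x))"
      by (simp add: algebra_simps)
    also have "\<dots> = 0" using i assms by (simp add: annihilates_exps_def)
    finally show ?thesis .
  qed
  then show ?thesis using assms by (simp add: annihilates_exps_def)
qed

text \<open>Multiplication by an exponential only shifts the index. A real linear functional of
  \<open>cis x\<close> is a combination of cos and sin, thus of \<open>cexp 1\<close> and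
  \<open>cexp (- 1)\<close>; products follow by applying the induction hypotheses in turn, hence
  \<open>h\<close> is kept arbitrary.\<close>

lemma annihilates_exps_polynomial:
  assumes "real_polynomial_function q" "annihilates_exps h"
  shows "annihilates_exps (\<lambda>x. h x * of_real (q (cis x)))"
  using assms
proof (induction q arbitrary: h rule: real_polynomial_function.induct)
  case (linear f)
  interpret bounded_linear f by fact
  have e: "cis x = exp (\<i> * of_real x)" "cis (- x) = exp (- (\<i> * of_real x))" for x by (simp_all add: cis_conv_exp)
  have c: "cexp 1 x = cis x" "cexp (- 1) x = cis (- x)" for x by (simp_all add: cexp_eq_cis)
  have "h x * of_real (f (cis x)) = ((of_real (f 1) - \<i> * of_real (f \<i>)) / 2) * (h x * cexp 1 x)
      + ((of_real (f 1) + \<i> * of_real (f \<i>)) / 2) * (h x * cexp (- 1) x)" for x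
  proof -
    have "cis x = cos x *\<^sub>R 1 + sin x *\<^sub>R \<i>" by (simp add: complex_eq_iff)
    then have "f (cis x) = cos x * f 1 + sin x * f \<i>" by (simp only: add scaleR) simp
    then show ?thesis unfolding c by (simp add: complex_eq_iff field_simps)
  qed
  then show ?case
    by (simp only:) (intro annihilates_exps_lincomb annihilates_exps_mult_cexp \<open>annihilates_exps h\<close>)
next
  case (const c)
  have "h x * of_real c = of_real c * h x + 0 * h x" for x by simp
  then show ?case by (simp only:) (intro annihilates_exps_lincomb const)
next
  case (add f g)
  have "h x * of_real (f (cis x) + g (cis x)) = 1 * (h x * of_real (f (cis x))) + 1 * (h x * of_real (g (cis x)))" for x
    by (simp add: algebra_simps)
  then show ?case by (simp only:) (intro annihilates_exps_lincomb add)
next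
  case (mult f g)
  then show ?case by (simp add: mult.assoc[symmetric])
qed

lemma le_mult_eps_imp_nonpos:
  assumes "\<And>e::real. 0 < e \<Longrightarrow> x \<le> e * c" "0 \<le> c" shows "x \<le> 0"
proof (rule field_le_epsilon)
  fix e :: real assume e: "0 < e"
  have "x \<le> e / (c + 1) * c" using e assms by (intro assms(1)) (simp add: add_nonneg_pos)
  also have "\<dots> \<le> e" using e assms(2) by (simp add: field_simps)
  finally show "x \<le> 0 + e" by simp
qed

text \<open>Stone-Weierstrass on the unit circle instead of the interval, so that periodicity is
  built in.\<close>

lemma annihilates_exps_continuous:
  assumes h: "annihilates_exps h" and \<phi>: "continuous_on (sphere 0 1) (\<phi> :: complex \<Rightarrow> real)"
  shows "integral\<^sup>L torus (\<lambda>x. h x * of_real (\<phi> (cis x))) = 0"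
proof -
  have ih: "integrable torus h" using h by (simp add: annihilates_exps_def)
  define I where "I = integral\<^sup>L torus (\<lambda>x. cmod (h x))"
  have I0: "0 \<le> I" unfolding I_def by simp
  have sph: "cis x \<in> sphere 0 1" for x by simp
  have "continuous_on UNIV (\<lambda>x. \<phi> (cis x))"
    by (rule continuous_on_compose2[OF \<phi>]) (use sph in \<open>auto intro!: continuous_intros simp: cis_conv_exp\<close>)
  then have c\<phi>: "continuous_on UNIV (\<lambda>x. complex_of_real (\<phi> (cis x)))" by (intro continuous_intros)
  obtain B where B: "\<And>z. z \<in> sphere 0 1 \<Longrightarrow> \<bar>\<phi> z\<bar> \<le> B"
    using compact_imp_bounded[OF compact_continuous_image[OF \<phi> compact_sphere]] unfolding bounded_iff
    by (metis imageI real_norm_def)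
  have i1: "integrable torus (\<lambda>x. h x * of_real (\<phi> (cis x)))"
    by (rule integrable_mult_bounded[OF ih measurable_torus_continuous[OF c\<phi>], of B])
      (use B[OF sph] in auto)
  have "cmod (integral\<^sup>L torus (\<lambda>x. h x * of_real (\<phi> (cis x)))) \<le> e * I" if e: "e > 0" for e
  proof -
    obtain q where q: "real_polynomial_function q" "\<And>z. z \<in> sphere 0 1 \<Longrightarrow> \<bar>\<phi> z - q z\<bar> < e"
      using Stone_Weierstrass_real_polynomial_function[OF compact_sphere \<phi> e] by blast
    have Z: "annihilates_exps (\<lambda>x. h x * of_real (q (cis x)))" by (rule annihilates_exps_polynomial[OF q(1) h])
    then have i2: "integrable torus (\<lambda>x. h x * of_real (q (cis x)))" 
      and z: "integral\<^sup>L torus (\<lambda>x. h x * of_real (q (cis x))) = 0"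
      unfolding annihilates_exps_def by (auto dest: spec[of _ 0])
    have "integral\<^sup>L torus (\<lambda>x. h x * of_real (\<phi> (cis x))) =
       integral\<^sup>L torus (\<lambda>x. h x * of_real (\<phi> (cis x)) - h x * of_real (q (cis x)))"
      using i1 i2 z by simp
    also have "cmod \<dots> \<le> integral\<^sup>L torus (\<lambda>x. cmod (h x * of_real (\<phi> (cis x)) - h x * of_real (q (cis x))))"
      by (rule integral_norm_bound)
    also have "\<dots> \<le> integral\<^sup>L torus (\<lambda>x. e * cmod (h x))"
    proof (rule integral_mono)
      fix x
      have "cmod (h x * of_real (\<phi> (cis x)) - h x * of_real (q (cis x))) = cmod (h x) * \<bar>\<phi> (cis x) - q (cis x)\<bar>"
        by (simp add: norm_mult flip: right_diff_distrib of_real_diff)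
      also have "\<dots> \<le> cmod (h x) * e" using q(2)[OF sph[of x]] by (intro mult_left_mono) auto
      finally show "cmod (h x * of_real (\<phi> (cis x)) - h x * of_real (q (cis x))) \<le> e * cmod (h x)"
        by (simp add: mult_ac)
    qed (use i1 i2 ih in auto)
    also have "\<dots> = e * I" by (simp add: I_def)
    finally show ?thesis .
  qed
  then have "cmod (integral\<^sup>L torus (\<lambda>x. h x * of_real (\<phi> (cis x)))) \<le> 0"
    using I0 by (rule le_mult_eps_imp_nonpos)
  then show ?thesis by simp
qed

text \<open>The indicator of the compact image of \<open>K\<close> on the circle is the pointwise
  limit of tent functions of the distance. Since \<open>K\<close> avoids the endpoints, the circle
  distinguishes its points from the others up to one null point.\<close>

lemma annihilates_exps_closed_set:
  assumes h: "annihilates_exps h" and K: "closed K" "K \<subseteq> {- pi<..<pi}"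
  shows "integral\<^sup>L torus (\<lambda>x. h x * indicator K x) = 0"
proof -
  have ih: "integrable torus h" using h by (simp add: annihilates_exps_def)
  define C where "C = cis ` K"
  have "K \<subseteq> {- pi..pi}" using K by auto
  then have "compact K" using K(1) compact_Icc closed_Int_compact by (metis inf.absorb1)
  then have "compact C" unfolding C_def by (intro compact_continuous_image) (auto intro!: continuous_intros)
  then have C: "closed C" by (rule compact_imp_closed)
  show ?thesis
  proof (cases "K = {}")
    case False
    then have ne: "C \<noteq> {}" by (simp add: C_def)
    define \<phi> where "\<phi> n z = max 0 (1 - real n * infdist z C)" for n z
    have c: "continuous_on S (\<phi> n)" for S n
      unfolding \<phi>_def by (intro continuous_intros)
    have z: "integral\<^sup>L torus (\<lambda>x. h x * of_real (\<phi> n (cis x))) = 0" for n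
      by (rule annihilates_exps_continuous[OF h c])
    \<comment> \<open>\<open>Arg\<close> inverts \<open>cis\<close> on the half-open interval only;
      the endpoint \<open>- pi\<close> is discarded as a null set below.\<close>
    have mem: "cis x \<in> C \<longleftrightarrow> x \<in> K" if "x \<in> {- pi<..pi}" for x
    proof
      assume "cis x \<in> C"
      then obtain y where y: "y \<in> K" "cis x = cis y" by (auto simp: C_def)
      have "y \<in> {- pi<..pi}" using subsetD[OF K(2) y(1)] by simp
      have "Arg (cis x) = x" "Arg (cis y) = y"
        by (rule Arg_cis, fact)+
      then have "x = y" using y(2) by metis
      then show "x \<in> K" using y(1) by metis
    qed (simp add: C_def)
    have lim: "(\<lambda>n. \<phi> n w) \<longlonglongrightarrow> (if w \<in> C then 1 else 0)" for w
    proof (cases "w \<in> C")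
      case True
      then show ?thesis by (simp add: \<phi>_def)
    next
      case False
      then have d: "infdist w C > 0" using C ne by (simp add: infdist_pos_not_in_closed)
      then obtain N where N: "1 < real N * infdist w C" using reals_Archimedean3 by blast
      have "\<phi> n w = 0" if "n \<ge> N" for n
      proof -
        have "real N * infdist w C \<le> real n * infdist w C"
          using that d by (intro mult_right_mono) auto
        then show ?thesis using N by (simp add: \<phi>_def)
      qed
      then have "\<forall>\<^sub>F n in sequentially. \<phi> n w = 0" by (rule eventually_sequentiallyI)
      then show ?thesis using False by (simp add: tendsto_eventually)
    qed
    have ae: "AE x in torus. x \<noteq> - pi"
    proof -
      have "AE x in lebesgue. x \<noteq> (- pi::real)"
        by (rule AE_I'[of "{- pi}"]) (auto simp: null_sets_def)
      then show ?thesis unfolding torus_def by (subst AE_restrict_space_iff) auto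
    qed
    have b: "\<bar>\<phi> n w\<bar> \<le> 1" for n w using infdist_nonneg[of w C] by (simp add: \<phi>_def)
    have mK: "(\<lambda>x. h x * indicator K x) \<in> borel_measurable torus"
    proof -
      have "indicator K \<in> borel_measurable (lebesgue :: real measure)"
        using K(1) by (intro borel_measurable_indicator) (simp add: borel_closed)
      then have "(indicator K :: real \<Rightarrow> complex) \<in> borel_measurable torus"
        using K(1) by (intro measurable_torus_lebesgue borel_measurable_indicator) (simp add: borel_closed)
      then show ?thesis using ih by (intro borel_measurable_times) auto
    qed
    have "(\<lambda>n. integral\<^sup>L torus (\<lambda>x. h x * of_real (\<phi> n (cis x)))) \<longlonglongrightarrow> integral\<^sup>L torus (\<lambda>x. h x * indicator K x)"
    proof (rule integral_dominated_convergence[where w="\<lambda>x. cmod (h x)"])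
      show "(\<lambda>x. h x * of_real (\<phi> n (cis x))) \<in> borel_measurable torus" for n
      proof -
        have "continuous_on UNIV (\<lambda>x. complex_of_real (\<phi> n (cis x)))"
          by (intro continuous_intros continuous_on_compose2[OF c]) (auto intro!: continuous_intros)
        then show ?thesis
          by (rule borel_measurable_times[OF borel_measurable_integrable[OF ih] measurable_torus_continuous])
      qed
      show "AE x in torus. (\<lambda>n. h x * of_real (\<phi> n (cis x))) \<longlonglongrightarrow> h x * indicator K x"
        using ae AE_space
      proof eventually_elim
        case (elim x)
        then have "x \<in> {- pi<..pi}" by auto
        from mem[OF this] have "(if cis x \<in> C then 1 else 0) = (indicator K x :: real)"
          by (simp add: indicator_def)
        with lim[of "cis x"] have "(\<lambda>n. \<phi> n (cis x)) \<longlonglongrightarrow> indicator K x" by simp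
        then have "(\<lambda>n. h x * of_real (\<phi> n (cis x))) \<longlonglongrightarrow> h x * of_real (indicator K x)"
          by (intro tendsto_intros)
        then show ?case by (simp add: of_real_indicator)
      qed
      show "AE x in torus. cmod (h x * of_real (\<phi> n (cis x))) \<le> cmod (h x)" for n
        using b by (intro AE_I2) (simp add: norm_mult mult_left_le)
    qed (use ih mK in auto)
    then show ?thesis unfolding z using LIMSEQ_const_iff by (metis LIMSEQ_unique tendsto_const)
  qed simp
qed

text \<open>On a closed subset of the positivity set the integral of \<open>Re h\<close> vanishes
  although the integrand is positive, so the subset is null; inner regularity extends this to the
  whole set.\<close>

lemma annihilates_exps_Re_nonpos:
  assumes h: "annihilates_exps h"
  shows "AE x in torus. Re (h x) \<le> 0"
proof -
  have ih: "integrable torus h" using h by (simp add: annihilates_exps_def)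
  define S where "S = {x \<in> {- pi<..<pi}. Re (h x) > 0}"
  have S: "S \<in> sets lebesgue"
  proof -
    have "(\<lambda>x. Re (h x)) \<in> borel_measurable torus" using ih by auto
    then have "{x \<in> space torus. 0 < Re (h x)} \<in> sets torus" by measurable
    then have "{x \<in> {- pi..pi}. 0 < Re (h x)} \<in> sets lebesgue"
      by (simp add: torus_def sets_restrict_space_iff)
    moreover have "S = {x \<in> {- pi..pi}. 0 < Re (h x)} \<inter> {- pi<..<pi}" by (auto simp: S_def)
    moreover have "{- pi<..<pi} \<in> sets lebesgue" by simp
    ultimately show ?thesis by (metis sets.Int)
  qed
  have null: "emeasure lebesgue K = 0" if K: "closed K" "K \<subseteq> S" for K
  proof -
    have Ks: "K \<subseteq> {- pi<..<pi}" using K(2) by (auto simp: S_def)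
    have KL: "K \<in> sets lebesgue" using K(1) by (simp add: borel_closed)
    have mKc: "(indicator K :: real \<Rightarrow> complex) \<in> borel_measurable torus"
      using KL by (intro measurable_torus_lebesgue borel_measurable_indicator)
    have iK: "integrable torus (\<lambda>x. h x * indicator K x)"
      by (rule integrable_mult_bounded[OF ih mKc, of 1]) (simp add: indicator_def)
    have "integral\<^sup>L torus (\<lambda>x. Re (h x * indicator K x)) = Re (integral\<^sup>L torus (\<lambda>x. h x * indicator K x))"
      by (rule integral_Re[OF iK])
    also have "\<dots> = 0" using annihilates_exps_closed_set[OF h K(1) Ks] by simp
    finally have "integral\<^sup>L torus (\<lambda>x. Re (h x * indicator K x)) = 0" .
    moreover have "AE x in torus. 0 \<le> Re (h x * indicator K x)"
      by (rule AE_I2) (use K(2) in \<open>auto simp: indicator_def S_def\<close>)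
    ultimately have "AE x in torus. Re (h x * indicator K x) = 0"
      using integral_nonneg_eq_0_iff_AE[OF integrable_Re[OF iK]] by blast
    then have "AE x in torus. x \<notin> K"
      by eventually_elim (use K(2) in \<open>auto simp: indicator_def S_def\<close>)
    then have "AE x in lebesgue. x \<in> {- pi..pi} \<longrightarrow> x \<notin> K"
      unfolding torus_def by (subst (asm) AE_restrict_space_iff) auto
    then have "AE x in lebesgue. x \<notin> K"
      by eventually_elim (use Ks in force)
    then show ?thesis using KL by (subst (asm) AE_iff_null_sets[symmetric]) auto
  qed
  have "emeasure lebesgue S \<le> 0 + ennreal e" if e: "e > 0" for e
  proof -
    obtain K where K: "closed K" "K \<subseteq> S" "S - K \<in> lmeasurable" "emeasure lebesgue (S - K) < ennreal e"
      using sets_lebesgue_inner_closed[OF S e] by metis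
    have "emeasure lebesgue S \<le> emeasure lebesgue K + emeasure lebesgue (S - K)"
      using K S by (subst plus_emeasure) (auto simp: borel_closed Un_absorb1)
    then show ?thesis using null[OF K(1,2)] K(4) by (simp add: order_trans less_imp_le)
  qed
  then have "emeasure lebesgue S \<le> 0" by (rule ennreal_le_epsilon) simp
  then have "S \<in> null_sets lebesgue" using S by (simp add: null_sets_def)
  moreover have "{pi, - pi} \<in> null_sets lebesgue"
    by (intro null_sets_completionI finite_imp_null_set_lborel) simp
  ultimately have "S \<union> {pi, - pi} \<in> null_sets lebesgue" by (rule null_sets.Un)
  then have "AE x in lebesgue. x \<notin> S \<union> {pi, - pi}" by (rule AE_not_in)
  then have "AE x in lebesgue. x \<in> {- pi..pi} \<longrightarrow> Re (h x) \<le> 0"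
  proof eventually_elim
    case (elim x)
    then show ?case by (auto simp: S_def not_less)
  qed
  then show ?thesis unfolding torus_def by (subst AE_restrict_space_iff) auto
qed

lemma fourier_coeff_eq_0_imp_AE:
  assumes f: "integrable torus f" and z: "\<And>m. fourier_coeff f m = 0"
  shows "AE x in torus. f x = 0"
proof -
  have "integral\<^sup>L torus (\<lambda>x. f x * cexp m x) = 0" for m
    using z[of "- m"] by (simp add: fourier_coeff_eq)
  then have Z: "annihilates_exps f" using f by (simp add: annihilates_exps_def)
  have "annihilates_exps (\<lambda>x. c * f x)" for c
    using annihilates_exps_lincomb[OF Z Z, of c 0] by simp
  \<comment> \<open>The four rotations bound the real and imaginary parts from both sides.\<close>
  note z = this[of 1] this[of "-1"] this[of \<i>] this[of "- \<i>"]
  have "AE x in torus. Re (1 * f x) \<le> 0" "AE x in torus. Re (- 1 * f x) \<le> 0"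
    "AE x in torus. Re (\<i> * f x) \<le> 0" "AE x in torus. Re (- \<i> * f x) \<le> 0"
    by (rule z[THEN annihilates_exps_Re_nonpos])+
  then show ?thesis by eventually_elim (simp add: complex_eq_iff)
qed

subsection \<open>Riesz--Fischer and Parseval\<close>

definition sq_int :: "(real \<Rightarrow> complex) \<Rightarrow> bool" where
  "sq_int f \<longleftrightarrow> f \<in> borel_measurable torus \<and> integrable torus (\<lambda>x. (cmod (f x))\<^sup>2)"

definition sq_norm :: "(real \<Rightarrow> complex) \<Rightarrow> real" where
  "sq_norm f = integral\<^sup>L torus (\<lambda>x. (cmod (f x))\<^sup>2)"

lemma L2_torus_sq_int: "f \<in> L2_torus \<Longrightarrow> sq_int f"
  by (auto simp: L2_torus_def sq_int_def measurable_torus_lebesgue)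

lemma sq_norm_nonneg: "0 \<le> sq_norm f"
  by (simp add: sq_norm_def)

lemma integrable_real_bound:
  fixes f :: "real \<Rightarrow> 'b::{banach, second_countable_topology}" and g :: "real \<Rightarrow> real"
  assumes "integrable torus g" "f \<in> borel_measurable torus" "\<And>x. norm (f x) \<le> g x"
  shows "integrable torus f"
  by (rule Bochner_Integration.integrable_bound[OF assms(1,2)])
    (use assms(3) in \<open>auto intro!: AE_I2 intro: order_trans[OF _ abs_ge_self]\<close>)

lemma sq_int_integrable: assumes "sq_int f" shows "integrable torus f"
proof (rule integrable_real_bound)
  show "integrable torus (\<lambda>x. 1 + (cmod (f x))\<^sup>2)" using assms by (auto simp: sq_int_def)
  fix x
  have "2 * cmod (f x) \<le> 1 + (cmod (f x))\<^sup>2" using sum_squares_bound[of 1 "cmod (f x)"] by simp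
  then show "cmod (f x) \<le> 1 + (cmod (f x))\<^sup>2" using norm_ge_zero[of "f x"] by linarith
qed (use assms in \<open>simp add: sq_int_def\<close>)

text \<open>Takes the place of Cauchy-Schwarz for integrals: the squared norm of an error is sent to
  0 for fixed \<open>d\<close>, and only afterwards \<open>d\<close> itself.\<close>

lemma young_mult: "0 < d \<Longrightarrow> a * b \<le> d * b\<^sup>2 + a\<^sup>2 / d" for a b d :: real
proof -
  assume d: "0 < d"
  have "2 * (d * b) * a \<le> (d * b)\<^sup>2 + a\<^sup>2" by (rule sum_squares_bound)
  moreover have "0 \<le> (d * b)\<^sup>2 + a\<^sup>2" by simp
  ultimately have "(d * b) * a \<le> (d * b)\<^sup>2 + a\<^sup>2" by linarith
  then have "a * b \<le> ((d * b)\<^sup>2 + a\<^sup>2) / d" using d by (simp add: pos_le_divide_eq mult_ac)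
  also have "\<dots> = d * b\<^sup>2 + a\<^sup>2 / d" using d by (simp add: add_divide_distrib power2_eq_square)
  finally show ?thesis .
qed

lemma sq_int_mult:
  assumes f: "sq_int f" and g: "sq_int g"
  shows "integrable torus (\<lambda>x. f x * g x)"
    and "0 < d \<Longrightarrow> cmod (integral\<^sup>L torus (\<lambda>x. f x * g x)) \<le> d * sq_norm g + sq_norm f / d"
proof -
  have i: "integrable torus (\<lambda>x. d * (cmod (g x))\<^sup>2 + (cmod (f x))\<^sup>2 / d)" for d
    using f g by (auto simp: sq_int_def)
  have b: "cmod (f x * g x) \<le> d * (cmod (g x))\<^sup>2 + (cmod (f x))\<^sup>2 / d" if "0 < d" for d x
    unfolding norm_mult by (rule young_mult[OF that])
  show int: "integrable torus (\<lambda>x. f x * g x)"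
    by (rule integrable_real_bound[OF i[of 1] _ b]) (use f g in \<open>auto simp: sq_int_def\<close>)
  assume d: "0 < d"
  have "cmod (integral\<^sup>L torus (\<lambda>x. f x * g x)) \<le> integral\<^sup>L torus (\<lambda>x. d * (cmod (g x))\<^sup>2 + (cmod (f x))\<^sup>2 / d)"
    by (rule Bochner_Integration.integral_norm_bound_integral[OF int i b[OF d]])
  also have "\<dots> = d * sq_norm g + sq_norm f / d"
    using f g by (auto simp: sq_int_def sq_norm_def)
  finally show "cmod (integral\<^sup>L torus (\<lambda>x. f x * g x)) \<le> d * sq_norm g + sq_norm f / d" .
qed

lemma sq_int_bounded:
  assumes "f \<in> borel_measurable torus" "\<And>x. cmod (f x) \<le> B"
  shows "sq_int f"
proof -
  have "integrable torus (\<lambda>x. (cmod (f x))\<^sup>2)"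
    by (rule integrable_real_bound[of "\<lambda>x. B\<^sup>2"]) (use assms in \<open>auto intro!: power_mono\<close>)
  then show ?thesis using assms by (simp add: sq_int_def)
qed

lemma sq_int_one: "sq_int (\<lambda>x. 1)" and sq_norm_one: "sq_norm (\<lambda>x. 1) = 2 * pi"
  by (auto intro: sq_int_bounded[of _ 1] simp: sq_norm_def)

lemma L1_le_sq_norm:
  assumes f: "sq_int f" and d: "0 < d"
  shows "integral\<^sup>L torus (\<lambda>x. cmod (f x)) \<le> d * (2 * pi) + sq_norm f / d"
proof -
  have sf: "sq_int (\<lambda>x. of_real (cmod (f x)))" using f by (auto simp: sq_int_def)
  have "cmod (integral\<^sup>L torus (\<lambda>x. of_real (cmod (f x)) * 1)) \<le> d * (2 * pi) + sq_norm (\<lambda>x. of_real (cmod (f x))) / d"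
    using sq_int_mult(2)[OF sf sq_int_one d] unfolding sq_norm_one .
  then show ?thesis by (simp add: sq_norm_def)
qed

lemma sq_int_diff: 
  assumes "sq_int f" "sq_int g" shows "sq_int (\<lambda>x. f x - g x)"
proof -
  have "integrable torus (\<lambda>x. (cmod (f x - g x))\<^sup>2)"
  proof (rule integrable_real_bound)
    show "integrable torus (\<lambda>x. 2 * (cmod (f x))\<^sup>2 + 2 * (cmod (g x))\<^sup>2)" using assms by (auto simp: sq_int_def)
    fix x
    have "(cmod (f x - g x))\<^sup>2 \<le> (cmod (f x) + cmod (g x))\<^sup>2" by (intro power_mono norm_triangle_ineq4) simp
    also have "\<dots> \<le> 2 * (cmod (f x))\<^sup>2 + 2 * (cmod (g x))\<^sup>2"
      using sum_squares_bound[of "cmod (f x)" "cmod (g x)"] by (simp add: power2_sum)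
    finally show "norm ((cmod (f x - g x))\<^sup>2) \<le> 2 * (cmod (f x))\<^sup>2 + 2 * (cmod (g x))\<^sup>2" by simp
  qed (use assms in \<open>auto simp: sq_int_def\<close>)
  then show ?thesis using assms by (auto simp: sq_int_def)
qed

lemma sq_int_mult_bounded:
  assumes "sq_int f" "g \<in> borel_measurable torus" "AE x in torus. cmod (g x) \<le> B" "0 \<le> B"
  shows "sq_int (\<lambda>x. g x * f x)"
proof -
  have "integrable torus (\<lambda>x. (cmod (g x * f x))\<^sup>2)"
  proof (rule Bochner_Integration.integrable_bound)
    show "integrable torus (\<lambda>x. B\<^sup>2 * (cmod (f x))\<^sup>2)" using assms by (auto simp: sq_int_def)
    show "AE x in torus. norm ((cmod (g x * f x))\<^sup>2) \<le> norm (B\<^sup>2 * (cmod (f x))\<^sup>2)"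
      using assms(3) by eventually_elim (simp add: norm_mult power_mult_distrib mult_right_mono power_mono)
  qed (use assms in \<open>auto simp: sq_int_def\<close>)
  then show ?thesis using assms by (auto simp: sq_int_def)
qed

lemma sq_int_cnj:
  assumes "sq_int f" shows "sq_int (\<lambda>x. cnj (f x))"
proof -
  have "continuous_on UNIV cnj" by (intro continuous_intros)
  then have "(\<lambda>x. cnj (f x)) \<in> borel_measurable torus"
    by (rule borel_measurable_continuous_on) (use assms in \<open>simp add: sq_int_def\<close>)
  then show ?thesis using assms by (simp add: sq_int_def)
qed

lemma sq_int_cexp: "sq_int (cexp k)" by (rule sq_int_bounded[of _ 1]) auto

lemma sq_int_mult_cexp: "sq_int f \<Longrightarrow> sq_int (\<lambda>x. f x * cexp k x)"
  using sq_int_mult_bounded[of f "cexp k" 1] by (simp add: mult.commute)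

lemma fourier_coeff_diff:
  "integrable torus f \<Longrightarrow> integrable torus g \<Longrightarrow>
    fourier_coeff (\<lambda>x. f x - g x) m = fourier_coeff f m - fourier_coeff g m"
  by (simp add: fourier_coeff_eq left_diff_distrib diff_divide_distrib integrable_mult_cexp)

lemma AE_eq_if_fourier_coeff_eq:
  assumes "integrable torus f" "integrable torus g" "\<And>m. fourier_coeff f m = fourier_coeff g m"
  shows "AE x in torus. f x = g x"
  using fourier_coeff_eq_0_imp_AE[of "\<lambda>x. f x - g x"] assms by (simp add: fourier_coeff_diff)

definition trig :: "int set \<Rightarrow> (int \<Rightarrow> complex) \<Rightarrow> real \<Rightarrow> complex" where
  "trig A c x = (\<Sum>k\<in>A. c k * cexp k x)"

lemma continuous_on_trig: "continuous_on S (trig A c)"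
  unfolding trig_def by (intro continuous_intros)

lemma norm_trig_le: "cmod (trig A c x) \<le> (\<Sum>k\<in>A. cmod (c k))"
  unfolding trig_def by (rule order_trans[OF norm_sum]) (simp add: norm_mult)

lemma sq_int_trig: "sq_int (trig A c)"
  by (rule sq_int_bounded[OF measurable_torus_continuous[OF continuous_on_trig] norm_trig_le])

lemma trig_add_2pi: "trig A c (x + 2 * pi) = trig A c x"
  by (simp add: trig_def)

lemma fourier_coeff_trig:
  assumes "finite A" shows "fourier_coeff (trig A c) m = (if m \<in> A then c m else 0)"
proof -
  have "integral\<^sup>L torus (\<lambda>x. trig A c x * cexp (- m) x) = integral\<^sup>L torus (\<lambda>x. \<Sum>k\<in>A. c k * cexp (k - m) x)"
    by (simp add: trig_def sum_distrib_right mult.assoc cexp_mult)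
  also have "\<dots> = (\<Sum>k\<in>A. c k * (if k = m then 2 * pi else 0))"
    by (subst Bochner_Integration.integral_sum)
      (auto simp: torus_integral_cexp sq_int_integrable[OF sq_int_cexp] intro!: sum.cong)
  also have "\<dots> = (if m \<in> A then c m * (2 * pi) else 0)"
    using assms by (simp add: sum.delta if_distrib cong: if_cong)
  finally show ?thesis by (simp add: fourier_coeff_eq)
qed

lemma integral_mult_cnj_trig:
  assumes f: "sq_int f"
  shows "integral\<^sup>L torus (\<lambda>x. f x * cnj (trig A c x)) = 2 * pi * (\<Sum>k\<in>A. fourier_coeff f k * cnj (c k))"
proof -
  have "integral\<^sup>L torus (\<lambda>x. f x * cnj (trig A c x)) = integral\<^sup>L torus (\<lambda>x. \<Sum>k\<in>A. cnj (c k) * (f x * cexp (- k) x))"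
    by (simp add: trig_def cnj_sum cnj_cexp sum_distrib_left mult_ac)
  also have "\<dots> = (\<Sum>k\<in>A. cnj (c k) * integral\<^sup>L torus (\<lambda>x. f x * cexp (- k) x))"
    by (subst Bochner_Integration.integral_sum) (auto intro!: integrable_mult_right integrable_mult_cexp sq_int_integrable[OF f])
  finally show ?thesis by (simp add: fourier_coeff_eq sum_distrib_left mult_ac)
qed

lemma sq_norm_trig:
  assumes A: "finite A" shows "sq_norm (trig A c) = 2 * pi * (\<Sum>k\<in>A. (cmod (c k))\<^sup>2)"
proof -
  have "complex_of_real (sq_norm (trig A c)) = integral\<^sup>L torus (\<lambda>x. trig A c x * cnj (trig A c x))"
    unfolding sq_norm_def integral_complex_of_real[symmetric] by (simp only: complex_norm_square)
  also have "\<dots> = complex_of_real (2 * pi * (\<Sum>k\<in>A. (cmod (c k))\<^sup>2))"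
    unfolding integral_mult_cnj_trig[OF sq_int_trig] using A
    by (simp add: fourier_coeff_trig complex_norm_square del: of_real_power)
  finally show ?thesis by (simp only: of_real_eq_iff)
qed

lemma sq_norm_minus_trig:
  assumes f: "sq_int f" and A: "finite A"
  shows "sq_norm (\<lambda>x. f x - trig A (fourier_coeff f) x) = sq_norm f - 2 * pi * (\<Sum>k\<in>A. (cmod (fourier_coeff f k))\<^sup>2)"
proof -
  let ?t = "trig A (fourier_coeff f)" and ?S = "\<Sum>k\<in>A. (cmod (fourier_coeff f k))\<^sup>2"
  have i: "integrable torus (\<lambda>x. f x * cnj (?t x))"
    by (rule sq_int_mult(1)[OF f sq_int_cnj[OF sq_int_trig]])
  have "integral\<^sup>L torus (\<lambda>x. f x * cnj (?t x)) = complex_of_real (2 * pi * ?S)"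
    unfolding integral_mult_cnj_trig[OF f] by (simp add: complex_norm_square del: of_real_power)
  then have re: "integral\<^sup>L torus (\<lambda>x. Re (f x * cnj (?t x))) = 2 * pi * ?S"
    using integral_Re[OF i] by simp
  have pw: "(cmod (f x - ?t x))\<^sup>2 = (cmod (f x))\<^sup>2 + (cmod (?t x))\<^sup>2 - 2 * Re (f x * cnj (?t x))" for x
    unfolding cmod_power2 by (simp add: power2_eq_square algebra_simps)
  have combine: "integral\<^sup>L torus (\<lambda>x. a x + b x - 2 * c x) = integral\<^sup>L torus a + integral\<^sup>L torus b - 2 * integral\<^sup>L torus c"
    if "integrable torus a" "integrable torus b" "integrable torus c" for a b c :: "real \<Rightarrow> real"
    using that by simp
  have "sq_norm (\<lambda>x. f x - ?t x) = integral\<^sup>L torus (\<lambda>x. (cmod (f x))\<^sup>2 + (cmod (?t x))\<^sup>2 - 2 * Re (f x * cnj (?t x)))"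
    unfolding sq_norm_def pw ..
  also have "\<dots> = sq_norm f + sq_norm ?t - 2 * integral\<^sup>L torus (\<lambda>x. Re (f x * cnj (?t x)))"
  proof -
    have i1: "integrable torus (\<lambda>x. (cmod (f x))\<^sup>2)" using f unfolding sq_int_def by (rule conjunct2)
    have i2: "integrable torus (\<lambda>x. (cmod (?t x))\<^sup>2)"
      using sq_int_trig[of A "fourier_coeff f"] unfolding sq_int_def by (rule conjunct2)
    have i3: "integrable torus (\<lambda>x. Re (f x * cnj (?t x)))" by (rule integrable_Re[OF i])
    show ?thesis unfolding sq_norm_def by (fact combine[OF i1 i2 i3])
  qed
  finally show ?thesis unfolding re sq_norm_trig[OF A] by simp
qed

lemma bessel: "sq_int f \<Longrightarrow> finite A \<Longrightarrow> 2 * pi * (\<Sum>k\<in>A. (cmod (fourier_coeff f k))\<^sup>2) \<le> sq_norm f"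
  using sq_norm_nonneg[of "\<lambda>x. f x - trig A (fourier_coeff f) x"] sq_norm_minus_trig[of f A] by simp

definition fc :: "(real \<Rightarrow> complex) \<Rightarrow> int ell2" where "fc f = Abs_ell2 (fourier_coeff f)"

lemma coord_fc: assumes f: "sq_int f" shows "coord (fc f) = fourier_coeff f"
proof -
  have "l2_bounded (fourier_coeff f)"
  proof (rule l2_boundedI)
    fix A :: "int set" assume A: "finite A"
    have "(\<Sum>k\<in>A. (cmod (fourier_coeff f k))\<^sup>2) \<le> sq_norm f / (2 * pi)"
      using bessel[OF f A] by (simp add: field_simps)
    then show "L2_set (\<lambda>k. cmod (fourier_coeff f k)) A \<le> sqrt (sq_norm f / (2 * pi))"
      unfolding L2_set_def by (rule real_sqrt_le_mono)
  qed
  then show ?thesis by (simp add: fc_def coord_Abs_ell2)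
qed

abbreviation psum :: "(int \<Rightarrow> complex) \<Rightarrow> nat \<Rightarrow> real \<Rightarrow> complex" where
  "psum c n \<equiv> trig {- int n..int n} c"

lemma tail_tendsto_0:
  fixes c :: "int ell2"
  shows "(\<lambda>n. (norm (c - proj {- int n..int n} c))\<^sup>2) \<longlonglongrightarrow> 0"
proof -
  have "(\<lambda>n. (norm c)\<^sup>2 - (\<Sum>k\<in>{- int n..int n}. (cmod (coord c k))\<^sup>2)) \<longlonglongrightarrow> (norm c)\<^sup>2 - (norm c)\<^sup>2"
    by (intro tendsto_intros has_sum_int_symmetric has_sum_coord_power2)
  then show ?thesis by (simp add: norm_minus_proj_power2)
qed

text \<open>The partial sums are Cauchy in L1, which supplies an a.e. convergent subsequence; Fatou
  transfers the tail bounds to its limit. The explicit rate is part of the conclusion because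
  Parseval is derived from it.\<close>

lemma riesz_fischer:
  fixes c :: "int ell2"
  shows "\<exists>h\<in>L2_torus. (\<forall>m. fourier_coeff h m = coord c m) \<and>
    (\<forall>n. sq_norm (\<lambda>x. h x - psum (coord c) n x) \<le> 2 * pi * (norm (c - proj {- int n..int n} c))\<^sup>2)"
proof -
  let ?S = "psum (coord c)"
  define \<tau> where "\<tau> n = (norm (c - proj {- int n..int n} c))\<^sup>2" for n
  have \<tau>0: "\<tau> \<longlonglongrightarrow> 0" unfolding \<tau>_def by (rule tail_tendsto_0)
  have \<tau>nn: "\<tau> n \<ge> 0" for n by (simp add: \<tau>_def)
  have sS: "sq_int (?S n)" for n by (rule sq_int_trig)
  have tail: "sq_norm (\<lambda>x. ?S n x - ?S m x) \<le> 2 * pi * \<tau> m" if "m \<le> n" for m n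
  proof -
    let ?D = "{- int n..int n} - {- int m..int m}"
    have "(\<lambda>x. ?S n x - ?S m x) = trig ?D (coord c)"
      unfolding trig_def using that by (intro ext) (subst sum_diff, auto)
    then have "sq_norm (\<lambda>x. ?S n x - ?S m x) = 2 * pi * (\<Sum>k\<in>?D. (cmod (coord c k))\<^sup>2)"
      by (simp add: sq_norm_trig)
    also have "(\<Sum>k\<in>?D. (cmod (coord c k))\<^sup>2) = (\<Sum>k\<in>?D. (cmod (coord (c - proj {- int m..int m} c) k))\<^sup>2)"
      by (intro sum.cong) auto
    also have "\<dots> = (L2_set (\<lambda>k. cmod (coord (c - proj {- int m..int m} c) k)) ?D)\<^sup>2"
      by (simp add: L2_set_def sum_nonneg del: coord_simps)
    also have "\<dots> \<le> \<tau> m" unfolding \<tau>_def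
      by (intro power_mono L2_set_coord_le_norm) auto
    finally show ?thesis by simp
  qed
  have cauchy: "\<exists>N. \<forall>i\<ge>N. \<forall>j\<ge>N. integral\<^sup>L torus (\<lambda>x. norm (?S i x - ?S j x)) < e" if e: "e > 0" for e
  proof -
    define d where "d = e / (8 * pi)"
    have d: "d > 0" using e by (simp add: d_def)
    have "\<forall>\<^sub>F n in sequentially. \<tau> n < e * d / (8 * pi)"
      using \<tau>0 e d by (intro order_tendstoD(2)) auto
    then obtain N where N: "\<And>n. n \<ge> N \<Longrightarrow> \<tau> n < e * d / (8 * pi)" by (auto simp: eventually_sequentially)
    have le: "integral\<^sup>L torus (\<lambda>x. norm (?S i x - ?S j x)) < e" if "N \<le> j" "j \<le> i" for i j
    proof -
      have "integral\<^sup>L torus (\<lambda>x. norm (?S i x - ?S j x)) \<le> d * (2 * pi) + sq_norm (\<lambda>x. ?S i x - ?S j x) / d"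
        by (intro L1_le_sq_norm sq_int_diff sS d)
      also have "\<dots> \<le> d * (2 * pi) + 2 * pi * (e * d / (8 * pi)) / d"
      proof (intro add_left_mono divide_right_mono)
        show "sq_norm (\<lambda>x. ?S i x - ?S j x) \<le> 2 * pi * (e * d / (8 * pi))"
          by (rule order_trans[OF tail[OF that(2)] mult_left_mono]) (use N[OF that(1)] in auto)
      qed (use d in simp)
      also have "\<dots> = e / 2" using d by (simp add: d_def)
      finally show ?thesis using e by simp
    qed
    show ?thesis
    proof (intro exI[of _ N] allI impI)
      fix i j assume ij: "N \<le> i" "N \<le> j"
      show "integral\<^sup>L torus (\<lambda>x. norm (?S i x - ?S j x)) < e"
        using le[of i j] le[of j i] ij by (cases "j \<le> i") (auto simp: norm_minus_commute)
    qed
  qed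
  obtain r where r: "strict_mono r" "AE x in torus. Cauchy (\<lambda>i. ?S (r i) x)"
    using cauchy_L1_AE_cauchy_subseq[of torus ?S] sq_int_integrable[OF sS] cauchy by blast
  \<comment> \<open>Taken at every point: the partial sums are exactly periodic, so
    \<open>lim\<close> is periodic too, even where there is no limit and its value is
    unspecified.\<close>
  define h where "h x = lim (\<lambda>i. ?S (r i) x)" for x
  have mh: "h \<in> borel_measurable lebesgue"
    unfolding h_def
    by (intro borel_measurable_lim_metric) (simp add: borel_measurable_continuous_onI continuous_on_trig measurable_completion)
  have mht: "h \<in> borel_measurable torus" by (rule measurable_torus_lebesgue[OF mh])
  have conv: "AE x in torus. (\<lambda>i. ?S (r i) x) \<longlonglongrightarrow> h x"
    using r(2) unfolding h_def by eventually_elim (simp add: Cauchy_convergent_iff convergent_LIMSEQ_iff)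
  have fatou: "(\<integral>\<^sup>+ x. ennreal ((cmod (h x - ?S m x))\<^sup>2) \<partial>torus) \<le> ennreal (2 * pi * \<tau> m)" for m
  proof -
    have [measurable]: "?S n \<in> borel_measurable torus" for n using sS by (simp add: sq_int_def)
    have "AE x in torus. liminf (\<lambda>i. ennreal ((cmod (?S (r i) x - ?S m x))\<^sup>2)) = ennreal ((cmod (h x - ?S m x))\<^sup>2)"
      using conv
    proof eventually_elim
      case (elim x)
      then have "(\<lambda>i. ennreal ((cmod (?S (r i) x - ?S m x))\<^sup>2)) \<longlonglongrightarrow> ennreal ((cmod (h x - ?S m x))\<^sup>2)"
        by (intro tendsto_intros)
      then show ?case by (intro lim_imp_Liminf) auto
    qed
    then have "(\<integral>\<^sup>+ x. ennreal ((cmod (h x - ?S m x))\<^sup>2) \<partial>torus) = (\<integral>\<^sup>+ x. liminf (\<lambda>i. ennreal ((cmod (?S (r i) x - ?S m x))\<^sup>2)) \<partial>torus)"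
      by (intro nn_integral_cong_AE) (auto elim: eventually_mono)
    also have "\<dots> \<le> liminf (\<lambda>i. \<integral>\<^sup>+ x. ennreal ((cmod (?S (r i) x - ?S m x))\<^sup>2) \<partial>torus)"
      by (intro nn_integral_liminf) measurable
    also have "\<dots> \<le> limsup (\<lambda>i. \<integral>\<^sup>+ x. ennreal ((cmod (?S (r i) x - ?S m x))\<^sup>2) \<partial>torus)"
      by (intro Liminf_le_Limsup) auto
    also have "\<dots> \<le> ennreal (2 * pi * \<tau> m)"
    proof (intro Limsup_bounded eventually_sequentiallyI[of m])
      fix i assume "m \<le> i"
      then have mi: "m \<le> r i" using seq_suble[OF r(1), of i] by linarith
      have "(\<integral>\<^sup>+ x. ennreal ((cmod (?S (r i) x - ?S m x))\<^sup>2) \<partial>torus) = ennreal (sq_norm (\<lambda>x. ?S (r i) x - ?S m x))"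
        unfolding sq_norm_def using sq_int_diff[OF sS sS, of "r i" m]
        by (intro nn_integral_eq_integral) (auto simp: sq_int_def)
      then show "(\<integral>\<^sup>+ x. ennreal ((cmod (?S (r i) x - ?S m x))\<^sup>2) \<partial>torus) \<le> ennreal (2 * pi * \<tau> m)"
        using tail[OF mi] by (simp add: ennreal_leI)
    qed
    finally show ?thesis .
  qed
  have id: "integrable torus (\<lambda>x. (cmod (h x - ?S m x))\<^sup>2)" for m
  proof (rule integrableI_bounded)
    show "(\<lambda>x. (cmod (h x - ?S m x))\<^sup>2) \<in> borel_measurable torus"
      using mht sS[of m] by (auto simp: sq_int_def)
    show "(\<integral>\<^sup>+ x. ennreal (norm ((cmod (h x - ?S m x))\<^sup>2)) \<partial>torus) < \<infinity>"
      using fatou[of m] by (auto simp: le_less_trans)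
  qed
  have sd: "sq_int (\<lambda>x. h x - ?S m x)" for m
    using id mht sS[of m] by (auto simp: sq_int_def)
  have bd: "sq_norm (\<lambda>x. h x - ?S m x) \<le> 2 * pi * \<tau> m" for m
  proof -
    have "ennreal (sq_norm (\<lambda>x. h x - ?S m x)) = (\<integral>\<^sup>+ x. ennreal ((cmod (h x - ?S m x))\<^sup>2) \<partial>torus)"
      unfolding sq_norm_def using id[of m] by (intro nn_integral_eq_integral[symmetric]) auto
    then have "ennreal (sq_norm (\<lambda>x. h x - ?S m x)) \<le> ennreal (2 * pi * \<tau> m)"
      using fatou[of m] by (simp only:)
    then show ?thesis using \<tau>nn[of m] by (subst (asm) ennreal_le_iff) auto
  qed
  have sh: "sq_int h"
    using sq_int_diff[OF sd[of 0] sq_int_trig[of "{- int 0..int 0}" "\<lambda>k. - coord c k"]]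
    by (simp add: trig_def sum_negf)
  have L2: "h \<in> L2_torus"
  proof -
    have "torus_fun h" by standard (simp add: h_def trig_add_2pi)
    then show ?thesis using mh sh by (simp add: L2_torus_def sq_int_def)
  qed
  have "fourier_coeff h k = coord c k" for k
  proof -
    have le: "cmod (fourier_coeff h k - coord c k) \<le> d + \<tau> m / d" if "d > 0" "m \<ge> nat \<bar>k\<bar>" for d m
    proof -
      have "k \<in> {- int m..int m}" using that(2) by auto
      then have "fourier_coeff h k - coord c k = fourier_coeff (\<lambda>x. h x - ?S m x) k"
        by (simp add: fourier_coeff_diff sq_int_integrable sh sS fourier_coeff_trig)
      also have "cmod \<dots> = cmod (integral\<^sup>L torus (\<lambda>x. (h x - ?S m x) * cexp (- k) x)) / (2 * pi)"
        by (simp add: fourier_coeff_eq norm_divide)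
      also have "\<dots> \<le> (integral\<^sup>L torus (\<lambda>x. cmod ((h x - ?S m x) * cexp (- k) x))) / (2 * pi)"
        by (intro divide_right_mono integral_norm_bound) simp
      also have "\<dots> \<le> (d * (2 * pi) + sq_norm (\<lambda>x. h x - ?S m x) / d) / (2 * pi)"
        using L1_le_sq_norm[OF sd that(1)] by (intro divide_right_mono) (auto simp: norm_mult)
      also have "\<dots> \<le> (d * (2 * pi) + (2 * pi * \<tau> m) / d) / (2 * pi)"
        using bd that by (intro divide_right_mono add_left_mono) auto
      also have "\<dots> = d + \<tau> m / d" by (simp add: field_simps)
      finally show ?thesis .
    qed
    have "cmod (fourier_coeff h k - coord c k) \<le> d" if d: "d > 0" for d
    proof (rule tendsto_lowerbound)
      show "(\<lambda>m. d + \<tau> m / d) \<longlonglongrightarrow> d"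
        using tendsto_add[OF tendsto_const tendsto_divide[OF \<tau>0 tendsto_const], of d d] d by simp
      show "\<forall>\<^sub>F m in sequentially. cmod (fourier_coeff h k - coord c k) \<le> d + \<tau> m / d"
        using le[OF d] by (intro eventually_sequentiallyI)
    qed simp
    then have "cmod (fourier_coeff h k - coord c k) \<le> 0" by (rule field_le_epsilon) simp
    then show ?thesis by simp
  qed
  then show ?thesis using L2 bd unfolding \<tau>_def by blast
qed

text \<open>By completeness \<open>f\<close> agrees a.e. with the function built by
  \<open>riesz_fischer\<close> from its coefficients and inherits the rate of convergence.\<close>

lemma sq_norm_minus_psum:
  assumes f: "sq_int f"
  shows "sq_norm (\<lambda>x. f x - psum (fourier_coeff f) n x) \<le> 2 * pi * (norm (fc f - proj {- int n..int n} (fc f)))\<^sup>2"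
proof -
  obtain h where h: "h \<in> L2_torus" "\<And>m. fourier_coeff h m = fourier_coeff f m"
    "sq_norm (\<lambda>x. h x - psum (fourier_coeff f) n x) \<le> 2 * pi * (norm (fc f - proj {- int n..int n} (fc f)))\<^sup>2"
    using riesz_fischer[of "fc f"] unfolding coord_fc[OF f] by blast
  have sh: "sq_int h" by (rule L2_torus_sq_int[OF h(1)])
  have "AE x in torus. f x = h x"
    by (rule AE_eq_if_fourier_coeff_eq[OF sq_int_integrable[OF f] sq_int_integrable[OF sh]]) (simp add: h(2))
  then have "sq_norm (\<lambda>x. f x - psum (fourier_coeff f) n x) = sq_norm (\<lambda>x. h x - psum (fourier_coeff f) n x)"
    unfolding sq_norm_def using sq_int_diff[OF f sq_int_trig] sq_int_diff[OF sh sq_int_trig]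
    by (intro integral_cong_AE) (auto simp: sq_int_def intro: borel_measurable_integrable elim: eventually_mono)
  then show ?thesis using h(3) by simp
qed

lemma sq_norm_minus_psum_tendsto:
  assumes f: "sq_int f"
  shows "(\<lambda>n. sq_norm (\<lambda>x. f x - psum (fourier_coeff f) n x)) \<longlonglongrightarrow> 0"
proof (rule tendsto_sandwich[OF _ _ tendsto_const])
  show "(\<lambda>n. 2 * pi * (norm (fc f - proj {- int n..int n} (fc f)))\<^sup>2) \<longlonglongrightarrow> 0"
    using tendsto_mult_left[OF tail_tendsto_0, of "2 * pi" "fc f"] by simp
qed (auto simp: sq_norm_nonneg sq_norm_minus_psum[OF f])

lemma parseval:
  assumes f: "sq_int f" shows "sq_norm f = 2 * pi * (norm (fc f))\<^sup>2"
proof -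
  let ?\<sigma> = "\<lambda>n. sq_norm (\<lambda>x. f x - psum (fourier_coeff f) n x)"
  have "?\<sigma> \<longlonglongrightarrow> 0" by (rule sq_norm_minus_psum_tendsto[OF f])
  moreover have "?\<sigma> \<longlonglongrightarrow> sq_norm f - 2 * pi * (norm (fc f))\<^sup>2"
    unfolding sq_norm_minus_trig[OF f finite_atLeastAtMost_int]
    by (intro tendsto_intros has_sum_int_symmetric) (use has_sum_coord_power2[of "fc f"] in \<open>simp add: coord_fc[OF f]\<close>)
  ultimately show ?thesis using LIMSEQ_unique by fastforce
qed

text \<open>Bilinear, without conjugate: the form in which test functions are paired. Bessel-type
  truncation of \<open>f\<close> gives the sum over boxes, and the error is removed by sending first
  \<open>n\<close> to infinity and then \<open>d\<close> to 0.\<close>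

lemma parseval_product:
  assumes f: "sq_int f" and g: "sq_int g"
  shows "((\<lambda>k. fourier_coeff f k * fourier_coeff g (- k)) has_sum (integral\<^sup>L torus (\<lambda>x. f x * g x) / (2 * pi))) UNIV"
proof -
  let ?p = "\<lambda>k. fourier_coeff f k * fourier_coeff g (- k)"
  have b: "(\<Sum>k\<in>A. cmod (?p k)) \<le> norm (fc f) * norm (fc g)" if "finite A" for A
    using sum_coord_mult_le[OF that, of "fc f" "reflect (fc g)"]
    by (simp add: coord_fc f g norm_mult)
  have "(\<lambda>k. cmod (?p k)) summable_on UNIV"
    by (rule nonneg_bounded_partial_sums_imp_summable_on)
      (auto intro!: eventually_finite_subsets_at_top_weakI b)
  then have "?p summable_on UNIV" by (rule abs_summable_summable)
  then have hs: "(?p has_sum infsum ?p UNIV) UNIV" by (rule has_sum_infsum)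
  define \<sigma> where "\<sigma> n = sq_norm (\<lambda>x. f x - psum (fourier_coeff f) n x)" for n
  have \<sigma>0: "\<sigma> \<longlonglongrightarrow> 0" unfolding \<sigma>_def by (rule sq_norm_minus_psum_tendsto[OF f])
  let ?I = "integral\<^sup>L torus (\<lambda>x. f x * g x)"
  have part: "integral\<^sup>L torus (\<lambda>x. psum (fourier_coeff f) n x * g x) = 2 * pi * (\<Sum>k\<in>{- int n..int n}. ?p k)" for n
  proof -
    have "integral\<^sup>L torus (\<lambda>x. psum (fourier_coeff f) n x * g x)
       = integral\<^sup>L torus (\<lambda>x. \<Sum>k\<in>{- int n..int n}. fourier_coeff f k * (g x * cexp (- (- k)) x))"
      by (simp add: trig_def sum_distrib_right sum_distrib_left mult_ac)
    also have "\<dots> = (\<Sum>k\<in>{- int n..int n}. fourier_coeff f k * integral\<^sup>L torus (\<lambda>x. g x * cexp (- (- k)) x))"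
      by (subst Bochner_Integration.integral_sum) (auto intro!: integrable_mult_right integrable_mult_cexp sq_int_integrable[OF g])
    also have "\<dots> = 2 * pi * (\<Sum>k\<in>{- int n..int n}. ?p k)"
      by (simp only: fourier_coeff_eq) (simp add: sum_distrib_left mult_ac)
    finally show ?thesis .
  qed
  have le: "cmod (?I - 2 * pi * (\<Sum>k\<in>{- int n..int n}. ?p k)) \<le> d * sq_norm g + \<sigma> n / d" if "d > 0" for n d
  proof -
    have "?I - 2 * pi * (\<Sum>k\<in>{- int n..int n}. ?p k) = integral\<^sup>L torus (\<lambda>x. (f x - psum (fourier_coeff f) n x) * g x)"
      unfolding part[symmetric] left_diff_distrib
      by (rule Bochner_Integration.integral_diff[symmetric]) (intro sq_int_mult(1) f g sq_int_trig)+
    then show ?thesis unfolding \<sigma>_def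
      using sq_int_mult(2)[OF sq_int_diff[OF f sq_int_trig] g that] by simp
  qed
  have "(\<lambda>n. ?I - 2 * pi * (\<Sum>k\<in>{- int n..int n}. ?p k)) \<longlonglongrightarrow> ?I - 2 * pi * infsum ?p UNIV"
    by (intro tendsto_intros has_sum_int_symmetric hs)
  then have lim: "(\<lambda>n. cmod (?I - 2 * pi * (\<Sum>k\<in>{- int n..int n}. ?p k))) \<longlonglongrightarrow> cmod (?I - 2 * pi * infsum ?p UNIV)"
    by (rule tendsto_norm)
  have "cmod (?I - 2 * pi * infsum ?p UNIV) \<le> d * sq_norm g" if d: "d > 0" for d
  proof (rule LIMSEQ_le[OF lim])
    show "(\<lambda>n. d * sq_norm g + \<sigma> n / d) \<longlonglongrightarrow> d * sq_norm g"
      using tendsto_add[OF tendsto_const tendsto_divide[OF \<sigma>0 tendsto_const], of d "d * sq_norm g"] d by simp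
  qed (use le[OF d] in auto)
  then have "cmod (?I - 2 * pi * infsum ?p UNIV) \<le> 0"
    using sq_norm_nonneg by (rule le_mult_eps_imp_nonpos)
  then have "infsum ?p UNIV = ?I / (2 * pi)" by simp
  then show ?thesis using hs by simp
qed

lemma fourier_coeff_mult:
  assumes f: "sq_int f" and g: "sq_int g"
  shows "((\<lambda>j. fourier_coeff f j * fourier_coeff g (k - j)) has_sum fourier_coeff (\<lambda>x. f x * g x) k) UNIV"
proof -
  have "fourier_coeff (\<lambda>x. g x * cexp (- k) x) (- j) = fourier_coeff g (k - j)" for j
    by (simp add: fourier_coeff_eq mult.assoc cexp_mult)
  then show ?thesis
    using parseval_product[OF f sq_int_mult_cexp[OF g, of "- k"]]
    by (simp add: fourier_coeff_eq[of "\<lambda>x. f x * g x"] mult.assoc)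
qed

text \<open>The absolutely convergent series defines a bounded function \<open>G\<close>; dominated
  convergence gives it the coefficients of \<open>f\<close>, and completeness identifies the
  two.\<close>

lemma AE_bounded_if_fourier_summable:
  assumes f: "sq_int f" and s: "(\<lambda>k. cmod (fourier_coeff f k)) summable_on UNIV"
  shows "AE x in torus. cmod (f x) \<le> (\<Sum>\<^sub>\<infinity>k. cmod (fourier_coeff f k))"
proof -
  let ?c = "fourier_coeff f"
  let ?B = "\<Sum>\<^sub>\<infinity>k. cmod (?c k)"
  have sx: "(\<lambda>k. ?c k * cexp k x) summable_on UNIV" for x
    by (rule abs_summable_summable) (use s in \<open>simp add: norm_mult\<close>)
  define G where "G x = (\<Sum>\<^sub>\<infinity>k. ?c k * cexp k x)" for x
  have lim: "(\<lambda>n. psum ?c n x) \<longlonglongrightarrow> G x" for x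
    unfolding trig_def G_def by (intro has_sum_int_symmetric has_sum_infsum sx)
  have bS: "cmod (psum ?c n x) \<le> ?B" for n x
    by (rule order_trans[OF norm_trig_le finite_sum_le_infsum]) (use s in auto)
  have bG: "cmod (G x) \<le> ?B" for x
    by (rule LIMSEQ_le_const2[OF tendsto_norm[OF lim]]) (use bS in auto)
  have mS: "psum ?c n \<in> borel_measurable torus" for n using sq_int_trig by (simp add: sq_int_def)
  have mG: "G \<in> borel_measurable torus"
    by (rule borel_measurable_LIMSEQ_metric[OF mS lim])
  have iG: "integrable torus G" by (rule sq_int_integrable[OF sq_int_bounded[OF mG bG]])
  have "fourier_coeff G m = ?c m" for m
  proof -
    have "(\<lambda>n. integral\<^sup>L torus (\<lambda>x. psum ?c n x * cexp (- m) x)) \<longlonglongrightarrow> integral\<^sup>L torus (\<lambda>x. G x * cexp (- m) x)"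
    proof (rule integral_dominated_convergence[where w="\<lambda>x. ?B"])
      show "AE x in torus. (\<lambda>n. psum ?c n x * cexp (- m) x) \<longlonglongrightarrow> G x * cexp (- m) x"
        by (intro AE_I2 tendsto_intros lim)
    qed (use bS mS mG in \<open>auto simp: norm_mult intro!: borel_measurable_times\<close>)
    then have "(\<lambda>n. fourier_coeff (psum ?c n) m) \<longlonglongrightarrow> fourier_coeff G m"
      unfolding fourier_coeff_eq by (intro tendsto_intros) auto
    moreover have "(\<lambda>n. fourier_coeff (psum ?c n) m) \<longlonglongrightarrow> ?c m"
      by (rule tendsto_eventually, rule eventually_sequentiallyI[of "nat \<bar>m\<bar>"])
        (auto simp: fourier_coeff_trig)
    ultimately show ?thesis by (rule LIMSEQ_unique)
  qed
  then have "AE x in torus. G x = f x"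
    by (rule AE_eq_if_fourier_coeff_eq[OF iG sq_int_integrable[OF f]])
  then show ?thesis by eventually_elim (use bG in metis)
qed

section \<open>Fourier side of the definitions\<close>

text \<open>The coefficient side of the bilinear integral of f g, up to the factor 2 pi. Being
  bounded and linear in \<open>f\<close>, it commutes with l2-valued time integrals.\<close>

definition pairing :: "int ell2 \<Rightarrow> int ell2 \<Rightarrow> complex" where
  "pairing g f = (\<Sum>\<^sub>\<infinity>k. coord f k * coord g (- k))"

lemma has_sum_pairing: "((\<lambda>k. coord f k * coord g (- k)) has_sum pairing g f) UNIV"
  and norm_pairing_le: "cmod (pairing g f) \<le> norm f * norm g"
proof -
  let ?p = "\<lambda>k. coord f k * coord g (- k)"
  have b: "(\<Sum>k\<in>A. cmod (?p k)) \<le> norm f * norm g" if "finite A" for A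
    using sum_coord_mult_le[OF that, of f "reflect g"] by (simp add: norm_mult)
  have s: "(\<lambda>k. cmod (?p k)) summable_on UNIV"
    by (rule nonneg_bounded_partial_sums_imp_summable_on)
      (auto intro!: eventually_finite_subsets_at_top_weakI b)
  show "(?p has_sum pairing g f) UNIV"
    unfolding pairing_def by (rule has_sum_infsum[OF abs_summable_summable[OF s]])
  show "cmod (pairing g f) \<le> norm f * norm g" unfolding pairing_def
    by (rule order_trans[OF norm_infsum_bound[OF s] infsum_le_finite_sums[OF s]]) (rule b)
qed

lemma bounded_linear_pairing: "bounded_linear (pairing g)"
proof (rule bounded_linear_intro[of _ "norm g"])
  fix f h :: "int ell2" and r :: real
  have "((\<lambda>k. coord (f + h) k * coord g (- k)) has_sum (pairing g f + pairing g h)) UNIV"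
    using has_sum_add[OF has_sum_pairing has_sum_pairing] by (simp add: distrib_right)
  then show "pairing g (f + h) = pairing g f + pairing g h"
    using has_sum_pairing by (rule has_sum_unique[symmetric])
  have "((\<lambda>k. coord (r *\<^sub>R f) k * coord g (- k)) has_sum (r *\<^sub>R pairing g f)) UNIV"
    using has_sum_scaleR[OF has_sum_pairing[of f g], of r] by simp
  then show "pairing g (r *\<^sub>R f) = r *\<^sub>R pairing g f"
    using has_sum_pairing by (rule has_sum_unique[symmetric])
qed (rule norm_pairing_le)

lemma integral_eq_pairing:
  assumes "sq_int f" "sq_int g"
  shows "integral\<^sup>L torus (\<lambda>x. f x * g x) = 2 * pi * pairing (fc g) (fc f)"
  using has_sum_unique[OF parseval_product[OF assms] has_sum_pairing[of "fc f" "fc g", unfolded coord_fc[OF assms(1)] coord_fc[OF assms(2)]]]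
  by (simp add: field_simps)

lemma sq_int_continuous:
  assumes "continuous_on UNIV f" shows "sq_int f"
proof -
  have "continuous_on {- pi..pi} (\<lambda>x. (cmod (f x))\<^sup>2)"
    by (intro continuous_intros continuous_on_subset[OF assms]) auto
  then show ?thesis
    using measurable_torus_continuous[OF assms] by (simp add: sq_int_def integrable_torus_continuous)
qed

lemma
  assumes \<phi>: "\<phi> \<in> test_fun"
  shows test_fun_sq_int: "sq_int \<phi>" and test_fun_Dx_sq_int: "sq_int (Dx \<phi>)"
    and fourier_coeff_Dx: "fourier_coeff (Dx \<phi>) m = \<i> * of_int m * fourier_coeff \<phi> m"
proof -
  have d0: "\<phi> differentiable (at x)" and d1: "Dx \<phi> differentiable (at x)" for x
    using \<phi> unfolding test_fun_def by (force dest: spec[of _ 0], force dest: spec[of _ 1])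
  have p: "torus_fun \<phi>" using \<phi> by (simp add: test_fun_def)
  have c0: "continuous_on UNIV \<phi>" and c1: "continuous_on UNIV (Dx \<phi>)"
    using d0 d1 by (auto intro!: continuous_at_imp_continuous_on differentiable_imp_continuous_within)
  show s0: "sq_int \<phi>" and s1: "sq_int (Dx \<phi>)" by (intro sq_int_continuous c0 c1)+
  have v: "(\<phi> has_vector_derivative Dx \<phi> x) (at x)" for x
    using d0 unfolding Dx_def by (simp add: vector_derivative_works[symmetric])
  have "integral\<^sup>L torus (\<lambda>x. \<phi> x * (\<i> * of_int (- m) * cexp (- m) x) + Dx \<phi> x * cexp (- m) x) = 0"
  proof (rule torus_integral_deriv[of "\<lambda>x. \<phi> x * cexp (- m) x"])
    show "((\<lambda>x. \<phi> x * cexp (- m) x) has_vector_derivative \<phi> x * (\<i> * of_int (- m) * cexp (- m) x) + Dx \<phi> x * cexp (- m) x) (at x)" for x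
      by (intro has_vector_derivative_mult v cexp_has_vector_derivative)
    show "continuous_on UNIV (\<lambda>x. \<phi> x * (\<i> * of_int (- m) * cexp (- m) x) + Dx \<phi> x * cexp (- m) x)"
      by (intro continuous_intros c0 c1)
    show "torus_fun (\<lambda>x. \<phi> x * cexp (- m) x)"
      by standard (simp add: periodic_fun_simple.plus_period[OF p])
  qed
  also have "(\<lambda>x. \<phi> x * (\<i> * of_int (- m) * cexp (- m) x) + Dx \<phi> x * cexp (- m) x) =
     (\<lambda>x. (- \<i> * of_int m) * (\<phi> x * cexp (- m) x) + Dx \<phi> x * cexp (- m) x)"
    by (rule ext) (simp add: mult_ac)
  also have "integral\<^sup>L torus \<dots> = (- \<i> * of_int m) * integral\<^sup>L torus (\<lambda>x. \<phi> x * cexp (- m) x) + integral\<^sup>L torus (\<lambda>x. Dx \<phi> x * cexp (- m) x)"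
  proof -
    have "integrable torus (\<lambda>x. \<phi> x * cexp (- m) x)" "integrable torus (\<lambda>x. Dx \<phi> x * cexp (- m) x)"
      by (intro integrable_mult_cexp sq_int_integrable s0 s1)+
    then show ?thesis by (subst Bochner_Integration.integral_add) (auto intro: integrable_mult_right)
  qed
  finally show "fourier_coeff (Dx \<phi>) m = \<i> * of_int m * fourier_coeff \<phi> m"
    by (simp add: fourier_coeff_eq field_simps)
qed

lemma Dx_power_cexp: "(Dx ^^ n) (cexp k) = (\<lambda>x. (\<i> * of_int k) ^ n * cexp k x)"
proof (induction n)
  case (Suc n)
  have "((\<lambda>x. (\<i> * of_int k) ^ n * cexp k x) has_vector_derivative (\<i> * of_int k) ^ n * (\<i> * of_int k * cexp k x)) (at x)" for x
    by (intro has_vector_derivative_mult_right cexp_has_vector_derivative)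
  then have "Dx (\<lambda>x. (\<i> * of_int k) ^ n * cexp k x) = (\<lambda>x. (\<i> * of_int k) ^ n * (\<i> * of_int k * cexp k x))"
    unfolding Dx_def by (intro ext vector_derivative_at)
  then show ?case by (simp add: Suc mult_ac)
qed simp

lemma cexp_test_fun: "cexp k \<in> test_fun"
proof -
  have "(\<lambda>x. (\<i> * of_int k) ^ n * cexp k x) differentiable (at x)" for n x
    using has_vector_derivative_mult_right[OF cexp_has_vector_derivative[of k x UNIV], of "(\<i> * of_int k) ^ n"]
    by (auto simp: has_vector_derivative_def differentiable_def)
  then show ?thesis by (simp add: test_fun_def Dx_power_cexp torus_fun_cexp)
qed

lemma Dx_cexp: "Dx (cexp k) = (\<lambda>x. \<i> * of_int k * cexp k x)"
  using Dx_power_cexp[of 1 k] by simp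

lemma fourier_coeff_cexp: "fourier_coeff (cexp k) m = (if m = k then 1 else 0)"
  by (simp add: fourier_coeff_eq cexp_mult torus_integral_cexp)

lemma integral_mult_cexp_uminus: "integral\<^sup>L torus (\<lambda>x. f x * cexp (- k) x) = 2 * pi * fourier_coeff f k"
  by (simp add: fourier_coeff_eq)

text \<open>Exponentials are test functions, which gives one direction; the other moves the
  multiplier onto the test function with \<open>parseval_product\<close>.\<close>

lemma is_weak_deriv_iff:
  assumes g: "sq_int g" and w: "w \<in> L2_torus"
  shows "is_weak_deriv g w \<longleftrightarrow> (\<forall>k. fourier_coeff w k = \<i> * of_int k * fourier_coeff g k)"
proof
  assume "is_weak_deriv g w"
  then have "integral\<^sup>L torus (\<lambda>x. w x * cexp (- k) x) = - integral\<^sup>L torus (\<lambda>x. g x * Dx (cexp (- k)) x)" for k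
    using cexp_test_fun by (simp add: is_weak_deriv_def)
  moreover have "integral\<^sup>L torus (\<lambda>x. g x * Dx (cexp (- k)) x) = - \<i> * of_int k * (2 * pi * fourier_coeff g k)" for k
  proof -
    have "(\<lambda>x. g x * Dx (cexp (- k)) x) = (\<lambda>x. (- \<i> * of_int k) * (g x * cexp (- k) x))"
      by (rule ext) (simp add: Dx_cexp mult_ac)
    then show ?thesis by (simp only: integral_mult_right_zero integral_mult_cexp_uminus)
  qed
  ultimately have "2 * pi * fourier_coeff w k = \<i> * of_int k * (2 * pi * fourier_coeff g k)" for k
    unfolding integral_mult_cexp_uminus by simp
  then show "\<forall>k. fourier_coeff w k = \<i> * of_int k * fourier_coeff g k" by simp
next
  assume c: "\<forall>k. fourier_coeff w k = \<i> * of_int k * fourier_coeff g k"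
  have "integral\<^sup>L torus (\<lambda>x. w x * \<phi> x) = - integral\<^sup>L torus (\<lambda>x. g x * Dx \<phi> x)" if \<phi>: "\<phi> \<in> test_fun" for \<phi>
  proof -
    have "((\<lambda>k. - (fourier_coeff g k * fourier_coeff (Dx \<phi>) (- k))) has_sum - (integral\<^sup>L torus (\<lambda>x. g x * Dx \<phi> x) / (2 * pi))) UNIV"
      by (intro has_sum_uminusI parseval_product g test_fun_Dx_sq_int \<phi>)
    moreover have "- (fourier_coeff g k * fourier_coeff (Dx \<phi>) (- k)) = fourier_coeff w k * fourier_coeff \<phi> (- k)" for k
      by (simp add: fourier_coeff_Dx[OF \<phi>] c)
    ultimately have "((\<lambda>k. fourier_coeff w k * fourier_coeff \<phi> (- k)) has_sum - (integral\<^sup>L torus (\<lambda>x. g x * Dx \<phi> x) / (2 * pi))) UNIV"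
      by simp
    from has_sum_unique[OF this parseval_product[OF L2_torus_sq_int[OF w] test_fun_sq_int[OF \<phi>]]]
    have "- (integral\<^sup>L torus (\<lambda>x. g x * Dx \<phi> x) / (2 * pi)) = integral\<^sup>L torus (\<lambda>x. w x * \<phi> x) / (2 * pi)" .
    then have "integral\<^sup>L torus (\<lambda>x. w x * \<phi> x) / (2 * pi) = (- integral\<^sup>L torus (\<lambda>x. g x * Dx \<phi> x)) / (2 * pi)" by simp
    then show ?thesis by (simp only: divide_cancel_right) simp
  qed
  then show "is_weak_deriv g w" using w by (simp add: is_weak_deriv_def)
qed

lemma W_eq_pairing:
  assumes g: "sq_int g" and \<phi>: "sq_int \<phi>"
  shows "W t g \<phi> = 2 * pi * pairing (fc \<phi>) (phase (cub t) (fc g))"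
proof -
  have "integral\<^sup>L torus (\<lambda>x. fourier_coeff g k * exp (\<i> * (of_int k * of_real x + of_real t * of_int k ^ 3)) * \<phi> x)
     = of_real (2 * pi) * (coord (phase (cub t) (fc g)) k * coord (fc \<phi>) (- k))" for k
  proof -
    have "exp (\<i> * (of_int k * of_real x + of_real t * of_int k ^ 3)) = cexp k x * cis (cub t k)" for x
      by (simp add: cexp_def cub_def cis_conv_exp exp_add[symmetric] algebra_simps)
    then have "(\<lambda>x. fourier_coeff g k * exp (\<i> * (of_int k * of_real x + of_real t * of_int k ^ 3)) * \<phi> x)
       = (\<lambda>x. (fourier_coeff g k * cis (cub t k)) * (\<phi> x * cexp (- (- k)) x))"
      by (intro ext) (simp add: mult_ac)
    then show ?thesis
      by (simp only: integral_mult_right_zero integral_mult_cexp_uminus) (simp add: coord_fc g \<phi> mult_ac)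
  qed
  then have "W t g \<phi> = (\<Sum>\<^sub>\<infinity>k. of_real (2 * pi) * (coord (phase (cub t) (fc g)) k * coord (fc \<phi>) (- k)))"
    unfolding W_def by simp
  also have "\<dots> = of_real (2 * pi) * pairing (fc \<phi>) (phase (cub t) (fc g))"
    by (rule infsumI[OF has_sum_cmult_right[OF has_sum_pairing]])
  finally show ?thesis by simp
qed

lemma L2_torus_diff:
  assumes f: "f \<in> L2_torus" and g: "g \<in> L2_torus" shows "(\<lambda>x. f x - g x) \<in> L2_torus"
proof -
  have "torus_fun (\<lambda>x. f x - g x)"
    using f g by (auto simp: L2_torus_def periodic_fun_simple_def)
  moreover have "(\<lambda>x. f x - g x) \<in> borel_measurable lebesgue"
    using f g by (intro borel_measurable_diff) (auto simp: L2_torus_def)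
  ultimately show ?thesis
    using sq_int_diff[OF L2_torus_sq_int[OF f] L2_torus_sq_int[OF g]] by (simp add: L2_torus_def sq_int_def)
qed

lemma pairing_single:
  assumes "\<And>m. coord g m = (if m = - k then 1 else 0)" shows "pairing g f = coord f k"
proof -
  have "((\<lambda>m. coord f m * coord g (- m)) has_sum coord f k) UNIV \<longleftrightarrow> ((\<lambda>m. coord f m) has_sum coord f k) {k}"
    by (rule has_sum_cong_neutral) (auto simp: assms)
  moreover have "((\<lambda>m. coord f m) has_sum coord f k) {k}" using has_sum_finite[of "{k}" "coord f"] by simp
  ultimately show ?thesis using has_sum_unique[OF has_sum_pairing] by blast
qed

section \<open>Sobolev functions as normalised coefficient sequences\<close>

context regularity
begin

definition ncoeff :: "(real \<Rightarrow> complex) \<Rightarrow> int ell2" where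
  "ncoeff g = Abs_ell2 (\<lambda>k. of_real (jap k powr s) * fourier_coeff g k)"

lemma is_J_iff: "is_J s g h \<longleftrightarrow> h \<in> L2_torus \<and> (\<forall>m. fourier_coeff h m = of_real (jap m powr s) * fourier_coeff g m)"
  unfolding is_J_def jap_powr_eq ..

lemma
  assumes g: "g \<in> Hs_torus s"
  shows coord_ncoeff: "coord (ncoeff g) k = of_real (jap k powr s) * fourier_coeff g k"
    and Hs_norm_eq: "Hs_norm s g = sqrt (2 * pi) * norm (ncoeff g)"
    and Hs_sq_int: "sq_int g"
proof -
  obtain h where "is_J s g h" using g by (auto simp: Hs_torus_def)
  then have J: "is_J s g (J s g)" unfolding J_def by (rule someI[of "is_J s g"])
  then have L: "sq_int (J s g)" by (auto simp: is_J_iff intro: L2_torus_sq_int)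
  have "fourier_coeff (J s g) = (\<lambda>k. of_real (jap k powr s) * fourier_coeff g k)"
    using J by (auto simp: is_J_iff)
  then have ncoeff: "ncoeff g = fc (J s g)" by (simp add: ncoeff_def fc_def)
  show "coord (ncoeff g) k = of_real (jap k powr s) * fourier_coeff g k"
    unfolding ncoeff coord_fc[OF L] using J by (simp add: is_J_iff)
  show "Hs_norm s g = sqrt (2 * pi) * norm (ncoeff g)"
    using parseval[OF L] by (simp add: Hs_norm_def L2_torus_norm_def sq_norm_def ncoeff real_sqrt_mult)
  show "sq_int g" using g by (auto simp: Hs_torus_def intro: L2_torus_sq_int)
qed

lemma powr_minus_s: "jap k powr (- s) * jap k powr s = 1"
  by (simp flip: powr_add)

lemma coord_fc_Hs: "g \<in> Hs_torus s \<Longrightarrow> fourier_coeff g k = of_real (jap k powr (- s)) * coord (ncoeff g) k"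
  using powr_minus_s[of k] by (simp add: coord_ncoeff mult.assoc[symmetric] flip: of_real_mult)

lemma ncoeff_inj_AE:
  assumes "f \<in> Hs_torus s" "g \<in> Hs_torus s" "ncoeff f = ncoeff g"
  shows "AE x in torus. f x = g x"
  by (rule AE_eq_if_fourier_coeff_eq) (use assms in \<open>auto simp: coord_fc_Hs intro: sq_int_integrable Hs_sq_int\<close>)

lemma ex_Hs: "\<exists>g\<in>Hs_torus s. ncoeff g = c"
proof -
  obtain h where h: "h \<in> L2_torus" "\<And>m. fourier_coeff h m = coord c m"
    using riesz_fischer[of c] by blast
  obtain g where g: "g \<in> L2_torus" "\<And>m. fourier_coeff g m = coord (damp c) m"
    using riesz_fischer[of "damp c"] by blast
  have "is_J s g h"
    using h g by (simp add: is_J_iff mult.assoc[symmetric] mult.commute[of "jap _ powr s"] powr_minus_s flip: of_real_mult)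
  then have gH: "g \<in> Hs_torus s" using g by (auto simp: Hs_torus_def)
  have "ncoeff g = c"
    by (rule ell2_eqI) (simp add: coord_ncoeff[OF gH] g mult.assoc[symmetric] mult.commute[of "jap _ powr s"] powr_minus_s flip: of_real_mult)
  then show ?thesis using gH by blast
qed

lemma
  assumes f: "f \<in> Hs_torus s" and g: "g \<in> Hs_torus s"
  shows Hs_diff: "(\<lambda>x. f x - g x) \<in> Hs_torus s" and ncoeff_diff: "ncoeff (\<lambda>x. f x - g x) = ncoeff f - ncoeff g"
proof -
  obtain h where h: "h \<in> L2_torus" "\<And>m. fourier_coeff h m = coord (ncoeff f - ncoeff g) m"
    using riesz_fischer[of "ncoeff f - ncoeff g"] by blast
  have c: "fourier_coeff (\<lambda>x. f x - g x) m = fourier_coeff f m - fourier_coeff g m" for m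
    by (intro fourier_coeff_diff sq_int_integrable Hs_sq_int f g)
  have "is_J s (\<lambda>x. f x - g x) h"
    using h by (simp add: is_J_iff c coord_ncoeff f g right_diff_distrib)
  then show H: "(\<lambda>x. f x - g x) \<in> Hs_torus s"
    using f g L2_torus_diff by (auto simp: Hs_torus_def)
  show "ncoeff (\<lambda>x. f x - g x) = ncoeff f - ncoeff g"
    by (rule ell2_eqI) (simp add: coord_ncoeff[OF H] coord_ncoeff f g c right_diff_distrib)
qed

lemma C_Hs_iff:
  "u \<in> C_Hs T s \<longleftrightarrow> (\<forall>t\<in>{- T..T}. u t \<in> Hs_torus s) \<and> continuous_on {- T..T} (\<lambda>t. ncoeff (u t))"
proof -
  have "(((\<lambda>t'. Hs_norm s (\<lambda>x. u t' x - u t x)) \<longlongrightarrow> 0) (at t within {- T..T})) \<longleftrightarrow>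
      ((\<lambda>t. ncoeff (u t)) \<longlongrightarrow> ncoeff (u t)) (at t within {- T..T})"
    if H: "\<forall>t\<in>{- T..T}. u t \<in> Hs_torus s" and t: "t \<in> {- T..T}" for t
  proof -
    have "((\<lambda>t'. Hs_norm s (\<lambda>x. u t' x - u t x)) \<longlongrightarrow> 0) (at t within {- T..T}) \<longleftrightarrow>
        ((\<lambda>t'. sqrt (2 * pi) * dist (ncoeff (u t')) (ncoeff (u t))) \<longlongrightarrow> 0) (at t within {- T..T})"
    proof (rule tendsto_cong)
      \<comment> \<open>\<open>J\<close> is a choice and has the expected norm only for elements of
        H^s; the filter restricts \<open>t'\<close> to times at which \<open>u t'\<close> is
        one.\<close>
      show "\<forall>\<^sub>F t' in at t within {- T..T}. Hs_norm s (\<lambda>x. u t' x - u t x) = sqrt (2 * pi) * dist (ncoeff (u t')) (ncoeff (u t))"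
        unfolding eventually_at_filter
        by (rule always_eventually) (use H t in \<open>simp add: Hs_norm_eq Hs_diff ncoeff_diff dist_norm\<close>)
    qed
    also have "\<dots> \<longleftrightarrow> ((\<lambda>t'. dist (ncoeff (u t')) (ncoeff (u t))) \<longlongrightarrow> 0) (at t within {- T..T})"
      using tendsto_mult_left_iff[of "sqrt (2 * pi)" "\<lambda>t'. dist (ncoeff (u t')) (ncoeff (u t))" 0] by simp
    also have "\<dots> \<longleftrightarrow> ((\<lambda>t. ncoeff (u t)) \<longlongrightarrow> ncoeff (u t)) (at t within {- T..T})"
      by (rule tendsto_dist_iff[symmetric])
    finally show ?thesis .
  qed
  then show ?thesis unfolding C_Hs_def continuous_on_def by blast
qed

lemma jap_powr_minus_le_wt: "jap k powr (- s) \<le> wt k"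
  using inverse_jap_powr_le_wt[of k] by (simp add: powr_minus_divide)

text \<open>Sobolev embedding: the coefficients are absolutely summable by Cauchy-Schwarz against
  \<open>wt\<close>.\<close>

lemma Hs_bounded:
  assumes g: "g \<in> Hs_torus s"
  shows "\<exists>B\<ge>0. AE x in torus. cmod (g x) \<le> B"
proof -
  have b: "(\<Sum>k\<in>A. cmod (fourier_coeff g k)) \<le> norm wtv * norm (ncoeff g)" if "finite A" for A
  proof -
    have "(\<Sum>k\<in>A. cmod (fourier_coeff g k)) \<le> (\<Sum>k\<in>A. wt k * cmod (coord (ncoeff g) k))"
      unfolding coord_fc_Hs[OF g] norm_mult
      by (intro sum_mono mult_right_mono) (use jap_powr_minus_le_wt in auto)
    also have "\<dots> \<le> norm wtv * norm (ncoeff g)" by (rule sum_wt_coord_le[OF that])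
    finally show ?thesis .
  qed
  have "(\<lambda>k. cmod (fourier_coeff g k)) summable_on UNIV"
    by (rule nonneg_bounded_partial_sums_imp_summable_on)
      (auto intro!: eventually_finite_subsets_at_top_weakI b)
  from AE_bounded_if_fourier_summable[OF Hs_sq_int[OF g] this] show ?thesis
    by (intro exI[of _ "\<Sum>\<^sub>\<infinity>k. cmod (fourier_coeff g k)"]) (auto intro: infsum_nonneg)
qed

lemma weak_deriv_Hs:
  assumes g: "g \<in> Hs_torus s"
  shows "sq_int (weak_deriv g)" and "fourier_coeff (weak_deriv g) k = \<i> * of_int k * fourier_coeff g k"
proof -
  define m where "m k = real_of_int k * jap k powr (- s)" for k
  have m: "\<bar>m k\<bar> \<le> 1" for k
  proof -
    have "\<bar>m k\<bar> \<le> jap k * jap k powr (- s)"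
      unfolding m_def abs_mult by (intro mult_mono abs_le_jap) auto
    also have "\<dots> = jap k powr (1 - s)" by (simp add: powr_diff powr_minus_divide)
    also have "\<dots> \<le> 1" using s_gt_1 by (intro jap_powr_le_1) auto
    finally show ?thesis .
  qed
  \<comment> \<open>The constant phase \<open>pi / 2\<close> is multiplication by the imaginary
    unit.\<close>
  obtain w where w: "w \<in> L2_torus" "\<And>k. fourier_coeff w k = coord (phase (\<lambda>k. pi / 2) (diag m (ncoeff g))) k"
    using riesz_fischer by blast
  have "fourier_coeff w k = \<i> * of_int k * fourier_coeff g k" for k
    by (simp add: w coord_diag[OF m] coord_fc_Hs[OF g]) (simp add: m_def mult_ac)
  then have "is_weak_deriv g w" using is_weak_deriv_iff[OF Hs_sq_int[OF g] w(1)] by blast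
  then have wd: "is_weak_deriv g (weak_deriv g)" unfolding weak_deriv_def by (rule someI[of "is_weak_deriv g"])
  then have L: "weak_deriv g \<in> L2_torus" by (simp add: is_weak_deriv_def)
  then show "sq_int (weak_deriv g)" by (rule L2_torus_sq_int)
  show "fourier_coeff (weak_deriv g) k = \<i> * of_int k * fourier_coeff g k"
    using wd is_weak_deriv_iff[OF Hs_sq_int[OF g] L] by blast
qed

lemma fourier_coeff_cnj: "fourier_coeff (\<lambda>x. cnj (f x)) m = cnj (fourier_coeff f (- m))"
proof -
  have "(\<lambda>x. cnj (f x) * cexp (- m) x) = (\<lambda>x. cnj (f x * cexp m x))"
    by (rule ext) (simp add: cnj_cexp)
  then have "integral\<^sup>L torus (\<lambda>x. cnj (f x) * cexp (- m) x) = cnj (integral\<^sup>L torus (\<lambda>x. f x * cexp m x))"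
    by (simp only: Bochner_Integration.integral_cnj)
  then show ?thesis by (simp add: fourier_coeff_eq)
qed

text \<open>Boundedness of \<open>g\<close> keeps both partial products in L2, so the convolution
  formula applies twice. The resulting iterated sum is compared with the unordered sum over pairs
  that defines \<open>tri\<close>.\<close>

lemma
  assumes g: "g \<in> Hs_torus s"
  shows nonlin_sq_int: "sq_int (nonlin g)"
    and nonlin_coeff: "of_real (jap k powr s) * (6 * fourier_coeff (nonlin g) k) =
      of_real (jap k) * coord (tri symNf (ncoeff g) (reflect (ncoeff g)) (ncoeff g)) k"
proof -
  let ?w = "weak_deriv g"
  obtain B where B: "B \<ge> 0" "AE x in torus. cmod (g x) \<le> B" using Hs_bounded[OF g] by blast
  have sg: "sq_int g" by (rule Hs_sq_int[OF g])
  have sgc: "sq_int (\<lambda>x. cnj (g x))" by (rule sq_int_cnj[OF sg])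
  have sw: "sq_int ?w" by (rule weak_deriv_Hs(1)[OF g])
  have s1: "sq_int (\<lambda>x. cnj (g x) * ?w x)"
    by (rule sq_int_mult_bounded[OF sw _ _ B(1)]) (use sgc B(2) in \<open>auto simp: sq_int_def\<close>)
  have s2: "sq_int (\<lambda>x. g x * (cnj (g x) * ?w x))"
    by (rule sq_int_mult_bounded[OF s1 _ B(2) B(1)]) (use sg in \<open>auto simp: sq_int_def\<close>)
  have n: "nonlin g = (\<lambda>x. g x * (cnj (g x) * ?w x))"
    by (rule ext) (simp only: nonlin_def complex_norm_square mult.assoc)
  show "sq_int (nonlin g)" unfolding n by (rule s2)
  let ?f = "ncoeff g"
  let ?c = "of_real (6 * jap k powr (s - 1)) :: complex"
  have inner: "((\<lambda>y. tri_term symNf ?f (reflect ?f) ?f k (x, y)) has_sum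
      ?c * (fourier_coeff g x * fourier_coeff (\<lambda>x. cnj (g x) * ?w x) (k - x))) UNIV" for x
  proof -
    have "((\<lambda>y. ?c * (fourier_coeff g x * (fourier_coeff (\<lambda>x. cnj (g x)) y * fourier_coeff ?w (k - x - y)))) has_sum
      ?c * (fourier_coeff g x * fourier_coeff (\<lambda>x. cnj (g x) * ?w x) (k - x))) UNIV"
      by (intro has_sum_cmult_right fourier_coeff_mult sgc sw)
    moreover have "?c * (fourier_coeff g x * (fourier_coeff (\<lambda>x. cnj (g x)) y * fourier_coeff ?w (k - x - y)))
       = tri_term symNf ?f (reflect ?f) ?f k (x, y)" for y
    proof -
      have 1: "tri_term symNf ?f (reflect ?f) ?f k (x, y) = 
         (6 * \<i> * of_int (k - x - y) * of_real (jap k powr (s - 1) / pw x y (k - x - y))) *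
         (of_real (jap x powr s) * fourier_coeff g x) * cnj (of_real (jap y powr s) * fourier_coeff g (- y))
         * (of_real (jap (k - x - y) powr s) * fourier_coeff g (k - x - y))"
        by (simp add: tri_term_def symNf_def coord_ncoeff[OF g])
      have 2: "complex_of_real (jap k powr (s - 1) / pw x y (k - x - y)) * of_real (jap x powr s) * of_real (jap y powr s) * of_real (jap (k - x - y) powr s)
         = of_real (jap k powr (s - 1))"
        unfolding of_real_mult[symmetric] using pw_pos[of x y "k - x - y"] by (simp add: pw_def)
      show ?thesis
        unfolding 1 fourier_coeff_cnj weak_deriv_Hs(2)[OF g] of_real_mult 2[symmetric]
        by (simp add: mult_ac)
    qed
    ultimately show ?thesis by simp
  qed
  have "(tri_term symNf ?f (reflect ?f) ?f k has_sum coord (tri symNf ?f (reflect ?f) ?f) k) (UNIV \<times> UNIV)"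
    using has_sum_tri[OF sym_bound_Nf] by simp
  from has_sum_SigmaD[OF this inner]
  have "((\<lambda>x. ?c * (fourier_coeff g x * fourier_coeff (\<lambda>x. cnj (g x) * ?w x) (k - x))) has_sum
      coord (tri symNf ?f (reflect ?f) ?f) k) UNIV" by simp
  moreover have "((\<lambda>x. ?c * (fourier_coeff g x * fourier_coeff (\<lambda>x. cnj (g x) * ?w x) (k - x))) has_sum
      ?c * fourier_coeff (nonlin g) k) UNIV"
    unfolding n by (intro has_sum_cmult_right fourier_coeff_mult sg s1)
  ultimately have "coord (tri symNf ?f (reflect ?f) ?f) k = ?c * fourier_coeff (nonlin g) k"
    by (rule has_sum_unique)
  moreover have "jap k powr s = jap k * jap k powr (s - 1)" by (simp add: powr_diff)
  ultimately show "of_real (jap k powr s) * (6 * fourier_coeff (nonlin g) k) =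
      of_real (jap k) * coord (tri symNf ?f (reflect ?f) ?f) k"
    by simp
qed

lemma fc_Hs:
  assumes g: "g \<in> Hs_torus s"
  shows "fc g = damp (ncoeff g)"
  by (rule ell2_eqI) (simp add: coord_fc[OF Hs_sq_int[OF g]] coord_fc_Hs[OF g])

lemma jap_powr_1_minus_s: "jap k powr (1 - s) = jap k powr (- s) * jap k"
  by (simp add: powr_diff powr_minus_divide)

lemma fourier_coeff_nonlin:
  assumes g: "g \<in> Hs_torus s"
  shows "6 * fourier_coeff (nonlin g) k =
    of_real (jap k powr (1 - s)) * coord (tri symNf (ncoeff g) (reflect (ncoeff g)) (ncoeff g)) k"
proof -
  have "6 * fourier_coeff (nonlin g) k = of_real (jap k powr (- s)) * (of_real (jap k powr s) * (6 * fourier_coeff (nonlin g) k))"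
    using powr_minus_s[of k] by (simp add: mult.assoc[symmetric] flip: of_real_mult)
  also have "\<dots> = of_real (jap k powr (- s)) * (of_real (jap k) * coord (tri symNf (ncoeff g) (reflect (ncoeff g)) (ncoeff g)) k)"
    unfolding nonlin_coeff[OF g] ..
  finally show ?thesis using jap_powr_1_minus_s[of k] by (simp add: mult.assoc)
qed

section \<open>From the Duhamel formula to the coefficient equations and back\<close>

lemma has_vector_derivative_duhamel:
  assumes T: "T > 0" and c: "continuous_on {- T..T} F" and t: "t \<in> {- T..T}"
    and eq: "\<And>t. t \<in> {- T..T} \<Longrightarrow> f t = a + (LBINT t'=ereal 0..ereal t. F t')"
  shows "(f has_vector_derivative (F t :: complex)) (at t within {- T..T})"
proof -
  have "((\<lambda>u. LBINT y=0..u. F y) has_vector_derivative F t) (at t within {- T..T})"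
    using interval_integral_FTC2[of "- T" 0 T F t] T t c by (simp add: zero_ereal_def)
  from has_vector_derivative_add[OF has_vector_derivative_const[of a] this]
  have "((\<lambda>u. a + (LBINT y=0..u. F y)) has_vector_derivative F t) (at t within {- T..T})" by simp
  then show ?thesis
    by (rule has_vector_derivative_transform[OF t, rotated]) (simp add: eq zero_ereal_def)
qed

lemma continuous_on_nonlinearity:
  assumes "continuous_on S c"
  shows "continuous_on S (\<lambda>t. tri symNf (c t) (reflect (c t)) (c t))"
  using assms continuous_on_reflect[OF assms] unfolding continuous_on_def
  by (auto intro!: tendsto_tri[OF sym_bound_Nf])

text \<open>Testing with \<open>cexp (- k)\<close> isolates the coefficient at \<open>k\<close>.
  After multiplication by \<open>cis (- cub t k)\<close> the upper time \<open>t\<close> of the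
  propagator leaves the integrand, and Duhamel's formula becomes a plain primitive of a continuous
  function.\<close>

lemma strong_solution_imp_usol:
  assumes T: "T > 0" and u0: "u0 \<in> Hs_torus s" and u: "strong_solution s T u0 u"
  shows "usol T (ncoeff u0) (\<lambda>t. ncoeff (u t))"
proof -
  have H: "u t \<in> Hs_torus s" if "t \<in> {- T..T}" for t
    using u that by (simp add: strong_solution_def C_Hs_iff)
  have cu: "continuous_on {- T..T} (\<lambda>t. ncoeff (u t))"
    using u by (simp add: strong_solution_def C_Hs_iff)
  let ?N = "\<lambda>t k. coord (tri symNf (ncoeff (u t)) (reflect (ncoeff (u t))) (ncoeff (u t))) k"
  let ?F = "\<lambda>k t. cis (- cub t k) * (of_real (jap k) * ?N t k)"
  have cF: "continuous_on {- T..T} (?F k)" for k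
    unfolding cub_def cis_conv_exp by (intro continuous_intros continuous_on_nonlinearity cu)
  have coeff: "cis (- cub t k) * coord (ncoeff (u t)) k = coord (ncoeff u0) k + (LBINT t'=ereal 0..ereal t. ?F k t')"
    if t: "t \<in> {- T..T}" for t k
  proof -
    have sgl: "coord (fc (cexp (- k))) m = (if m = - k then 1 else 0)" for m
      by (simp add: coord_fc sq_int_cexp fourier_coeff_cexp)
    have W: "W r g (cexp (- k)) = 2 * pi * (cis (cub r k) * fourier_coeff g k)" if "sq_int g" for r g
      unfolding W_eq_pairing[OF that sq_int_cexp] pairing_single[OF sgl] by (simp add: coord_fc that)
    define I where "I = (LBINT t'=ereal 0..ereal t. ?F k t')"
    have "integral\<^sup>L torus (\<lambda>x. u t x * cexp (- k) x) =
        W t u0 (cexp (- k)) + 6 * (LBINT t'=ereal 0..ereal t. W (t - t') (nonlin (u t')) (cexp (- k)))"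
      using u t cexp_test_fun by (simp add: strong_solution_def)
    \<comment> \<open>\<open>symNf\<close> already contains the 6 of the equation, hence the
      division by 6.\<close>
    also have "(LBINT t'=ereal 0..ereal t. W (t - t') (nonlin (u t')) (cexp (- k))) =
        (LBINT t'=ereal 0..ereal t. (2 * pi * cis (cub t k) * of_real (jap k powr (- s)) / 6) * ?F k t')"
    proof (rule interval_integral_cong)
      fix r assume "r \<in> einterval (min (ereal 0) (ereal t)) (max (ereal 0) (ereal t))"
      then have r: "r \<in> {- T..T}" using t T by (auto simp: einterval_def min_def max_def split: if_splits)
      have "W (t - r) (nonlin (u r)) (cexp (- k)) = 2 * pi * (cis (cub (t - r) k) * (6 * fourier_coeff (nonlin (u r)) k)) / 6"
        by (simp add: W nonlin_sq_int[OF H[OF r]])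
      also have "\<dots> = 2 * pi * (cis (cub (t - r) k) * (of_real (jap k powr (1 - s)) * ?N r k)) / 6"
        unfolding fourier_coeff_nonlin[OF H[OF r]] ..
      also have "cis (cub (t - r) k) = cis (cub t k) * cis (- cub r k)"
        unfolding cis_mult by (simp add: cub_def left_diff_distrib)
      also note jap_powr_1_minus_s
      finally show "W (t - r) (nonlin (u r)) (cexp (- k)) = (2 * pi * cis (cub t k) * of_real (jap k powr (- s)) / 6) * ?F k r"
        by (simp add: mult_ac)
    qed
    finally have "integral\<^sup>L torus (\<lambda>x. u t x * cexp (- k) x) =
        W t u0 (cexp (- k)) + 6 * ((2 * pi * cis (cub t k) * of_real (jap k powr (- s)) / 6) * I)"
      unfolding I_def interval_lebesgue_integral_mult_right .
    then have "(2 * of_real pi) * fourier_coeff (u t) k =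
        (2 * of_real pi) * (cis (cub t k) * (fourier_coeff u0 k + of_real (jap k powr (- s)) * I))"
      unfolding integral_mult_cexp_uminus W[OF Hs_sq_int[OF u0]] by (simp add: algebra_simps)
    then have "fourier_coeff (u t) k = cis (cub t k) * (fourier_coeff u0 k + of_real (jap k powr (- s)) * I)"
      by (subst (asm) mult_cancel_left) simp
    then have "of_real (jap k powr s) * (cis (- cub t k) * fourier_coeff (u t) k) =
        of_real (jap k powr s) * ((cis (- cub t k) * cis (cub t k)) * (fourier_coeff u0 k + of_real (jap k powr (- s)) * I))"
      by (simp add: mult.assoc)
    also have "\<dots> = of_real (jap k powr s) * fourier_coeff u0 k + of_real (jap k powr (- s) * jap k powr s) * I"
      unfolding cis_mult by (simp add: algebra_simps)
    finally have "cis (- cub t k) * coord (ncoeff (u t)) k = coord (ncoeff u0) k + I"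
      unfolding powr_minus_s by (simp add: coord_ncoeff[OF H[OF t]] coord_ncoeff[OF u0] mult_ac)
    then show ?thesis unfolding I_def .
  qed
  show ?thesis
    unfolding usol_def
  proof (intro conjI ballI allI cu)
    show "ncoeff (u 0) = ncoeff u0"
      using coeff[of 0] T by (intro ell2_eqI) (simp add: cub_def)
    fix t k assume t: "t \<in> {- T..T}"
    show "((\<lambda>t. cis (- cub t k) * coord (ncoeff (u t)) k) has_vector_derivative ?F k t) (at t within {- T..T})"
      by (rule has_vector_derivative_duhamel[OF T cF t coeff])
  qed
qed

text \<open>Pairing with a test function is bounded and linear on l2, so it suffices to have
  Duhamel's formula for the coefficient sequences as an l2-valued integral, and this is checked one
  coordinate at a time.\<close>

lemma usol_imp_strong_solution:
  assumes T: "T > 0" and u0: "u0 \<in> Hs_torus s" and c: "usol T (ncoeff u0) c"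
  shows "\<exists>u. strong_solution s T u0 u \<and> (\<forall>t\<in>{- T..T}. u t \<in> Hs_torus s \<and> ncoeff (u t) = c t)"
proof -
  have "\<forall>t. \<exists>g. g \<in> Hs_torus s \<and> ncoeff g = c t" using ex_Hs by blast
  then obtain u where u: "\<And>t. u t \<in> Hs_torus s" "\<And>t. ncoeff (u t) = c t" by metis
  have cc: "continuous_on {- T..T} c" using c by (simp add: usol_def)
  let ?tri = "\<lambda>t. tri symNf (c t) (reflect (c t)) (c t)"
  \<comment> \<open>The values of \<open>symNf\<close> are normalised for H^(s-1); this multiplier
    turns them into Fourier coefficients. It is at most 1, so \<open>n\<close> is continuous with
    values in l2.\<close>
  define m where "m k = jap k powr (1 - s)" for k
  have m: "\<bar>m k\<bar> \<le> 1" for k using jap_powr_le_1[of "1 - s" k] s_gt_1 by (simp add: m_def)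
  define n where "n t = diag m (?tri t)" for t
  have cn: "continuous_on {- T..T} n"
    unfolding n_def by (intro continuous_on_diag m continuous_on_nonlinearity cc)
  have n_coord: "coord (n t) k = 6 * fourier_coeff (nonlin (u t)) k" for t k
    unfolding n_def coord_diag[OF m] fourier_coeff_nonlin[OF u(1)] u(2) m_def ..
  have n_fc: "n t = 6 *\<^sub>R fc (nonlin (u t))" for t
    by (rule ell2_eqI) (simp add: n_coord coord_fc[OF nonlin_sq_int[OF u(1)]] scaleR_conv_of_real)
  have "(\<integral>x. u t x * \<phi> x \<partial>torus) = W t u0 \<phi> + 6 * (LBINT t'=ereal 0..ereal t. W (t - t') (nonlin (u t')) \<phi>)"
    if t: "t \<in> {- T..T}" and \<phi>: "\<phi> \<in> test_fun" for t \<phi>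
  proof -
    have s\<phi>: "sq_int \<phi>" by (rule test_fun_sq_int[OF \<phi>])
    let ?p = "pairing (fc \<phi>)"
    interpret p: bounded_linear ?p by (rule bounded_linear_pairing)
    define P where "P r = phase (cub (t - r)) (n r)" for r
    have cP: "continuous_on {- T..T} P"
      unfolding P_def by (intro continuous_on_phase cn) (unfold cub_def, intro continuous_intros)
    have cpP: "continuous_on {- T..T} (\<lambda>r. ?p (P r))" by (intro p.continuous_on cP)
    have sum: "fc (u t) = phase (cub t) (fc u0) + sint T P t"
    proof (rule ell2_eqI)
      fix k
      let ?f = "\<lambda>r. (cis (cub t k) * of_real (jap k powr (- s))) * (cis (- cub r k) * coord (c r) k)"
      have d: "(?f has_vector_derivative coord (P r) k) (at r within {- T..T})" if r: "r \<in> {- T..T}" for r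
      proof -
        have "(?f has_vector_derivative (cis (cub t k) * of_real (jap k powr (- s))) *
            (cis (- cub r k) * (of_real (jap k) * coord (?tri r) k))) (at r within {- T..T})"
          by (rule has_vector_derivative_mult_right) (use c r in \<open>simp add: usol_def\<close>)
        moreover have "(cis (cub t k) * of_real (jap k powr (- s))) * (cis (- cub r k) * (of_real (jap k) * coord (?tri r) k)) = coord (P r) k"
        proof -
          have 1: "cis (cub (t - r) k) = cis (cub t k) * cis (- cub r k)"
            unfolding cis_mult by (simp add: cub_def left_diff_distrib)
          show ?thesis unfolding P_def n_def coord_phase coord_diag[OF m] m_def 1 jap_powr_1_minus_s by (simp add: mult_ac)
        qed
        ultimately show ?thesis by simp
      qed
      have "coord (sint T P t) k = sint T (\<lambda>r. coord (P r) k) t"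
      proof -
        have "integral {- T..b} (\<lambda>r. coord (P r) k) = coord (integral {- T..b} P) k" if "b \<in> {- T..T}" for b
          using integral_linear[OF integrable_continuous_real bounded_linear_coord, of "- T" b P k]
            continuous_on_subset[OF cP, of "{- T..b}"] that by (simp add: o_def)
        then show ?thesis using t T by (simp add: sint_def)
      qed
      then have "?f t = ?f 0 + coord (sint T P t) k" using eq_sint[OF d t] by simp
      moreover have "?f t = coord (fc (u t)) k"
      proof -
        have "cis (cub t k) * cis (- cub t k) = 1" unfolding cis_mult by simp
        then have "?f t = of_real (jap k powr (- s)) * coord (c t) k"
          by (simp add: mult.commute mult.left_commute)
        then show ?thesis by (simp add: fc_Hs[OF u(1)] u(2))
      qed
      moreover have "?f 0 = coord (phase (cub t) (fc u0)) k"
        using c by (simp add: usol_def fc_Hs[OF u0] cub_def)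
      ultimately show "coord (fc (u t)) k = coord (phase (cub t) (fc u0) + sint T P t) k" by simp
    qed
    have "(LBINT r=ereal 0..ereal t. ?p (P r)) = ?p (sint T P t) - ?p (sint T P 0)"
    proof (rule interval_integral_FTC_finite)
      have sub: "{min 0 t..max 0 t} \<subseteq> {- T..T}" using t T by auto
      show "continuous_on {min 0 t..max 0 t} (\<lambda>r. ?p (P r))" by (rule continuous_on_subset[OF cpP sub])
      fix r assume "min 0 t \<le> r" "r \<le> max 0 t"
      then have r: "r \<in> {- T..T}" using sub by auto
      show "((\<lambda>r. ?p (sint T P r)) has_vector_derivative ?p (P r)) (at r within {min 0 t..max 0 t})"
        by (rule has_vector_derivative_within_subset[OF p.has_vector_derivative[OF has_vector_derivative_sint[OF cP r]] sub])
    qed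
    then have ftc: "(LBINT r=ereal 0..ereal t. ?p (P r)) = ?p (sint T P t)" by (simp add: p.zero)
    have Wn: "W (t - r) (nonlin (u r)) \<phi> = (2 * pi / 6) * ?p (P r)" for r
    proof -
      have "P r = 6 *\<^sub>R phase (cub (t - r)) (fc (nonlin (u r)))"
        unfolding P_def n_fc by (rule ell2_eqI) simp
      then show ?thesis
        unfolding W_eq_pairing[OF nonlin_sq_int[OF u(1)] s\<phi>] by (simp add: p.scaleR scaleR_conv_of_real)
    qed
    have "(\<integral>x. u t x * \<phi> x \<partial>torus) = 2 * pi * ?p (fc (u t))"
      by (rule integral_eq_pairing[OF Hs_sq_int[OF u(1)] s\<phi>])
    also have "\<dots> = W t u0 \<phi> + 2 * pi * ?p (sint T P t)"
      unfolding sum p.add W_eq_pairing[OF Hs_sq_int[OF u0] s\<phi>] by (simp add: distrib_left)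
    also have "2 * pi * ?p (sint T P t) = 6 * (LBINT r=ereal 0..ereal t. W (t - r) (nonlin (u r)) \<phi>)"
      unfolding Wn interval_lebesgue_integral_mult_right ftc by simp
    finally show ?thesis .
  qed
  moreover have "u \<in> C_Hs T s" unfolding C_Hs_iff using u cc by simp
  ultimately have "strong_solution s T u0 u" by (simp add: strong_solution_def)
  then show ?thesis using u by blast
qed

theorem local_well_posedness:
  "\<exists>T :: real \<Rightarrow> real. (\<forall>r\<ge>0. T r > 0) \<and>
    (\<forall>u0 \<in> Hs_torus s.
       \<exists>u. strong_solution s (T (Hs_norm s u0)) u0 u \<and>
         (\<forall>v. strong_solution s (T (Hs_norm s u0)) u0 v \<longrightarrow>
            (\<forall>t\<in>{- T (Hs_norm s u0)..T (Hs_norm s u0)}. AE x in torus. v t x = u t x)))"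
proof -
  \<comment> \<open>\<open>Hs_norm\<close> is \<open>sqrt (2 * pi)\<close> times the l2 norm of the
    normalised coefficients; choosing one time for each radius yields \<open>T\<close> as a function
    of the norm alone.\<close>
  have "\<exists>T. T > 0 \<and> (\<forall>c0. norm c0 \<le> r / sqrt (2 * pi) \<longrightarrow> (\<exists>c. usol T c0 c))" if "r \<ge> 0" for r
    using usol_exists[of "r / sqrt (2 * pi)"] that by auto
  then obtain T where T: "\<And>r. r \<ge> 0 \<Longrightarrow> T r > 0"
    "\<And>r c0. r \<ge> 0 \<Longrightarrow> norm c0 \<le> r / sqrt (2 * pi) \<Longrightarrow> \<exists>c. usol (T r) c0 c"
    by metis
  have "\<exists>u. strong_solution s (T (Hs_norm s u0)) u0 u \<and>
         (\<forall>v. strong_solution s (T (Hs_norm s u0)) u0 v \<longrightarrow>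
            (\<forall>t\<in>{- T (Hs_norm s u0)..T (Hs_norm s u0)}. AE x in torus. v t x = u t x))"
    if u0: "u0 \<in> Hs_torus s" for u0
  proof -
    let ?r = "Hs_norm s u0"
    have r: "?r \<ge> 0" by (simp add: Hs_norm_eq[OF u0])
    have "norm (ncoeff u0) \<le> ?r / sqrt (2 * pi)" by (simp add: Hs_norm_eq[OF u0])
    then obtain c where c: "usol (T ?r) (ncoeff u0) c" using T(2)[OF r] by blast
    obtain u where u: "strong_solution s (T ?r) u0 u" "\<And>t. t \<in> {- T ?r..T ?r} \<Longrightarrow> u t \<in> Hs_torus s \<and> ncoeff (u t) = c t"
      using usol_imp_strong_solution[OF T(1)[OF r] u0 c] by blast
    have "AE x in torus. v t x = u t x" if v: "strong_solution s (T ?r) u0 v" and t: "t \<in> {- T ?r..T ?r}" for v t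
    proof (rule ncoeff_inj_AE)
      show "v t \<in> Hs_torus s" using v t by (simp add: strong_solution_def C_Hs_iff)
      show "u t \<in> Hs_torus s" using u(2)[OF t] by blast
      have "ncoeff (v t) = c t"
        by (rule usol_unique[OF strong_solution_imp_usol[OF T(1)[OF r] u0 v] c t])
      then show "ncoeff (v t) = ncoeff (u t)" using u(2)[OF t] by simp
    qed
    then show ?thesis using u(1) by blast
  qed
  then show ?thesis using T(1) by blast
qed

end

theorem theorem1p2:
  fixes s :: real
  assumes "s > 4 / 3"
  shows "\<exists>T :: real \<Rightarrow> real. (\<forall>r\<ge>0. T r > 0) \<and>
    (\<forall>u0 \<in> Hs_torus s.
       \<exists>u. strong_solution s (T (Hs_norm s u0)) u0 u \<and>
         (\<forall>v. strong_solution s (T (Hs_norm s u0)) u0 v \<longrightarrow>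
            (\<forall>t\<in>{- T (Hs_norm s u0)..T (Hs_norm s u0)}. AE x in torus. v t x = u t x)))"
proof -
  interpret regularity s by standard (use assms in simp)
  show ?thesis by (rule local_well_posedness)
qed

end
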